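(* Let $n\ge1$ be an integer, $\mathcal{M}$ a subset of $\mathbb{R}^m$, $\Omega\subset\mathbb{R}^N$ an open set and $D\subset\Omega$ an $\mathcal{H}^{N-1}$ $\sigma$-finite Borel set. Let $F\in C\big(\mathbb{R}^{m\times N^n}\times\mathbb{R}^{m\times N^{n-1}}\times\ldots\times\mathbb{R}^{m\times N}\times\mathbb{R}^m\times\mathbb{R}^N,\mathbb{R}\big)$ satisfy $F\ge0$ and the following property: for every $x_0\in\Omega$ and every $\tau>0$ there exists $\alpha>0$ such that $$F(a_1,a_2,\ldots,a_n,b,x)-F(a_1,a_2,\ldots,a_n,b,x_0)\ge-\tau F(a_1,a_2,\ldots,a_n,b,x_0)$$ for all $a_1\in\mathbb{R}^{m\times N^n}$, $a_2\in\mathbb{R}^{m\times N^{n-1}}$, $\ldots$, $a_n\in\mathbb{R}^{m\times N}$, $b\in\mathbb{R}^m$ and all $x\in\mathbb{R}^N$ with $|x-x_0|<\alpha$. Let $\vec A\in\mathcal{L}(\mathbb{R}^{d\times N};\mathbb{R}^m)$ be a linear operator, $q=(q_1,\ldots,q_m)\in\mathbb{R}^m$ with $q_j\ge1$ for all $j$, $p\ge1$, and let $v\in\mathcal{D}'(\Omega,\mathbb{R}^d)$ be such that $\vec A\cdot\nabla v\in L^q_{loc}(\Omega,\mathbb{R}^m)$ and $$F\big(0,0,\ldots,0,\{\vec A\cdot\nabla v\}(x),x\big)=0\quad\text{for a.e. }x\in\Omega.$$ Assume also that there exist three Borel mappings $\{\vec A\cdot\nabla v\}^+:D\to\mathbb{R}^m$,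 $\{\vec A\cdot\nabla v\}^-:D\to\mathbb{R}^m$ and $\vec n:D\to S^{N-1}$ such that for every $x\in D$ $$\lim_{\rho\to0^+}\frac{\int_{B_\rho^+(x,\vec n(x))}\big|\{\vec A\cdot\nabla v\}(y)-\{\vec A\cdot\nabla v\}^+(x)\big|^q dy}{\mathcal{L}^N(B_\rho(x))}=0,\qquad \lim_{\rho\to0^+}\frac{\int_{B_\rho^-(x,\vec n(x))}\big|\{\vec A\cdot\nabla v\}(y)-\{\vec A\cdot\nabla v\}^-(x)\big|^q dy}{\mathcal{L}^N(B_\rho(x))}=0 .$$ Then for every $\{v_\varepsilon\}_{\varepsilon>0}\subset\mathcal{D}'(\Omega,\mathbb{R}^d)$ satisfying $\vec A\cdot\nabla v_\varepsilon\in L^q_{loc}(\Omega,\mathbb{R}^m)\cap W^{n,p}_{loc}(\Omega,\mathbb{R}^m)$, $\{\vec A\cdot\nabla v_\varepsilon\}(x)\in\mathcal{M}$ for a.e. $x\in\Omega$, and $\vec A\cdot\nabla v_\varepsilon\to\vec A\cdot\nabla v$ in $L^q_{loc}(\Omega,\mathbb{R}^m)$ as $\varepsilon\to0^+$, we have $$\liminf_{\varepsilon\to0^+}\frac1\varepsilon\int_\Omega F\big(\varepsilon^n\nabla^n\{\vec A\cdot\nabla v_\varepsilon\}(x),\varepsilon^{n-1}\nabla^{n-1}\{\vec A\cdot\nabla v_\varepsilon\}(x),\ldots,\varepsilon\nabla\{\vec A\cdot\nabla v_\varepsilon\}(x),\{\vec A\cdot\nabla v_\varepsilon\}(x),x\big)dx$$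 $$\ge\ \int_D E^{(n)}_0\big(\{\vec A\cdot\nabla v\}^+(x),\{\vec A\cdot\nabla v\}^-(x),\vec n(x),x\big)d\mathcal{H}^{N-1}(x),$$ where for every $x\in\mathbb{R}^N$, $a,b\in\mathbb{R}^m$ and unit vector $\vec\nu\in\mathbb{R}^N$ $$E^{(n)}_0(a,b,\vec\nu,x):=\inf\Big\{\liminf_{\varepsilon\to0^+}\frac1\varepsilon\int_{I_{\vec\nu}}F\big(\varepsilon^n\nabla^n\{\vec A\cdot\nabla\varphi_\varepsilon\}(y),\ldots,\varepsilon\nabla\{\vec A\cdot\nabla\varphi_\varepsilon\}(y),\{\vec A\cdot\nabla\varphi_\varepsilon\}(y),x\big)dy\Big\},$$ the infimum being over all families $\{\varphi_\varepsilon\}_{\varepsilon>0}\subset\mathcal{D}'(I_{\vec\nu},\mathbb{R}^d)$ with $\vec A\cdot\nabla\varphi_\varepsilon\in L^q(I_{\vec\nu},\mathbb{R}^m)\cap W^{n,p}(I_{\vec\nu},\mathbb{R}^m)$, $\vec A\cdot\nabla\varphi_\varepsilon\in\mathcal{M}$ a.e. in $I_{\vec\nu}$, and $\{\vec A\cdot\nabla\varphi_\varepsilon\}(y)\to\xi(y,a,b,\vec\nu)$ in $L^q(I_{\vec\nu},\mathbb{R}^m)$ as $\varepsilon\to0^+$.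
   Context: $I_{\vec\nu}:=\{y\in\mathbb{R}^N:\ |y\cdot\vec\nu_j|<1/2\ \ \forall j=1,\ldots,N\}$, where $\{\vec\nu_1,\ldots,\vec\nu_N\}\subset\mathbb{R}^N$ is an orthonormal basis of $\mathbb{R}^N$ with $\vec\nu_1:=\vec\nu$. The function $\xi$ is defined by $\xi(y,a,b,\vec\nu):=a$ if $y\cdot\vec\nu>0$ and $:=b$ if $y\cdot\vec\nu<0$. $\mathcal{D}'(\Omega,\mathbb{R}^d)$ is the space of $\mathbb{R}^d$-valued distributions; $\vec A\cdot\nabla v$ is the linear operator $\vec A$ applied to the distributional gradient $\nabla v$. $B_\rho(x)$ is the open ball of radius $\rho$ centred at $x$, and $B_\rho^{\pm}(x,\vec n):=\{y\in B_\rho(x):\ \pm(y-x)\cdot\vec n>0\}$. $\mathcal{L}^N$ is Lebesgue measure, $\mathcal{H}^{N-1}$ is Hausdorff measure. For a vector exponent $q=(q_1,\ldots,q_m)$ with $q_j\ge1$ and an open set $U\subset\mathbb{R}^N$: $L^q(U,\mathbb{R}^m)$ is the space of $f=(f_1,\ldots,f_m)$ with $f_j\in L^{q_j}(U,\mathbb{R})$, with norm $\sum_j\|f_j\|_{L^{q_j}(U)}$; $L^q_{loc}(U,\mathbb{R}^m)$ is the space of functions whose restriction to every $V\subset\subset U$ lies in $L^q(V,\mathbb{R}^m)$; and for $z\in\mathbb{R}^m$, $|z|^q:=\sum_{j=1}^m|z_j|^{q_j}$. *)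

theory Defs
  imports "HOL-Analysis.Analysis"
begin

section \<open>Test functions and distributions\<close>

definition partial :: "'N::finite \<Rightarrow> (real^'N \<Rightarrow> real) \<Rightarrow> real^'N \<Rightarrow> real" where
  "partial j f = (\<lambda>x. frechet_derivative f (at x) (axis j 1))"

text \<open>Multi-indices are words: \<open>partials [j\<^sub>1, \<dots>, j\<^sub>k] f\<close> is the iterated partial derivative
  in the directions \<open>j\<^sub>1, \<dots>, j\<^sub>k\<close>.\<close>

definition partials :: "'N::finite list \<Rightarrow> (real^'N \<Rightarrow> real) \<Rightarrow> real^'N \<Rightarrow> real" where
  "partials \<alpha> f = foldr partial \<alpha> f"

definition smooth :: "(real^'N::finite \<Rightarrow> real) \<Rightarrow> bool" where
  "smooth f \<longleftrightarrow> (\<forall>\<alpha> x. partials \<alpha> f differentiable (at x))"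

definition supp :: "(real^'N::finite \<Rightarrow> real) \<Rightarrow> (real^'N) set" where
  "supp f = closure {x. f x \<noteq> 0}"

definition test_fun :: "(real^'N::finite) set \<Rightarrow> (real^'N \<Rightarrow> real) set" where
  "test_fun U = {\<phi>. smooth \<phi> \<and> compact (supp \<phi>) \<and> supp \<phi> \<subseteq> U}"

text \<open>\<open>\<real>\<^sup>d\<close>-valued distributions on \<open>U\<close>: linear functionals on the test functions, continuous in
  the sense of the usual seminorm estimates on each compact subset.  Values of \<open>v\<close> off
  \<open>test_fun U\<close> carry no information.\<close>

definition distribution ::
  "(real^'N::finite) set \<Rightarrow> ((real^'N \<Rightarrow> real) \<Rightarrow> real^'d::finite) \<Rightarrow> bool" where
  "distribution U v \<longleftrightarrow>
     (\<forall>\<phi>\<in>test_fun U. \<forall>\<psi>\<in>test_fun U. v (\<lambda>x. \<phi> x + \<psi> x) = v \<phi> + v \<psi>) \<and>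
     (\<forall>\<phi>\<in>test_fun U. \<forall>c. v (\<lambda>x. c * \<phi> x) = c *\<^sub>R v \<phi>) \<and>
     (\<forall>K. compact K \<and> K \<subseteq> U \<longrightarrow>
        (\<exists>C k. \<forall>\<phi>\<in>test_fun U. supp \<phi> \<subseteq> K \<longrightarrow>
           norm (v \<phi>) \<le> C * (\<Sum>\<alpha> | length \<alpha> \<le> k. SUP x. \<bar>partials \<alpha> \<phi> x\<bar>)))"

text \<open>The distributional gradient, with entry \<open>\<partial>\<^sub>j v\<^sub>i\<close> in row \<open>i\<close> and column \<open>j\<close>, and
  its image under a linear operator \<open>A\<close> on \<open>d \<times> N\<close> matrices.\<close>

definition dist_grad ::
  "((real^'N::finite \<Rightarrow> real) \<Rightarrow> real^'d::finite) \<Rightarrow> (real^'N \<Rightarrow> real) \<Rightarrow> real^'N^'d" where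
  "dist_grad v \<phi> = (\<chi> i j. - (v (partial j \<phi>) $ i))"

definition A_grad ::
  "(real^'N::finite^'d::finite \<Rightarrow> real^'m::finite) \<Rightarrow> ((real^'N \<Rightarrow> real) \<Rightarrow> real^'d)
     \<Rightarrow> (real^'N \<Rightarrow> real) \<Rightarrow> real^'m" where
  "A_grad A v \<phi> = A (dist_grad v \<phi>)"

definition compactly_inside :: "(real^'N::finite) set \<Rightarrow> (real^'N) set \<Rightarrow> bool" where
  "compactly_inside V U \<longleftrightarrow> open V \<and> compact (closure V) \<and> closure V \<subseteq> U"

definition loc_integrable :: "(real^'N::finite) set \<Rightarrow> (real^'N \<Rightarrow> real^'m::finite) \<Rightarrow> bool" where
  "loc_integrable U w \<longleftrightarrow> (\<forall>V. compactly_inside V U \<longrightarrow> integrable (lebesgue_on V) w)"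

text \<open>The distribution \<open>T\<close> on \<open>U\<close> is given by the locally integrable function \<open>w\<close>.\<close>

definition represented_by ::
  "(real^'N::finite) set \<Rightarrow> ((real^'N \<Rightarrow> real) \<Rightarrow> real^'m::finite) \<Rightarrow> (real^'N \<Rightarrow> real^'m) \<Rightarrow> bool" where
  "represented_by U T w \<longleftrightarrow> loc_integrable U w \<and>
     (\<forall>\<phi>\<in>test_fun U. T \<phi> = (LINT x|lebesgue_on U. \<phi> x *\<^sub>R w x))"

section \<open>Lebesgue spaces with a vector exponent and Sobolev spaces\<close>

definition powq :: "real^'m::finite \<Rightarrow> real^'m \<Rightarrow> real" where
  "powq z q = (\<Sum>j\<in>UNIV. \<bar>z $ j\<bar> powr (q $ j))"

definition Lq :: "(real^'N::finite) set \<Rightarrow> real^'m::finite \<Rightarrow> (real^'N \<Rightarrow> real^'m) set" where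
  "Lq U q = {f. \<forall>j. (\<lambda>x. f x $ j) \<in> borel_measurable (lebesgue_on U) \<and>
                    integrable (lebesgue_on U) (\<lambda>x. \<bar>f x $ j\<bar> powr (q $ j))}"

definition Lq_loc :: "(real^'N::finite) set \<Rightarrow> real^'m::finite \<Rightarrow> (real^'N \<Rightarrow> real^'m) set" where
  "Lq_loc U q = {f. \<forall>V. compactly_inside V U \<longrightarrow> f \<in> Lq V q}"

definition Lq_norm ::
  "(real^'N::finite) set \<Rightarrow> real^'m::finite \<Rightarrow> (real^'N \<Rightarrow> real^'m) \<Rightarrow> real" where
  "Lq_norm U q f = (\<Sum>j\<in>UNIV. (LINT x|lebesgue_on U. \<bar>f x $ j\<bar> powr (q $ j)) powr (1 / q $ j))"

definition tendsto_Lq ::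
  "(real^'N::finite) set \<Rightarrow> real^'m::finite \<Rightarrow> (real \<Rightarrow> real^'N \<Rightarrow> real^'m) \<Rightarrow> (real^'N \<Rightarrow> real^'m)
     \<Rightarrow> bool" where
  "tendsto_Lq U q f g \<longleftrightarrow> ((\<lambda>\<epsilon>. Lq_norm U q (\<lambda>x. f \<epsilon> x - g x)) \<longlongrightarrow> 0) (at_right 0)"

definition tendsto_Lq_loc ::
  "(real^'N::finite) set \<Rightarrow> real^'m::finite \<Rightarrow> (real \<Rightarrow> real^'N \<Rightarrow> real^'m) \<Rightarrow> (real^'N \<Rightarrow> real^'m)
     \<Rightarrow> bool" where
  "tendsto_Lq_loc U q f g \<longleftrightarrow> (\<forall>V. compactly_inside V U \<longrightarrow> tendsto_Lq V q f g)"

definition is_weak_deriv ::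
  "(real^'N::finite) set \<Rightarrow> 'N list \<Rightarrow> (real^'N \<Rightarrow> real^'m::finite) \<Rightarrow> (real^'N \<Rightarrow> real^'m) \<Rightarrow> bool" where
  "is_weak_deriv U \<alpha> w g \<longleftrightarrow> loc_integrable U g \<and>
     (\<forall>\<phi>\<in>test_fun U. (LINT x|lebesgue_on U. \<phi> x *\<^sub>R g x)
        = (- 1) ^ length \<alpha> *\<^sub>R (LINT x|lebesgue_on U. partials \<alpha> \<phi> x *\<^sub>R w x))"

text \<open>The weak derivative is only determined almost everywhere; a representative is chosen.\<close>

definition weak_deriv ::
  "(real^'N::finite) set \<Rightarrow> 'N list \<Rightarrow> (real^'N \<Rightarrow> real^'m::finite) \<Rightarrow> real^'N \<Rightarrow> real^'m" where
  "weak_deriv U \<alpha> w = (SOME g. is_weak_deriv U \<alpha> w g)"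

definition sobolev ::
  "(real^'N::finite) set \<Rightarrow> nat \<Rightarrow> real \<Rightarrow> (real^'N \<Rightarrow> real^'m::finite) set" where
  "sobolev U n p = {w. w \<in> Lq U (vec p) \<and>
     (\<forall>\<alpha>. length \<alpha> \<le> n \<longrightarrow> (\<exists>g. is_weak_deriv U \<alpha> w g \<and> g \<in> Lq U (vec p)))}"

definition sobolev_loc ::
  "(real^'N::finite) set \<Rightarrow> nat \<Rightarrow> real \<Rightarrow> (real^'N \<Rightarrow> real^'m::finite) set" where
  "sobolev_loc U n p = {w. w \<in> Lq_loc U (vec p) \<and>
     (\<forall>\<alpha>. length \<alpha> \<le> n \<longrightarrow> (\<exists>g. is_weak_deriv U \<alpha> w g \<and> g \<in> Lq_loc U (vec p)))}"

section \<open>Hausdorff measure\<close>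

text \<open>The \<open>k\<close>-dimensional Hausdorff measure with the normalisation under which it agrees with
  Lebesgue measure for \<open>k = N\<close>.  The empty set needs a separate clause because \<open>0 ^ 0 = 1\<close>;
  boundedness of the covering sets is explicit because \<^const>\<open>diameter\<close> is unspecified on
  unbounded sets.\<close>

definition hausdorff_gauge :: "nat \<Rightarrow> (real^'N::finite) set \<Rightarrow> real" where
  "hausdorff_gauge k S = (if S = {} then 0 else unit_ball_vol (real k) * (diameter S / 2) ^ k)"

definition hausdorff_pre :: "nat \<Rightarrow> real \<Rightarrow> (real^'N::finite) set \<Rightarrow> ennreal" where
  "hausdorff_pre k \<delta> E =
     (INF C \<in> {C :: nat \<Rightarrow> (real^'N) set. E \<subseteq> (\<Union>i. C i) \<and> (\<forall>i. bounded (C i) \<and> diameter (C i) \<le> \<delta>)}.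
        \<Sum>i. ennreal (hausdorff_gauge k (C i)))"

definition hausdorff_outer :: "nat \<Rightarrow> (real^'N::finite) set \<Rightarrow> ennreal" where
  "hausdorff_outer k E = (SUP \<delta>\<in>{0<..}. hausdorff_pre k \<delta> E)"

text \<open>\<^const>\<open>lambda_system\<close> is the \<open>\<sigma>\<close>-algebra of Caratheodory measurable sets.\<close>

definition hausdorff_measure :: "nat \<Rightarrow> (real^'N::finite) measure" where
  "hausdorff_measure k =
     measure_of UNIV (lambda_system UNIV (Pow UNIV) (hausdorff_outer k)) (hausdorff_outer k)"

section \<open>The energy and the jump density\<close>

definition orthonormal_basis :: "(real^'N::finite) set \<Rightarrow> bool" where
  "orthonormal_basis B \<longleftrightarrow> pairwise orthogonal B \<and> (\<forall>u\<in>B. norm u = 1) \<and> span B = UNIV"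

definition unit_cube :: "(real^'N::finite) set \<Rightarrow> (real^'N) set" where
  "unit_cube B = {y. \<forall>u\<in>B. \<bar>y \<bullet> u\<bar> < 1/2}"

definition half_ball :: "real \<Rightarrow> real^'N::finite \<Rightarrow> real^'N \<Rightarrow> (real^'N) set" where
  "half_ball \<rho> x \<nu> = {y \<in> ball x \<rho>. (y - x) \<bullet> \<nu> > 0}"

text \<open>The value on the hyperplane \<open>y \<bullet> \<nu> = 0\<close>, which is a null set, is immaterial.\<close>

definition \<xi> :: "real^'N::finite \<Rightarrow> real^'m::finite \<Rightarrow> real^'m \<Rightarrow> real^'N \<Rightarrow> real^'m" where
  "\<xi> y a b \<nu> = (if y \<bullet> \<nu> > 0 then a else b)"

text \<open>A tuple \<open>(a\<^sub>1, \<dots>, a\<^sub>n, b)\<close> in \<open>\<real>\<^bsup>m\<times>N^n\<^esup> \<times> \<dots> \<times> \<real>\<^bsup>m\<times>N\<^esup> \<times> \<real>\<^sup>m\<close> is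
  encoded as one function \<open>J\<close> on words over the coordinate indices: the words of length \<open>k\<close> index
  the \<open>N^k\<close> columns of the factor \<open>\<real>\<^bsup>m\<times>N^k\<^esup>\<close>, so \<open>a\<^sub>i\<close> is \<open>J\<close> restricted to the words
  of length \<open>n + 1 - i\<close> and \<open>b = J []\<close>.  \<open>J\<close> vanishes on words longer than \<open>n\<close>, so
  \<open>jets n\<close> with the product topology of the function space is linearly homeomorphic to this
  finite-dimensional space.\<close>

definition jets :: "nat \<Rightarrow> ('N::finite list \<Rightarrow> real^'m::finite) set" where
  "jets n = {J. \<forall>\<alpha>. n < length \<alpha> \<longrightarrow> J \<alpha> = 0}"

text \<open>\<open>(\<epsilon>\<^sup>n \<nabla>\<^sup>n w(x), \<dots>, \<epsilon> \<nabla>w(x), w(x))\<close>, the weak derivatives being taken on \<open>U\<close>.\<close>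

definition scaled_jet ::
  "(real^'N::finite) set \<Rightarrow> nat \<Rightarrow> real \<Rightarrow> (real^'N \<Rightarrow> real^'m::finite) \<Rightarrow> real^'N
     \<Rightarrow> 'N list \<Rightarrow> real^'m" where
  "scaled_jet U n \<epsilon> w x = (\<lambda>\<alpha>. if \<alpha> = [] then w x
     else if length \<alpha> \<le> n then \<epsilon> ^ length \<alpha> *\<^sub>R weak_deriv U \<alpha> w x
     else 0)"

text \<open>The arguments \<open>\<Phi>\<close> and \<open>W\<close> range over families of distributions \<open>\<phi>\<^sub>\<epsilon>\<close> and functions
  \<open>w\<^sub>\<epsilon>\<close> representing \<open>A \<cdot> \<nabla>\<phi>\<^sub>\<epsilon>\<close>.  \<open>B \<nu>\<close> is the orthonormal basis containing \<open>\<nu>\<close>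
  that determines the cube.\<close>

definition admissible ::
  "nat \<Rightarrow> real \<Rightarrow> real^'m \<Rightarrow> (real^'N^'d \<Rightarrow> real^'m) \<Rightarrow> (real^'m) set \<Rightarrow> (real^'N \<Rightarrow> (real^'N) set)
     \<Rightarrow> real^'m \<Rightarrow> real^'m \<Rightarrow> real^'N
     \<Rightarrow> (real \<Rightarrow> (real^'N::finite \<Rightarrow> real) \<Rightarrow> real^'d::finite)
     \<Rightarrow> (real \<Rightarrow> real^'N \<Rightarrow> real^'m::finite) \<Rightarrow> bool" where
  "admissible n p q A M B a b \<nu> \<Phi> W \<longleftrightarrow> (let I = unit_cube (B \<nu>) in
     (\<forall>\<epsilon>>0. distribution I (\<Phi> \<epsilon>) \<and> represented_by I (A_grad A (\<Phi> \<epsilon>)) (W \<epsilon>) \<and>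
             W \<epsilon> \<in> Lq I q \<inter> sobolev I n p \<and> (AE y in lebesgue_on I. W \<epsilon> y \<in> M)) \<and>
     tendsto_Lq I q W (\<lambda>y. \<xi> y a b \<nu>))"

definition E0 ::
  "nat \<Rightarrow> real \<Rightarrow> real^'m \<Rightarrow> (real^'N^'d \<Rightarrow> real^'m) \<Rightarrow> (real^'m) set
     \<Rightarrow> (('N list \<Rightarrow> real^'m) \<Rightarrow> real^'N \<Rightarrow> real) \<Rightarrow> (real^'N::finite \<Rightarrow> (real^'N) set)
     \<Rightarrow> real^'m::finite \<Rightarrow> real^'m \<Rightarrow> real^'N \<Rightarrow> real^'N \<Rightarrow> ennreal" where
  "E0 n p q A M F B a b \<nu> x =
     Inf {Liminf (at_right 0) (\<lambda>\<epsilon>. ennreal (1 / \<epsilon>) *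
            (\<integral>\<^sup>+y. ennreal (F (scaled_jet (unit_cube (B \<nu>)) n \<epsilon> (W \<epsilon>) y) x)
               \<partial>lebesgue_on (unit_cube (B \<nu>))))
          | (\<Phi> :: real \<Rightarrow> (real^'N \<Rightarrow> real) \<Rightarrow> real^'d::finite) W.
              admissible n p q A M B a b \<nu> \<Phi> W}"

end

theory Submission
  imports Defs
begin

text \<open>
  No limit measure of the energies is needed. For a Borel set \<open>S\<close> let \<open>m(S)\<close> be the lower limit of the
  energies on \<open>S\<close>; it is superadditive on disjoint sets. Let \<open>x \<in> D\<close> and \<open>t < E\<^sub>0(x)\<close>. If
  \<open>m(B\<^sub>\<rho>(x)) < t \<omega> \<rho>^(N-1)\<close>, with \<open>\<omega>\<close> the volume of the unit ball of \<open>\<real>^(N-1)\<close>, held for all small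
  \<open>\<rho>\<close>, then choose \<open>\<rho> \<rightarrow> 0\<close> and after it \<open>\<epsilon>\<close> much smaller than \<open>\<rho>\<close>. Nearly fill the disc
  orthogonal to the normal by small cubes of the given orientation and rescale the cube of least energy to
  the unit cube; the resulting sequence is admissible for \<open>E\<^sub>0(x)\<close> and has energy below it, a
  contradiction. Hence \<open>m\<close> has upper \<open>(N-1)\<close>-density at least \<open>E\<^sub>0(x)\<close> at every \<open>x \<in> D\<close>, and a Vitali
  covering argument turns this into \<open>t H(E) \<le> m(U)\<close> for \<open>U\<close> open and \<open>E \<subseteq> U \<inter> {E\<^sub>0 > t}\<close>. The level sets of a
  simple function below \<open>E\<^sub>0\<close> are approximated from inside by disjoint compact sets, which have disjoint
  open neighbourhoods, so superadditivity of \<open>m\<close> sums these bounds.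
\<close>

section \<open>Hausdorff measure\<close>

text \<open>Competitors for \<open>E0\<close> live on the unit cube and carry no boundary condition,
  so a restriction of the given sequence can be rescaled into one without cutting off or gluing.
  What remains is a geometric mismatch: Hausdorff measure is normalised by discs and
  \<open>E0\<close> by cubes, and a single cube inscribed in a ball would cost a dimensional
  constant. Packing the disc by many small cubes makes this loss arbitrarily small. The choice of
  \<epsilon> after \<rho> is forced because on a ball of radius \<rho> the integrated q-th power
  distance from the two-valued jump function must be small compared with \<rho>^N. The nonnegative
  integral is a supremum over simple functions, so bounding these one at a time treats the
  right-hand side without studying how \<open>E0\<close> depends on x. Inner regularity needs level
  sets of finite Hausdorff measure; the density inequality itself provides this when the lower limit
  on \<Omega> is finite. Since \<open>weak_deriv\<close> is a choice among representatives,
  rescaling also rests on uniqueness of weak derivatives almost everywhere, hence on the fundamental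
  lemma of the calculus of variations.\<close>

lemma hausdorff_gauge_nonneg: "bounded S \<Longrightarrow> 0 \<le> hausdorff_gauge k S"
  by (simp add: hausdorff_gauge_def diameter_ge_0)

lemma hausdorff_pre_le_sum:
  assumes "E \<subseteq> (\<Union>i. C i)" "\<And>i. bounded (C i)" "\<And>i. diameter (C i) \<le> \<delta>"
  shows "hausdorff_pre k \<delta> E \<le> (\<Sum>i. ennreal (hausdorff_gauge k (C i)))"
  unfolding hausdorff_pre_def by (rule INF_lower) (use assms in auto)

lemma hausdorff_pre_approx:
  assumes "hausdorff_pre k \<delta> E < \<infinity>" "0 < e"
  obtains C where "E \<subseteq> (\<Union>i. C i)" "\<And>i. bounded (C i)" "\<And>i. diameter (C i) \<le> \<delta>"
    "(\<Sum>i. ennreal (hausdorff_gauge k (C i))) < hausdorff_pre k \<delta> E + ennreal e"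
proof -
  have "\<exists>C\<in>{C :: nat \<Rightarrow> (real^'a) set. E \<subseteq> (\<Union>i. C i) \<and> (\<forall>i. bounded (C i) \<and> diameter (C i) \<le> \<delta>)}.
     (\<Sum>i. ennreal (hausdorff_gauge k (C i))) < hausdorff_pre k \<delta> E + ennreal e"
    by (rule INF_approx_ennreal[OF assms(2) hausdorff_pre_def]) (use assms in auto)
  then show ?thesis using that by auto
qed

lemma hausdorff_pre_mono: "E \<subseteq> E' \<Longrightarrow> hausdorff_pre k \<delta> E \<le> hausdorff_pre k \<delta> E'"
  unfolding hausdorff_pre_def by (rule INF_superset_mono) auto

lemma hausdorff_pre_antimono: "\<delta> \<le> \<delta>' \<Longrightarrow> hausdorff_pre k \<delta>' E \<le> hausdorff_pre k \<delta> E"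
  unfolding hausdorff_pre_def by (rule INF_superset_mono) (auto intro: order_trans)

lemma hausdorff_pre_empty: "0 < \<delta> \<Longrightarrow> hausdorff_pre k \<delta> {} = 0"
  using hausdorff_pre_le_sum[of "{}" "\<lambda>_. {}" \<delta> k] by (simp add: hausdorff_gauge_def)

text \<open>Near-optimal covers of the \<open>A i\<close>, with errors e/2^(i+1) that sum to e, are
  merged into one sequence by \<open>prod_decode\<close>.\<close>

lemma hausdorff_pre_subadditive:
  "hausdorff_pre k \<delta> (\<Union>i. A i) \<le> (\<Sum>i. hausdorff_pre k \<delta> (A i))"
proof (cases "(\<Sum>i. hausdorff_pre k \<delta> (A i)) = \<infinity>")
  let ?g = "\<lambda>S. ennreal (hausdorff_gauge k S)"
  case False
  let ?P = "\<lambda>i. hausdorff_pre k \<delta> (A i)"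
  have fin: "?P i < \<infinity>" for i
    using False ennreal_suminf_lessD[of ?P \<infinity> i] by (auto simp: top.not_eq_extremum)
  show ?thesis
  proof (rule ennreal_le_epsilon)
    fix e :: real assume "e > 0"
    then have e2: "e * (1/2)^Suc i > 0" for i by simp
    have "\<exists>C. A i \<subseteq> (\<Union>j. C j) \<and> (\<forall>j. bounded (C j)) \<and> (\<forall>j. diameter (C j) \<le> \<delta>) \<and>
        (\<Sum>j. ?g (C j)) < ?P i + ennreal (e * (1/2)^Suc i)" for i
      using hausdorff_pre_approx[OF fin e2, of i i] by metis
    then obtain C where C: "\<And>i. A i \<subseteq> (\<Union>j. C i j)" "\<And>i j. bounded (C i j)" "\<And>i j. diameter (C i j) \<le> \<delta>"
        "\<And>i. (\<Sum>j. ?g (C i j)) < ?P i + ennreal (e * (1/2)^Suc i)"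
      by metis
    have "hausdorff_pre k \<delta> (\<Union>i. A i) \<le> (\<Sum>i. ?g ((\<lambda>(i,j). C i j) (prod_decode i)))"
    proof (rule hausdorff_pre_le_sum)
      show "\<Union> (range A) \<subseteq> (\<Union>i. case prod_decode i of (i, j) \<Rightarrow> C i j)"
      proof safe
        fix x i assume "x \<in> A i"
        then obtain j where "x \<in> C i j" using C(1) by blast
        then show "x \<in> (\<Union>i. case prod_decode i of (i, j) \<Rightarrow> C i j)"
          by (intro UN_I[of "prod_encode (i,j)"]) auto
      qed
    qed (use C in \<open>auto split: prod.split\<close>)
    also have "\<dots> = (\<Sum>i. \<Sum>j. ?g (C i j))"
      by (rule suminf_ennreal_2dimen[where f="\<lambda>p. ?g ((\<lambda>(i,j). C i j) p)"]) simp
    also have "\<dots> \<le> (\<Sum>i. ?P i + ennreal (e * (1/2)^Suc i))"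
      by (intro suminf_le) (use C(4) less_imp_le in auto)
    also have "\<dots> = (\<Sum>i. ?P i) + (\<Sum>i. ennreal (e * (1/2)^Suc i))"
      by (intro suminf_add[symmetric]) auto
    also have "(\<Sum>i. ennreal (e * (1/2)^Suc i)) = ennreal e"
      using \<open>e > 0\<close> sums_mult[OF power_half_series, of e] by (intro suminf_ennreal_eq) auto
    finally show "hausdorff_pre k \<delta> (\<Union>i. A i) \<le> (\<Sum>i. ?P i) + ennreal e" .
  qed
qed auto

lemma hausdorff_pre_le_outer: "0 < \<delta> \<Longrightarrow> hausdorff_pre k \<delta> E \<le> hausdorff_outer k E"
  unfolding hausdorff_outer_def by (rule SUP_upper) auto

lemma hausdorff_outer_le:
  "(\<And>\<delta>. 0 < \<delta> \<Longrightarrow> hausdorff_pre k \<delta> E \<le> c) \<Longrightarrow> hausdorff_outer k E \<le> c"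
  unfolding hausdorff_outer_def by (rule SUP_least) auto

lemma hausdorff_outer_mono: "E \<subseteq> E' \<Longrightarrow> hausdorff_outer k E \<le> hausdorff_outer k E'"
  by (meson hausdorff_outer_le hausdorff_pre_le_outer hausdorff_pre_mono order_trans)

lemma hausdorff_outer_empty: "hausdorff_outer k {} = 0"
  using hausdorff_outer_le[of k "{}" 0] by (simp add: hausdorff_pre_empty)

lemma hausdorff_outer_subadditive:
  "hausdorff_outer k (\<Union>i. A i) \<le> (\<Sum>i. hausdorff_outer k (A i))"
proof (rule hausdorff_outer_le)
  fix \<delta> :: real assume "0 < \<delta>"
  have "hausdorff_pre k \<delta> (\<Union>i. A i) \<le> (\<Sum>i. hausdorff_pre k \<delta> (A i))"
    by (rule hausdorff_pre_subadditive)
  also have "\<dots> \<le> (\<Sum>i. hausdorff_outer k (A i))"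
    by (intro suminf_le hausdorff_pre_le_outer \<open>0 < \<delta>\<close>) auto
  finally show "hausdorff_pre k \<delta> (\<Union>i. A i) \<le> (\<Sum>i. hausdorff_outer k (A i))" .
qed

lemma outer_measure_space_hausdorff: "outer_measure_space (Pow UNIV) (hausdorff_outer k)"
  unfolding outer_measure_space_def positive_def increasing_def countably_subadditive_def
  using hausdorff_outer_subadditive by (auto simp: hausdorff_outer_empty intro: hausdorff_outer_mono)

lemma hausdorff_outer_Un_le: "hausdorff_outer k (A \<union> B) \<le> hausdorff_outer k A + hausdorff_outer k B"
proof -
  let ?A = "\<lambda>i::nat. if i = 0 then A else if i = 1 then B else {}"
  have "hausdorff_outer k (\<Union>i. ?A i) \<le> (\<Sum>i. hausdorff_outer k (?A i))"
    by (rule hausdorff_outer_subadditive)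
  also have "(\<Union>i. ?A i) = A \<union> B" by (auto split: if_splits)
  also have "(\<Sum>i. hausdorff_outer k (?A i)) = (\<Sum>i\<in>{0,1}. hausdorff_outer k (?A i))"
    by (rule suminf_finite) (auto simp: hausdorff_outer_empty)
  finally show ?thesis by simp
qed

text \<open>\<open>measure_of\<close> falls back to the zero measure when its set function is not a
  measure. Caratheodory's theorem excludes this, so that the sets and values of
  \<open>hausdorff_measure\<close> can be read off below.\<close>

lemma measure_space_hausdorff:
  "measure_space UNIV (lambda_system UNIV (Pow UNIV) (hausdorff_outer k)) (hausdorff_outer k)"
  by (rule sigma_algebra.caratheodory_lemma[OF sigma_algebra_Pow outer_measure_space_hausdorff])

lemma space_hausdorff [simp]: "space (hausdorff_measure k) = UNIV"
  unfolding hausdorff_measure_def by (rule space_measure_of) auto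

lemma sets_hausdorff:
  "sets (hausdorff_measure k) = lambda_system UNIV (Pow UNIV) (hausdorff_outer k)"
  unfolding hausdorff_measure_def
  using measure_space_hausdorff[of k, where 'a='a] unfolding measure_space_def
  by (metis sigma_algebra.sets_measure_of_eq)

lemma emeasure_hausdorff:
  "E \<in> sets (hausdorff_measure k) \<Longrightarrow> emeasure (hausdorff_measure k) E = hausdorff_outer k E"
  unfolding hausdorff_measure_def
  using measure_space_hausdorff[of k, where 'a='a] unfolding measure_space_def
  by (metis emeasure_measure_of_sigma hausdorff_measure_def sets_hausdorff)

section \<open>Metric additivity and Borel measurability\<close>

lemma hausdorff_outer_metric:
  fixes A B :: "(real^'N::finite) set"
  assumes "0 < d" and d: "\<And>x y. x \<in> A \<Longrightarrow> y \<in> B \<Longrightarrow> d \<le> dist x y"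
  shows "hausdorff_outer k A + hausdorff_outer k B \<le> hausdorff_outer k (A \<union> B)"
proof -
  let ?g = "\<lambda>S. ennreal (hausdorff_gauge k S)"
  let ?P = "hausdorff_pre k"
  let ?H = "hausdorff_outer k"
  have pre: "?P \<delta> A + ?P \<delta> B \<le> ?P \<delta> (A \<union> B)"
    if "0 < \<delta>" "\<delta> < d" for \<delta>
    unfolding hausdorff_pre_def[of k \<delta> "A \<union> B"]
  proof (rule INF_greatest)
    fix C :: "nat \<Rightarrow> (real^'N) set"
    assume "C \<in> {C. A \<union> B \<subseteq> (\<Union>i. C i) \<and> (\<forall>i. bounded (C i) \<and> diameter (C i) \<le> \<delta>)}"
    then have C: "A \<union> B \<subseteq> (\<Union>i. C i)" "\<And>i. bounded (C i)" "\<And>i. diameter (C i) \<le> \<delta>" by auto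
    \<comment> \<open>A set of diameter at most \<delta> < d meets at most one of \<open>A\<close>
      and \<open>B\<close>. Discarding the members that miss the set in question therefore splits
      the cover into two with no member counted twice.\<close>
    define C1 where "C1 i = (if C i \<inter> A = {} then {} else C i)" for i
    define C2 where "C2 i = (if C i \<inter> B = {} then {} else C i)" for i
    have g: "?g (C1 i) + ?g (C2 i) \<le> ?g (C i)" for i
    proof (cases "C i \<inter> A = {} \<or> C i \<inter> B = {}")
      case True
      then show ?thesis
        by (auto simp: C1_def C2_def hausdorff_gauge_def[of k "{}"])
    next
      case False
      then obtain x y where "x \<in> C i" "x \<in> A" "y \<in> C i" "y \<in> B" by blast
      then have "d \<le> diameter (C i)"
        using d[of x y] diameter_bounded_bound[OF C(2), of x i y] by auto
      with C(3)[of i] that show ?thesis by simp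
    qed
    have "?P \<delta> A \<le> (\<Sum>i. ?g (C1 i))"
    proof (rule hausdorff_pre_le_sum)
      show "A \<subseteq> (\<Union>i. C1 i)"
      proof
        fix x assume "x \<in> A"
        then obtain i where "x \<in> C i" using C(1) by blast
        then show "x \<in> (\<Union>i. C1 i)" using \<open>x \<in> A\<close> by (intro UN_I[of i]) (auto simp: C1_def)
      qed
    qed (use C that in \<open>auto simp: C1_def\<close>)
    moreover have "?P \<delta> B \<le> (\<Sum>i. ?g (C2 i))"
    proof (rule hausdorff_pre_le_sum)
      show "B \<subseteq> (\<Union>i. C2 i)"
      proof
        fix x assume "x \<in> B"
        then obtain i where "x \<in> C i" using C(1) by blast
        then show "x \<in> (\<Union>i. C2 i)" using \<open>x \<in> B\<close> by (intro UN_I[of i]) (auto simp: C2_def)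
      qed
    qed (use C that in \<open>auto simp: C2_def\<close>)
    ultimately have "?P \<delta> A + ?P \<delta> B \<le>
        (\<Sum>i. ?g (C1 i)) + (\<Sum>i. ?g (C2 i))"
      by (rule add_mono)
    also have "\<dots> = (\<Sum>i. ?g (C1 i) + ?g (C2 i))"
      by (intro suminf_add) auto
    also have "\<dots> \<le> (\<Sum>i. ?g (C i))"
      by (intro suminf_le g) auto
    finally show "?P \<delta> A + ?P \<delta> B \<le> (\<Sum>i. ?g (C i))" .
  qed
  have "?P \<delta> A + ?P \<delta>' B \<le> ?H (A \<union> B)"
    if "0 < \<delta>" "0 < \<delta>'" for \<delta> \<delta>'
  proof -
    \<comment> \<open>The suprema over scales are taken independently for the two sets, so a common
      scale below both and below d is needed; refining the scale only increases the
      premeasures.\<close>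
    define \<eta> where "\<eta> = min (min \<delta> \<delta>') (d/2)"
    have \<eta>: "0 < \<eta>" "\<eta> < d" "\<eta> \<le> \<delta>" "\<eta> \<le> \<delta>'" using that \<open>0 < d\<close> by (auto simp: \<eta>_def)
    have "?P \<delta> A + ?P \<delta>' B \<le> ?P \<eta> A + ?P \<eta> B"
      using \<eta> by (intro add_mono hausdorff_pre_antimono) auto
    also have "\<dots> \<le> ?P \<eta> (A \<union> B)" using pre \<eta> by simp
    also have "\<dots> \<le> ?H (A \<union> B)" using hausdorff_pre_le_outer \<eta> by blast
    finally show ?thesis .
  qed
  then have "?P \<delta> A + ?H B \<le> ?H (A \<union> B)" if "0 < \<delta>" for \<delta>
    unfolding hausdorff_outer_def[of k B] using that
    by (subst ennreal_SUP_add_right) (auto intro!: SUP_least)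
  then show ?thesis
    unfolding hausdorff_outer_def[of k A]
    by (subst ennreal_SUP_add_left[symmetric]) (auto intro!: SUP_least)
qed

text \<open>Used to remove the shells that accumulate at a closed set: their sum is finite, so the
  tails in the estimate tend to 0.\<close>

lemma le_of_le_add_tails:
  fixes a :: ennreal and r :: "nat \<Rightarrow> ennreal"
  assumes "\<And>n. a \<le> b + (\<Sum>i. r (i + n))" "(\<Sum>i. r i) < \<infinity>"
  shows "a \<le> b"
proof (rule ennreal_le_epsilon)
  fix e :: real assume "0 < e"
  define s where "s n = (\<Sum>i<n. r i)" for n
  have fin: "r i < \<infinity>" for i
    using assms(2) ennreal_suminf_lessD by blast
  have sm: "summable (\<lambda>i. enn2real (r i))"
    using assms(2) fin
    by (intro summable_suminf_not_top) (auto simp: top.not_eq_extremum)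
  have "(\<lambda>n. \<Sum>i. enn2real (r (i + n))) \<longlonglongrightarrow> 0"
    by (rule suminf_exist_split2[OF sm])
  then have "\<forall>\<^sub>F n in sequentially. (\<Sum>i. enn2real (r (i + n))) < e"
    using \<open>0 < e\<close> order_tendstoD(2) by blast
  then obtain n where n: "(\<Sum>i. enn2real (r (i + n))) < e"
    by (auto simp: eventually_sequentially)
  have "(\<Sum>i. r (i + n)) = (\<Sum>i. ennreal (enn2real (r (i + n))))"
    using fin by simp
  also have "\<dots> = ennreal (\<Sum>i. enn2real (r (i + n)))"
    using sm by (intro suminf_ennreal2) (auto simp: summable_iff_shift[of "\<lambda>i. enn2real (r i)"])
  also have "\<dots> \<le> ennreal e" using n by (intro ennreal_leI) auto
  finally show "a \<le> b + ennreal e"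
    using assms(1)[of n] add_left_mono order_trans by blast
qed

text \<open>Neighbouring shells may touch, but shells of equal parity are pairwise at positive
  distance, so metric additivity applies to them; \<open>s\<close> is the parity.\<close>

lemma hausdorff_outer_shells_le:
  fixes R :: "nat \<Rightarrow> (real^'N::finite) set"
  assumes far: "\<And>i j. i + 1 < j \<Longrightarrow> \<exists>d>0. \<forall>x\<in>R i. \<forall>y\<in>R j. d \<le> dist x y" and "\<And>i. R i \<subseteq> X"
  shows "(\<Sum>i. hausdorff_outer k (R (2*i+s))) \<le> hausdorff_outer k X"
proof -
  let ?R = "\<lambda>n. \<Union>i<n. R (2*i+s)"
  let ?H = "hausdorff_outer k"
  have "(\<Sum>i<n. ?H (R (2*i+s))) \<le> ?H (?R n)" for n
  proof (induction n)
    case (Suc n)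
    have "\<exists>d. i < n \<longrightarrow> d > 0 \<and> (\<forall>x\<in>R (2*i+s). \<forall>y\<in>R (2*n+s). d \<le> dist x y)" for i
      using far[of "2*i+s" "2*n+s"] by (cases "i < n") auto
    then obtain d where d: "\<And>i. i < n \<Longrightarrow> d i > 0 \<and> (\<forall>x\<in>R (2*i+s). \<forall>y\<in>R (2*n+s). d i \<le> dist x y)"
      by metis
    \<comment> \<open>The inserted 1 keeps the set nonempty when \<open>n\<close> is 0.\<close>
    have fin: "finite (insert 1 (d ` {..<n}))" by simp
    have "?H (?R n) + ?H (R (2*n+s)) \<le>
        ?H ((?R n) \<union> R (2*n+s))"
    proof (rule hausdorff_outer_metric)
      show "0 < Min (insert 1 (d ` {..<n}))" using d by (subst Min_gr_iff[OF fin]) auto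
      show "Min (insert 1 (d ` {..<n})) \<le> dist x y" if xy: "x \<in> (?R n)" "y \<in> R (2*n+s)" for x y
      proof -
        obtain i where i: "i < n" "x \<in> R (2*i+s)" using xy(1) by blast
        have "Min (insert 1 (d ` {..<n})) \<le> d i" using i by (intro Min_le[OF fin]) auto
        also have "d i \<le> dist x y" using d i xy(2) by blast
        finally show ?thesis .
      qed
    qed
    moreover have "(?R n) \<union> R (2*n+s) = (?R (Suc n))"
      by (auto simp: less_Suc_eq)
    ultimately show ?case
      using order_trans[OF add_right_mono[OF Suc, of "?H (R (2*n+s))"]]
      unfolding sum.lessThan_Suc by metis
  qed (simp add: hausdorff_outer_empty)
  also have "?H (?R n) \<le> ?H X" for n
    using assms(2) by (intro hausdorff_outer_mono) auto
  finally show ?thesis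
    by (auto simp: suminf_eq_SUP intro!: SUP_least)
qed

text \<open>Caratheodory's criterion. The part of \<open>X\<close> outside \<open>C\<close> is
  exhausted by sets \<open>A n\<close> at distance at least 1/(n+1) from \<open>C\<close>, on which
  metric additivity works; the remainder is covered by thin shells whose total outer measure is
  finite, so their tails vanish.\<close>

lemma closed_in_sets_hausdorff:
  fixes C :: "(real^'N::finite) set"
  assumes "closed C"
  shows "C \<in> sets (hausdorff_measure k)"
proof (cases "C = {}")
  case False
  let ?H = "hausdorff_outer k"
  have le: "?H (C \<inter> X) + ?H (X - C) \<le> ?H X" for X
  proof (cases "?H X = \<infinity>")
    case fin: False
    define A where "A n = {x \<in> X. 1 / real (n+1) \<le> infdist x C}" for n
    define R where "R n = {x \<in> X. 1 / real (n+2) \<le> infdist x C \<and> infdist x C < 1 / real (n+1)}" for n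
    have d: "infdist x C \<le> infdist y C + dist x y" for x y
      by (rule infdist_triangle)
    have far: "\<exists>d>0. \<forall>x\<in>R i. \<forall>y\<in>R j. d \<le> dist x y" if "i + 1 < j" for i j
    proof (intro exI conjI ballI)
      show "0 < 1 / real (i+2) - 1 / real (j+1)" using that by (simp add: frac_less2)
      fix x y assume "x \<in> R i" "y \<in> R j"
      then show "1 / real (i+2) - 1 / real (j+1) \<le> dist x y"
        using d[of x y] by (auto simp: R_def)
    qed
    \<comment> \<open>Even and odd shells are summed separately, each family costing at most the
      outer measure of \<open>X\<close>.\<close>
    have "(\<Sum>i. ?H (R i)) \<le> (\<Sum>i. ?H (R (2*i+0))) + (\<Sum>i. ?H (R (2*i+1)))"
    proof -
      have "(\<Sum>i<n. ?H (R i)) \<le> (\<Sum>i<n. ?H (R (2*i+0))) + (\<Sum>i<n. ?H (R (2*i+1)))" for n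
      proof -
        have "(\<Sum>i<n. ?H (R i)) \<le> (\<Sum>i<2*n. ?H (R i))" by (intro sum_mono2) auto
        also have "\<dots> = (\<Sum>i<n. ?H (R (2*i+0))) + (\<Sum>i<n. ?H (R (2*i+1)))"
          by (induction n) (auto simp: algebra_simps)
        finally show ?thesis .
      qed
      also have "(\<Sum>i<n. ?H (R (2*i+0))) + (\<Sum>i<n. ?H (R (2*i+1))) \<le> (\<Sum>i. ?H (R (2*i+0))) + (\<Sum>i. ?H (R (2*i+1)))" for n
        by (intro add_mono sum_le_suminf) auto
      finally show ?thesis by (auto simp: suminf_eq_SUP[of "\<lambda>i. ?H (R i)"] intro!: SUP_least)
    qed
    also have "\<dots> \<le> ?H X + ?H X"
      by (intro add_mono hausdorff_outer_shells_le far) (auto simp: R_def)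
    also have "\<dots> < \<infinity>" using fin by (auto simp: top.not_eq_extremum)
    finally have sumR: "(\<Sum>i. ?H (R i)) < \<infinity>" .
    have sub: "X - C \<subseteq> A n \<union> (\<Union>i. R (i + n))" for n
    proof
      fix x assume x: "x \<in> X - C"
      then have pos: "infdist x C > 0"
        using in_closed_iff_infdist_zero[OF assms False, of x] infdist_nonneg[of x C] by auto
      show "x \<in> A n \<union> (\<Union>i. R (i + n))"
      proof (cases "1 / real (n+1) \<le> infdist x C")
        case True then show ?thesis using x by (auto simp: A_def)
      next
        case far: False
        \<comment> \<open>The first index at which 1/(m+1) drops to the distance of x from
          \<open>C\<close>. Minimality puts x in the shell with index m - 1, and m > n makes the
          subtraction harmless.\<close>
        define m where "m = (LEAST m. 1 / real (m+1) \<le> infdist x C)"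
        obtain m0 where "1 / real (Suc m0) < infdist x C" using pos nat_approx_posE by blast
        then have "1 / real (m0+1) \<le> infdist x C" by simp
        then have m: "1 / real (m+1) \<le> infdist x C"
          unfolding m_def by (rule LeastI[where P="\<lambda>m. 1 / real (m+1) \<le> infdist x C"])
        have "n < m"
        proof (rule ccontr)
          assume "\<not> n < m"
          then have "1 / real (n+1) \<le> 1 / real (m+1)" by (auto simp: field_simps)
          with m far show False by linarith
        qed
        have "\<not> 1 / real (m - 1 + 1) \<le> infdist x C"
          using \<open>n < m\<close> not_less_Least[of "m-1" "\<lambda>m. 1 / real (m+1) \<le> infdist x C"] unfolding m_def[symmetric] by auto
        then have "x \<in> R (m - 1)" using m x \<open>n < m\<close> by (auto simp: R_def)
        then show ?thesis using \<open>n < m\<close> by (intro UnI2 UN_I[of "m - 1 - n"]) auto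
      qed
    qed
    show ?thesis
    proof (rule le_of_le_add_tails[OF _ sumR])
      fix n
      have "?H (X - C) \<le> ?H (A n) + ?H (\<Union>i. R (i + n))"
        using hausdorff_outer_mono[OF sub] hausdorff_outer_Un_le order_trans by blast
      also have "\<dots> \<le> ?H (A n) + (\<Sum>i. ?H (R (i + n)))"
        by (intro add_left_mono hausdorff_outer_subadditive)
      finally have 1: "?H (C \<inter> X) + ?H (X - C) \<le> ?H (C \<inter> X) + ?H (A n) + (\<Sum>i. ?H (R (i + n)))"
        by (simp add: add.assoc add_left_mono)
      have "?H (C \<inter> X) + ?H (A n) \<le> ?H (C \<inter> X \<union> A n)"
      proof (rule hausdorff_outer_metric)
        show "0 < 1 / real (n+1)" by simp
        show "1 / real (n+1) \<le> dist x y" if "x \<in> C \<inter> X" "y \<in> A n" for x y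
          using that infdist_le[of x C y] by (auto simp: A_def dist_commute)
      qed
      also have "\<dots> \<le> ?H X" by (rule hausdorff_outer_mono) (auto simp: A_def)
      finally show "?H (C \<inter> X) + ?H (X - C) \<le> ?H X + (\<Sum>i. ?H (R (i + n)))"
        using order_trans[OF 1 add_right_mono] by blast
    qed
  qed auto
  have ge: "?H X \<le> ?H (C \<inter> X) + ?H (X - C)" for X
  proof -
    have "C \<inter> X \<union> (X - C) = X" by auto
    then show ?thesis using hausdorff_outer_Un_le[of k "C \<inter> X" "X - C"] by simp
  qed
  show ?thesis
    unfolding sets_hausdorff lambda_system_def using le ge
    by (auto simp: Diff_eq Int_commute intro!: antisym)
qed auto

lemma borel_subset_sets_hausdorff:
  "sets (borel :: (real^'N::finite) measure) \<subseteq> sets (hausdorff_measure k)"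
  unfolding borel_eq_closed
  using sets.sigma_sets_subset[of "Collect closed" "hausdorff_measure k"] closed_in_sets_hausdorff
  by auto

section \<open>Borel hulls, inner regularity and densities\<close>

lemma hausdorff_borel_hull:
  fixes E :: "(real^'N::finite) set"
  obtains G where "G \<in> sets borel" "E \<subseteq> G" "hausdorff_outer k G = hausdorff_outer k E"
proof (cases "hausdorff_outer k E = \<infinity>")
  case True
  have "hausdorff_outer k (UNIV :: (real^'N) set) = hausdorff_outer k E"
    using hausdorff_outer_mono[of E UNIV k] True by (simp add: top.extremum_unique)
  then show ?thesis using that[of UNIV] by auto
next
  case False
  let ?P = "\<lambda>n. hausdorff_pre k (1 / real (Suc n)) E"
  let ?g = "\<lambda>S. ennreal (hausdorff_gauge k S)"
  have fin: "?P n < \<infinity>" for n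
    using hausdorff_pre_le_outer[of "1 / real (Suc n)" k E] False
    by (auto simp: top.not_eq_extremum intro: le_less_trans)
  have "\<exists>C. E \<subseteq> (\<Union>i. C i) \<and> (\<forall>i. bounded (C i)) \<and> (\<forall>i. diameter (C i) \<le> 1 / real (Suc n)) \<and>
     (\<Sum>i. ?g (C i)) < ?P n + ennreal (1 / real (Suc n))" for n
    by (rule hausdorff_pre_approx[OF fin, of "1 / real (Suc n)" n]) auto
  then obtain C where C: "\<And>n. E \<subseteq> (\<Union>i. C n i)" "\<And>n i. bounded (C n i)" "\<And>n i. diameter (C n i) \<le> 1 / real (Suc n)"
     "\<And>n. (\<Sum>i. ?g (C n i)) < ?P n + ennreal (1 / real (Suc n))"
    by metis
  \<comment> \<open>Closing a bounded set changes neither its diameter nor its gauge, so the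
    intersection of the closed covers is Borel and as cheap as \<open>E\<close> at every
    scale.\<close>
  define G where "G = (\<Inter>n. \<Union>i. closure (C n i))"
  have "E \<subseteq> (\<Union>i. closure (C n i))" for n
    using C(1)[of n] closure_subset[of "C n _"] by blast
  then have "E \<subseteq> G" by (auto simp: G_def)
  have gauge: "hausdorff_gauge k (closure (C n i)) = hausdorff_gauge k (C n i)" for n i
    using C(2) by (simp add: hausdorff_gauge_def diameter_closure)
  have "hausdorff_outer k G \<le> hausdorff_outer k E"
  proof (rule hausdorff_outer_le)
    fix \<delta> :: real assume "0 < \<delta>"
    show "hausdorff_pre k \<delta> G \<le> hausdorff_outer k E"
    proof (rule ennreal_le_epsilon)
      fix e :: real assume "0 < e"
      obtain n where n: "1 / real (Suc n) < min \<delta> e"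
        using nat_approx_posE[of "min \<delta> e"] \<open>0 < \<delta>\<close> \<open>0 < e\<close> by auto
      have "hausdorff_pre k \<delta> G \<le> (\<Sum>i. ?g (closure (C n i)))"
      proof (rule hausdorff_pre_le_sum)
        show "diameter (closure (C n i)) \<le> \<delta>" for i
          using C(3)[of n i] n diameter_closure[OF C(2)[of n i]] by linarith
      qed (use C(2) in \<open>auto simp: G_def\<close>)
      also have "\<dots> \<le> ?P n + ennreal (1 / real (Suc n))"
        unfolding gauge using C(4)[of n] by simp
      also have "\<dots> \<le> hausdorff_outer k E + ennreal e"
        using n by (intro add_mono hausdorff_pre_le_outer ennreal_leI) auto
      finally show "hausdorff_pre k \<delta> G \<le> hausdorff_outer k E + ennreal e" .
    qed
  qed
  moreover have "G \<in> sets borel" unfolding G_def by (intro sets.countable_INT sets.countable_UN) auto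
  ultimately show ?thesis
    using that[of G] \<open>E \<subseteq> G\<close> hausdorff_outer_mono[OF \<open>E \<subseteq> G\<close>] by (simp add: antisym)
qed

text \<open>\<open>E\<close> contains a Borel set of the same measure: remove from a hull of
  \<open>E\<close> a hull of the null difference, which is null again. Restricted to this set,
  Hausdorff measure becomes a finite Borel measure, and such measures on Euclidean space are inner
  regular.\<close>

lemma hausdorff_inner_regular:
  fixes E :: "(real^'N::finite) set"
  assumes E: "E \<in> sets (hausdorff_measure k)" and fin: "hausdorff_outer k E < \<infinity>"
    and c: "c < hausdorff_outer k E"
  obtains K where "compact K" "K \<subseteq> E" "c < hausdorff_outer k K"
proof -
  let ?H = "hausdorff_outer k"
  let ?M = "hausdorff_measure k :: (real^'N) measure"
  note borel = subsetD[OF borel_subset_sets_hausdorff[of k, where 'N='N]]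
  obtain G where G: "G \<in> sets borel" "E \<subseteq> G" "?H G = ?H E"
    by (rule hausdorff_borel_hull)
  have "emeasure ?M (G - E) = emeasure ?M G - emeasure ?M E"
    using E G fin borel by (intro emeasure_Diff) (auto simp: emeasure_hausdorff)
  then have null: "?H (G - E) = 0"
    using E G fin borel[OF G(1)] emeasure_hausdorff[of "G - E" k]
    by (auto simp: emeasure_hausdorff sets.Diff)
  obtain Z where Z: "Z \<in> sets borel" "G - E \<subseteq> Z" "?H Z = 0"
    by (rule hausdorff_borel_hull[of "G - E" k]) (use null in auto)
  define B where "B = G - Z"
  have B: "B \<in> sets borel" "B \<subseteq> E" using G Z by (auto simp: B_def)
  have "?H E \<le> ?H (B \<union> Z)"
    using G(2) by (intro hausdorff_outer_mono) (auto simp: B_def)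
  also have "\<dots> \<le> ?H B"
    using hausdorff_outer_Un_le[of k B Z] Z(3) by simp
  finally have cB: "c < ?H B" using c by simp
  have finB: "?H B < \<infinity>" using hausdorff_outer_mono[OF B(2), of k] fin by simp
  \<comment> \<open>\<open>inner_regular\<close> speaks of measures on the Borel sigma-algebra; the
    restriction lives on traces of the larger Caratheodory one and is pushed forward by the
    identity.\<close>
  define M where "M = distr (restrict_space ?M B) borel (\<lambda>x. x)"
  have meas: "(\<lambda>x. x) \<in> restrict_space ?M B \<rightarrow>\<^sub>M borel"
    by (rule measurable_restrict_space1) (use borel in \<open>auto simp: measurable_def\<close>)
  have eM: "emeasure M A = ?H (A \<inter> B)" if "A \<in> sets borel" for A
    unfolding M_def using that B(1) borel
    by (subst emeasure_distr[OF meas])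
       (auto simp: space_restrict_space emeasure_restrict_space emeasure_hausdorff sets.Int)
  have "emeasure M B = (SUP K \<in> {K. K \<subseteq> B \<and> compact K}. emeasure M K)"
    by (rule inner_regular) (use B finB in \<open>auto simp: eM M_def[THEN arg_cong, of sets] space_restrict_space M_def[THEN arg_cong, of space] simp del: emeasure_distr\<close>)
  then have "c < (SUP K \<in> {K. K \<subseteq> B \<and> compact K}. emeasure M K)" using cB B(1) by (simp add: eM)
  then obtain K where K: "K \<subseteq> B" "compact K" "c < emeasure M K" by (auto simp: less_SUP_iff)
  then have "K \<inter> B = K" by auto
  with K have "c < ?H K" using eM[of K] by (simp add: borel_compact)
  with K B that show ?thesis by blast
qed

text \<open>Unlike in the plain Vitali lemma, only the balls outside a finite subfamily have to be enlarged, so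
  no factor \<open>5 ^ k\<close> is lost.\<close>

lemma hausdorff_le_of_density:
  fixes m :: "(real^'N::finite) set \<Rightarrow> ennreal"
  assumes t: "0 < t" and "open U" "E \<subseteq> U" and L: "0 \<le> L"
    and dens: "\<And>x \<delta>. x \<in> E \<Longrightarrow> 0 < \<delta> \<Longrightarrow>
       \<exists>\<rho>. 0 < \<rho> \<and> \<rho> < \<delta> \<and> ennreal (t * (unit_ball_vol (real k) * \<rho> ^ k)) \<le> m (cball x \<rho>)"
    and super: "\<And>P. finite P \<Longrightarrow> (\<And>p. p \<in> P \<Longrightarrow> 0 < snd p \<and> cball (fst p) (snd p) \<subseteq> U) \<Longrightarrow>
       pairwise (\<lambda>p p'. disjnt (cball (fst p) (snd p)) (cball (fst p') (snd p'))) P \<Longrightarrow>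
       (\<Sum>p\<in>P. m (cball (fst p) (snd p))) \<le> ennreal L"
  shows "ennreal t * hausdorff_outer k E \<le> ennreal L"
proof -
  have "hausdorff_pre k \<delta> E \<le> ennreal (L / t)" if "0 < \<delta>" for \<delta>
  proof -
    define \<omega> where "\<omega> = unit_ball_vol (real k)"
    have \<omega>: "0 < \<omega>" unfolding \<omega>_def by simp
    define B where "B p = cball (fst p) (snd p)" for p :: "(real^'N) \<times> real"
    define g where "g p = \<omega> * snd p ^ k" for p :: "(real^'N) \<times> real"
    \<comment> \<open>Radii below \<delta>/10 leave room for the fivefold enlargement, whose
      diameter must not exceed \<delta>.\<close>
    define Q where "Q = {p. fst p \<in> E \<and> 0 < snd p \<and> snd p < \<delta> / 10 \<and> B p \<subseteq> U \<and> ennreal (t * g p) \<le> m (B p)}"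
    have Q: "0 < snd p" "snd p < \<delta>/10" "B p \<subseteq> U" "ennreal (t * g p) \<le> m (B p)" if "p \<in> Q" for p
      using that by (auto simp: Q_def)
    obtain C where C: "countable C" "C \<subseteq> Q" "pairwise (\<lambda>p p'. disjnt (B p) (B p')) C"
       "\<And>p. p \<in> Q \<Longrightarrow> \<exists>p'. p' \<in> C \<and> \<not> disjnt (B p) (B p') \<and> B p \<subseteq> ball (fst p') (5 * snd p')"
      using Vitali_covering_lemma_cballs_balls[of Q snd "\<delta>/10" fst] Q unfolding B_def by (smt (verit, best))
    have g0: "0 < g p" if "p \<in> C" for p using subsetD[OF C(2) that] Q(1)[of p] \<omega> by (simp add: g_def)
    \<comment> \<open>Superadditivity of \<open>m\<close> on disjoint balls turns the density bound
      into a bound on sums of gauges.\<close>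
    have sumg: "sum g P \<le> L / t" if P: "finite P" "P \<subseteq> C" for P
    proof -
      have "ennreal (t * sum g P) = (\<Sum>p\<in>P. ennreal (t * g p))"
        using P g0 t by (subst sum_ennreal) (auto simp: sum_distrib_left intro!: mult_nonneg_nonneg less_imp_le)
      also have "\<dots> \<le> (\<Sum>p\<in>P. m (B p))" using P C(2) Q by (intro sum_mono) auto
      also have "\<dots> \<le> ennreal L"
        unfolding B_def
      proof (rule super)
        show "pairwise (\<lambda>p p'. disjnt (cball (fst p) (snd p)) (cball (fst p') (snd p'))) P"
          using pairwise_subset[OF C(3) P(2)] by (simp add: B_def)
        show "0 < snd p \<and> cball (fst p) (snd p) \<subseteq> U" if "p \<in> P" for p
          using that P C(2) Q(1,3)[of p] by (auto simp: B_def)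
      qed (rule P)
      finally have "t * sum g P \<le> L" using L by simp
      then show ?thesis using t by (simp add: field_simps)
    qed
    define S where "S = (SUP P\<in>{P. finite P \<and> P \<subseteq> C}. sum g P)"
    have bdd: "bdd_above (sum g ` {P. finite P \<and> P \<subseteq> C})" using sumg by (auto intro!: bdd_aboveI2)
    have SL: "S \<le> L / t" unfolding S_def by (rule cSUP_least) (use sumg in auto)
    have "hausdorff_pre k \<delta> E \<le> ennreal S"
    proof (rule ennreal_le_epsilon)
      fix e :: real assume "0 < e"
      \<comment> \<open>The balls outside a finite subfamily \<open>P0\<close> are enlarged
        fivefold, which multiplies their gauges by 5^k. Their original total stays below e/5^k
        because \<open>P0\<close> nearly attains the supremum \<open>S\<close>.\<close>
      define e' where "e' = e / 5 ^ k"
      have "0 < e'" using \<open>0 < e\<close> by (simp add: e'_def)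
      have "S - e' < S" using \<open>0 < e'\<close> by simp
      then obtain P0 where P0: "finite P0" "P0 \<subseteq> C" "S - e' < sum g P0"
        unfolding S_def using less_cSUP_iff[OF _ bdd, of "S - e'"] unfolding S_def by auto
      have tail: "sum g P < e'" if P: "finite P" "P \<subseteq> C - P0" for P
      proof -
        have "sum g P + sum g P0 = sum g (P \<union> P0)"
          using P P0 by (subst sum.union_disjoint) auto
        also have "\<dots> \<le> S" unfolding S_def using P P0 by (intro cSUP_upper bdd) auto
        finally show ?thesis using P0(3) by linarith
      qed
      define D where "D p = (if p \<in> P0 then B p else ball (fst p) (5 * snd p))" for p
      define f where "f = to_nat_on C"
      have inj: "inj_on f C" unfolding f_def using C(1) by (rule inj_on_to_nat_on)
      \<comment> \<open>Indices that number no ball are filled with the empty set, whose gauge is 0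
        by its separate clause.\<close>
      define h where "h n = (if n \<in> f ` C then D (inv_into C f n) else {})" for n
      have h: "h (f p) = D p" if "p \<in> C" for p using that inj by (simp add: h_def inv_into_f_f)
      have gD: "hausdorff_gauge k (D p) \<le> (if p \<in> P0 then g p else 5 ^ k * g p)" if "p \<in> C" for p
      proof -
        have pos: "0 < snd p" using subsetD[OF C(2) that] Q(1) by simp
        have "diameter (D p) \<le> 2 * (if p \<in> P0 then snd p else 5 * snd p)"
          using pos by (auto simp: D_def B_def)
        then have "(diameter (D p) / 2) ^ k \<le> (if p \<in> P0 then snd p else 5 * snd p) ^ k"
          by (intro power_mono) (auto simp: D_def B_def intro!: diameter_ge_0)
        then show ?thesis using \<omega> pos
          by (auto simp: hausdorff_gauge_def g_def \<omega>_def[symmetric] power_mult_distrib)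
      qed
      have "hausdorff_pre k \<delta> E \<le> (\<Sum>n. ennreal (hausdorff_gauge k (h n)))"
      proof (rule hausdorff_pre_le_sum)
        show "E \<subseteq> (\<Union>n. h n)"
        proof
          fix x assume "x \<in> E"
          have "\<exists>p\<in>C. x \<in> D p"
          proof (cases "x \<in> (\<Union>p\<in>P0. B p)")
            case True then show ?thesis using P0(2) by (auto simp: D_def)
          next
            case False
            \<comment> \<open>A point missed by the finitely many unenlarged balls has positive
              distance from them, so a small ball of \<open>Q\<close> around it avoids them all. The
              member of \<open>C\<close> that Vitali's lemma assigns to this ball meets it, hence
              lies outside \<open>P0\<close> and enters the cover enlarged.\<close>
            have "closed (\<Union>p\<in>P0. B p)" using P0(1) by (intro closed_UN) (auto simp: B_def)
            then have "open (U - (\<Union>p\<in>P0. B p))" using \<open>open U\<close> by blast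
            then obtain d where d: "0 < d" "cball x d \<subseteq> U - (\<Union>p\<in>P0. B p)"
              using False \<open>x \<in> E\<close> \<open>E \<subseteq> U\<close> open_contains_cball by (metis Diff_iff subsetD)
            obtain \<rho> where \<rho>: "0 < \<rho>" "\<rho> < min d (\<delta>/10)" "ennreal (t * (\<omega> * \<rho> ^ k)) \<le> m (cball x \<rho>)"
              using dens[OF \<open>x \<in> E\<close>, of "min d (\<delta>/10)"] d(1) \<open>0 < \<delta>\<close> unfolding \<omega>_def by auto
            have sub: "cball x \<rho> \<subseteq> U - (\<Union>p\<in>P0. B p)" using d(2) \<rho>(2) subset_cball[of \<rho> d x] by auto
            then have "(x, \<rho>) \<in> Q" using \<rho> \<open>x \<in> E\<close> by (auto simp: Q_def B_def g_def)
            then obtain p where p: "p \<in> C" "\<not> disjnt (B (x, \<rho>)) (B p)" "B (x, \<rho>) \<subseteq> ball (fst p) (5 * snd p)"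
              using C(4) by blast
            have "p \<notin> P0" using p(2) sub by (auto simp: disjnt_def B_def)
            moreover have "x \<in> ball (fst p) (5 * snd p)" using subsetD[OF p(3), of x] \<rho>(1) by (simp add: B_def)
            ultimately show ?thesis using p(1) by (auto simp: D_def)
          qed
          then show "x \<in> (\<Union>n. h n)" using h by blast
        qed
        show "bounded (h n)" for n by (auto simp: h_def D_def B_def)
        show "diameter (h n) \<le> \<delta>" for n
        proof (cases "n \<in> f ` C")
          case True
          then obtain p where p: "p \<in> C" "n = f p" by auto
          then have "0 < snd p" "snd p < \<delta>/10" using subsetD[OF C(2), of p] Q(1,2)[of p] by auto
          then show ?thesis using p h[of p] by (auto simp: D_def B_def)
        qed (use \<open>0 < \<delta>\<close> in \<open>simp add: h_def\<close>)
      qed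
      also have "\<dots> \<le> ennreal (S + e)"
      proof -
        have "(\<Sum>n<N. ennreal (hausdorff_gauge k (h n))) \<le> ennreal (S + e)" for N
        proof -
          define P where "P = {p\<in>C. f p < N}"
          have "f ` P \<subseteq> {..<N}" by (auto simp: P_def)
          then have finP: "finite P"
            using inj by (metis (no_types, lifting) P_def finite_imageD finite_lessThan finite_subset inj_on_subset mem_Collect_eq subsetI)
          have bdh: "bounded (h n)" for n by (auto simp: h_def D_def B_def)
          have "(\<Sum>n<N. hausdorff_gauge k (h n)) = (\<Sum>n\<in>f ` P. hausdorff_gauge k (h n))"
            by (rule sum.mono_neutral_right) (auto simp: P_def h_def hausdorff_gauge_def)
          also have "\<dots> = (\<Sum>p\<in>P. hausdorff_gauge k (D p))"
            using inj by (subst sum.reindex) (auto simp: P_def h inj_on_def)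
          also have "\<dots> \<le> (\<Sum>p\<in>P. if p \<in> P0 then g p else 5 ^ k * g p)"
            by (intro sum_mono gD) (auto simp: P_def)
          also have "\<dots> = sum g (P \<inter> P0) + 5 ^ k * sum g (P - P0)"
            using finP by (subst sum.If_cases) (auto simp: sum_distrib_left Diff_eq Collect_mem_eq Compl_eq)
          also have "\<dots> \<le> S + 5 ^ k * e'"
          proof (intro add_mono mult_left_mono)
            show "sum g (P \<inter> P0) \<le> S" unfolding S_def
              using finP by (intro cSUP_upper bdd) (auto simp: P_def)
            show "sum g (P - P0) \<le> e'" 
              by (rule less_imp_le, rule tail) (use finP in \<open>auto simp: P_def\<close>)
          qed auto
          also have "\<dots> = S + e" by (simp add: e'_def)
          finally show ?thesis
            using bdh by (subst sum_ennreal) (auto intro!: ennreal_leI hausdorff_gauge_nonneg)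
        qed
        then show ?thesis by (auto simp: suminf_eq_SUP intro!: SUP_least)
      qed
      also have "ennreal (S + e) = ennreal S + ennreal e"
        using \<open>0 < e\<close> cSUP_upper[OF _ bdd, of "{}"] by (intro ennreal_plus) (auto simp: S_def)
      finally show "hausdorff_pre k \<delta> E \<le> ennreal S + ennreal e" .
    qed
    also have "\<dots> \<le> ennreal (L / t)" using SL by (rule ennreal_leI)
    finally show ?thesis .
  qed
  then have "hausdorff_outer k E \<le> ennreal (L / t)" by (rule hausdorff_outer_le)
  then have "ennreal t * hausdorff_outer k E \<le> ennreal t * ennreal (L / t)" by (rule mult_left_mono) auto
  also have "\<dots> = ennreal L" using t L by (simp add: ennreal_mult[symmetric])
  finally show ?thesis .
qed

section \<open>The fundamental lemma of the calculus of variations\<close>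

text \<open>The derivatives of \<open>exp (- 1 / t)\<close> are combinations of these functions.\<close>

definition flat :: "nat \<Rightarrow> real \<Rightarrow> real" where
  "flat k t = (if 0 < t then (1 / t) ^ k * exp (- (1 / t)) else 0)"

lemma flat_tendsto_0: "(flat k \<longlongrightarrow> 0) (at 0)"
proof -
  have "((\<lambda>t. inverse t ^ k / exp (inverse t)) \<longlongrightarrow> 0) (at_right (0::real))"
    by (rule filterlim_compose[OF tendsto_power_div_exp_0 filterlim_inverse_at_top_right])
  then have "(flat k \<longlongrightarrow> 0) (at_right 0)"
    by (rule Lim_transform_eventually)
       (auto simp: flat_def eventually_at_filter exp_minus divide_inverse)
  moreover have "(flat k \<longlongrightarrow> 0) (at_left 0)"
    by (rule Lim_transform_eventually[OF tendsto_const]) (auto simp: flat_def eventually_at_filter)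
  ultimately show ?thesis by (simp add: filterlim_split_at)
qed

text \<open>At 0 the difference quotient of \<open>flat k\<close> is \<open>flat (Suc k)\<close>,
  which tends to 0. Derivatives thus stay in the span of the family.\<close>

lemma DERIV_flat: "(flat k has_real_derivative flat (k + 2) t - real k * flat (k + 1) t) (at t)"
proof -
  consider "t > 0" | "t < 0" | "t = 0" by linarith
  then show ?thesis
  proof cases
    case 1
    define u where "u = 1 / t"
    have "((\<lambda>t. (1 / t) ^ k * exp (- (1 / t))) has_real_derivative
        (real k * u ^ (k - 1) * (- (u * u))) * exp (- u) + u ^ k * (exp (- u) * (u * u))) (at t)"
      unfolding u_def using 1
      by (auto intro!: derivative_eq_intros simp: power2_eq_square)
    also have "(real k * u ^ (k - 1) * (- (u * u))) * exp (- u) + u ^ k * (exp (- u) * (u * u))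
        = flat (k + 2) t - real k * flat (k + 1) t"
      using 1 by (cases k) (auto simp: flat_def u_def[symmetric] algebra_simps)
    finally have "((\<lambda>t. (1 / t) ^ k * exp (- (1 / t))) has_real_derivative flat (k + 2) t - real k * flat (k + 1) t) (at t)" .
    then show ?thesis
      by (rule has_field_derivative_transform_within_open[of _ _ _ "{0<..}"]) (use 1 in \<open>auto simp: flat_def\<close>)
  next
    case 2
    have "((\<lambda>t. 0) has_real_derivative flat (k + 2) t - real k * flat (k + 1) t) (at t)"
      using 2 by (auto simp: flat_def)
    then show ?thesis
      by (rule has_field_derivative_transform_within_open[of _ _ _ "{..<0}"]) (use 2 in \<open>auto simp: flat_def\<close>)
  next
    case 3
    have "((\<lambda>h. (flat k (0 + h) - flat k 0) / h) \<longlongrightarrow> 0) (at 0)"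
      by (rule Lim_transform_eventually[OF flat_tendsto_0[of "Suc k"]])
         (auto simp: flat_def eventually_at_filter)
    then show ?thesis using 3 by (simp add: DERIV_def flat_def)
  qed
qed

lemma flat_0_bounds: "0 \<le> flat 0 t" "flat 0 t \<le> 1" "flat 0 t \<noteq> 0 \<longleftrightarrow> 0 < t"
  by (auto simp: flat_def)

text \<open>\<open>smooth\<close> asks that every iterated partial derivative be differentiable.
  This algebra consists of differentiable functions and is closed under partial derivatives, so
  induction on the word proves all its members smooth at once.\<close>

inductive_set flat_algebra :: "(real^'N::finite \<Rightarrow> real) set" where
  const: "(\<lambda>_. c) \<in> flat_algebra"
| flat: "(\<lambda>x. flat k (c * x $ i + d)) \<in> flat_algebra"
| add: "f \<in> flat_algebra \<Longrightarrow> g \<in> flat_algebra \<Longrightarrow> (\<lambda>x. f x + g x) \<in> flat_algebra"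
| mult: "f \<in> flat_algebra \<Longrightarrow> g \<in> flat_algebra \<Longrightarrow> (\<lambda>x. f x * g x) \<in> flat_algebra"

lemma flat_algebra_derivative:
  assumes "f \<in> flat_algebra"
  shows "\<exists>D. (\<forall>x. (f has_derivative D x) (at x)) \<and> (\<forall>j. (\<lambda>x. D x (axis j 1)) \<in> flat_algebra)"
  using assms
proof induction
  case (const c)
  show ?case
    by (rule exI[of _ "\<lambda>x h. 0"]) (auto intro: flat_algebra.const)
next
  case (flat k c i d)
  let ?D = "\<lambda>x h. (c * h $ i) * (flat (k + 2) (c * x $ i + d) - real k * flat (k + 1) (c * x $ i + d))"
  have "((\<lambda>x. flat k (c * x $ i + d)) has_derivative ?D x) (at x)" for x :: "real^'a"
  proof -
    have 1: "((\<lambda>x. c * x $ i + d) has_derivative (\<lambda>h. c * h $ i)) (at x)"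
      by (auto intro!: derivative_eq_intros bounded_linear.has_derivative[OF bounded_linear_vec_nth])
    show ?thesis
      using has_derivative_compose[OF 1 DERIV_flat[of k "c * x $ i + d", unfolded has_field_derivative_def]]
      by (simp add: mult.commute)
  qed
  moreover have "(\<lambda>x. ?D x (axis j 1)) \<in> flat_algebra" for j
  proof -
    have "(\<lambda>x::real^'a. (c * axis j 1 $ i) * (flat (k + 2) (c * x $ i + d) + (- real k) * flat (k + 1) (c * x $ i + d))) \<in> flat_algebra"
      by (intro flat_algebra.intros)
    then show ?thesis by simp
  qed
  ultimately show ?case by (intro exI[of _ ?D]) simp
next
  case (add f g)
  then obtain D E where D: "\<And>x. (f has_derivative D x) (at x)" "\<And>j. (\<lambda>x. D x (axis j 1)) \<in> flat_algebra"
    and E: "\<And>x. (g has_derivative E x) (at x)" "\<And>j. (\<lambda>x. E x (axis j 1)) \<in> flat_algebra" by blast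
  show ?case
    using has_derivative_add[OF D(1) E(1)] flat_algebra.add[OF D(2) E(2)]
    by (intro exI[of _ "\<lambda>x h. D x h + E x h"]) blast
next
  case (mult f g)
  then obtain D E where D: "\<And>x. (f has_derivative D x) (at x)" "\<And>j. (\<lambda>x. D x (axis j 1)) \<in> flat_algebra"
    and E: "\<And>x. (g has_derivative E x) (at x)" "\<And>j. (\<lambda>x. E x (axis j 1)) \<in> flat_algebra" by blast
  show ?case
    using has_derivative_mult[OF D(1) E(1)]
      flat_algebra.add[OF flat_algebra.mult[OF mult.hyps(1) E(2)] flat_algebra.mult[OF D(2) mult.hyps(2)]]
    by (intro exI[of _ "\<lambda>x h. f x * E x h + D x h * g x"]) blast
qed

lemma partial_eq: "(f has_derivative D) (at x) \<Longrightarrow> partial j f x = D (axis j 1)"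
  unfolding partial_def by (metis frechet_derivative_at)

lemma flat_algebra_partials:
  assumes "f \<in> flat_algebra"
  shows "partials \<alpha> f \<in> flat_algebra"
proof (induction \<alpha>)
  case (Cons j \<alpha>)
  then obtain D where D: "\<And>x. (partials \<alpha> f has_derivative D x) (at x)" "(\<lambda>x. D x (axis j 1)) \<in> flat_algebra"
    using flat_algebra_derivative by blast
  then have "partials (j # \<alpha>) f = (\<lambda>x. D x (axis j 1))"
    by (auto simp: partials_def partial_eq)
  with D show ?case by simp
qed (use assms in \<open>simp add: partials_def\<close>)

lemma flat_algebra_smooth: "f \<in> flat_algebra \<Longrightarrow> smooth f"
  unfolding smooth_def differentiable_def
  using flat_algebra_derivative[OF flat_algebra_partials] by blast

lemma flat_algebra_prod:
  "finite I \<Longrightarrow> (\<And>i. i \<in> I \<Longrightarrow> f i \<in> flat_algebra) \<Longrightarrow> (\<lambda>x. \<Prod>i\<in>I. f i x) \<in> flat_algebra"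
  by (induction I rule: finite_induct) (simp_all add: flat_algebra.const flat_algebra.mult)

text \<open>As \<open>n\<close> grows this increases to the indicator function of \<open>box a b\<close>.\<close>

definition bump :: "nat \<Rightarrow> real^'N::finite \<Rightarrow> real^'N \<Rightarrow> real^'N \<Rightarrow> real" where
  "bump n a b x = (\<Prod>i\<in>UNIV. flat 0 (real n * (x $ i - a $ i)) * flat 0 (real n * (b $ i - x $ i)))"

lemma bump_bounds: "0 \<le> bump n a b x" "bump n a b x \<le> 1"
proof -
  show "0 \<le> bump n a b x" unfolding bump_def by (intro prod_nonneg) (auto simp: flat_0_bounds)
  show "bump n a b x \<le> 1" unfolding bump_def
    by (intro prod_le_1) (auto simp: flat_0_bounds intro: mult_le_one)
qed

lemma bump_outside: "x \<notin> box a b \<Longrightarrow> bump n a b x = 0"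
proof -
  assume "x \<notin> box a b"
  then obtain i where i: "x $ i \<le> a $ i \<or> b $ i \<le> x $ i" by (auto simp: mem_box_cart not_less)
  have "\<not> 0 < real n * (x $ i - a $ i) \<or> \<not> 0 < real n * (b $ i - x $ i)"
    using i by (auto simp: not_less mult_nonneg_nonpos zero_less_mult_iff)
  then have "flat 0 (real n * (x $ i - a $ i)) * flat 0 (real n * (b $ i - x $ i)) = 0"
    by (auto simp: flat_def)
  then show ?thesis unfolding bump_def by (auto intro!: prod_zero)
qed

lemma bump_tendsto: "(\<lambda>n. bump n a b x) \<longlonglongrightarrow> indicator (box a b) x"
proof (cases "x \<in> box a b")
  case True
  have lim: "(\<lambda>n. flat 0 (real n * c)) \<longlonglongrightarrow> 1" if "0 < c" for c
  proof -
    have "(\<lambda>n. exp (- ((1 / c) * (1 / real n)))) \<longlonglongrightarrow> exp (- ((1 / c) * 0))"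
      by (intro tendsto_intros lim_1_over_n)
    then have "(\<lambda>n. exp (- ((1 / c) * (1 / real n)))) \<longlonglongrightarrow> 1" by simp
    then show ?thesis
      by (rule Lim_transform_eventually)
         (use that in \<open>auto simp: flat_def eventually_sequentially mult.commute intro!: exI[of _ 1]\<close>)
  qed
  have "(\<lambda>n. bump n a b x) \<longlonglongrightarrow> (\<Prod>i\<in>(UNIV::'a set). 1 * 1)"
    unfolding bump_def using True by (intro tendsto_prod tendsto_mult lim) (auto simp: mem_box_cart)
  then show ?thesis using True by simp
qed (simp add: bump_outside)

lemma bump_test_fun:
  assumes "cbox a b \<subseteq> U"
  shows "bump n a b \<in> test_fun U"
proof -
  have "(\<lambda>x. \<Prod>i\<in>UNIV. flat 0 (real n * x $ i + (- real n * a $ i)) * flat 0 (- real n * x $ i + real n * b $ i)) \<in> flat_algebra"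
    by (intro flat_algebra_prod flat_algebra.mult flat_algebra.flat) auto
  also have "(\<lambda>x. \<Prod>i\<in>UNIV. flat 0 (real n * x $ i + (- real n * a $ i)) * flat 0 (- real n * x $ i + real n * b $ i)) = bump n a b"
    by (auto simp: bump_def algebra_simps fun_eq_iff)
  finally have "smooth (bump n a b)" by (rule flat_algebra_smooth)
  moreover have "{x. bump n a b x \<noteq> 0} \<subseteq> cbox a b" using bump_outside box_subset_cbox by blast
  then have "supp (bump n a b) \<subseteq> cbox a b" unfolding supp_def by (intro closure_minimal closed_cbox)
  moreover then have "compact (supp (bump n a b))"
    unfolding supp_def by (meson bounded_cbox bounded_subset closed_closure compact_eq_bounded_closed)
  ultimately show ?thesis using assms by (auto simp: test_fun_def)
qed

section \<open>Functions whose integrals over boxes vanish\<close>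

lemma AE_zero_of_box_integrals_borel:
  fixes h :: "'a::euclidean_space \<Rightarrow> real"
  assumes h: "integrable lborel h" and z: "\<And>a b. (LINT x|lborel. indicator (box a b) x * h x) = 0"
  shows "AE x in lborel. h x = 0"
proof -
  have [measurable]: "h \<in> borel_measurable lborel" using h by auto
  \<comment> \<open>Since \<open>ennreal\<close> truncates at 0, these are the positive and negative
    parts of \<open>h\<close>. As densities they define two measures that agree on boxes, a
    generator stable under intersection; hence the measures coincide and the two parts are equal
    almost everywhere.\<close>
  let ?p = "\<lambda>x. ennreal (h x)" and ?n = "\<lambda>x. ennreal (- h x)"
  have hi: "integrable lborel (\<lambda>x. indicator (box a b) x * h x)" for a b
    using integrable_mult_indicator[OF _ h, of "box a b"] by simp
  have eq: "emeasure (density lborel ?p) (box a b) = emeasure (density lborel ?n) (box a b)" for a b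
  proof -
    let ?g = "\<lambda>x. indicator (box a b) x * h x"
    let ?I = "\<integral>\<^sup>+x. ennreal (indicator (box a b) x * h x) \<partial>lborel"
    let ?J = "\<integral>\<^sup>+x. ennreal (- (indicator (box a b) x * h x)) \<partial>lborel"
    have fin: "?I < \<infinity>" "?J < \<infinity>"
      using hi[of a b] by (auto simp: real_integrable_def top.not_eq_extremum)
    have "enn2real ?I - enn2real ?J = 0"
      using z[of a b] real_lebesgue_integral_def[OF hi[of a b]] by simp
    then have "?I = ?J"
      using fin by (metis diff_eq_diff_eq diff_self ennreal_enn2real infinity_ennreal_def)
    moreover have "ennreal (?g x) = ?p x * indicator (box a b) x" "ennreal (- ?g x) = ?n x * indicator (box a b) x" for x
      by (auto simp: indicator_def)
    ultimately show ?thesis by (simp add: emeasure_density)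
  qed
  have "density lborel ?p = density lborel ?n"
  proof (rule measure_eqI_generator_eq[where E="range (\<lambda>(a,b). box a b)" and \<Omega>=UNIV and A="\<lambda>n::nat. box (- real n *\<^sub>R One) (real n *\<^sub>R One)"])
    show "Int_stable (range (\<lambda>(a, b). box a b :: 'a set))"
      by (auto simp: Int_stable_def box_Int_box)
    show "sets (density lborel ?p) = sigma_sets UNIV (range (\<lambda>(a, b). box a b))"
      "sets (density lborel ?n) = sigma_sets UNIV (range (\<lambda>(a, b). box a b))"
      by (auto simp: borel_eq_box)
    show "(\<Union>i::nat. box (- real i *\<^sub>R One) (real i *\<^sub>R One)) = (UNIV::'a set)"
      using UN_box_eq_UNIV by simp
    show "emeasure (density lborel ?p) (box (- real i *\<^sub>R One) (real i *\<^sub>R One)) \<noteq> \<infinity>" for i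
    proof -
      have "emeasure (density lborel ?p) (box (- real i *\<^sub>R One) (real i *\<^sub>R One)) \<le> (\<integral>\<^sup>+x. ?p x \<partial>lborel)"
        by (subst emeasure_density) (auto intro!: nn_integral_mono simp: indicator_def)
      also have "\<dots> < \<infinity>" using h by (auto simp: real_integrable_def top.not_eq_extremum)
      finally show ?thesis by auto
    qed
  qed (use eq in auto)
  then have "AE x in lborel. ?p x = ?n x"
    by (intro sigma_finite_measure.density_unique[OF sigma_finite_lborel]) auto
  then show ?thesis
  proof eventually_elim
    case (elim x)
    show "h x = 0"
    proof (cases "0 \<le> h x")
      case True
      then show ?thesis using elim by (simp add: ennreal_neg)
    next
      case False
      then show ?thesis using elim by (simp add: ennreal_neg)
    qed
  qed
qed

text \<open>\<open>h\<close> is replaced by a Borel representative, since the generator argument is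
  carried out for \<open>lborel\<close>.\<close>

lemma AE_zero_of_box_integrals:
  fixes h :: "'a::euclidean_space \<Rightarrow> real"
  assumes h: "integrable lebesgue h" and z: "\<And>a b. (LINT x|lebesgue. indicator (box a b) x * h x) = 0"
  shows "AE x in lebesgue. h x = 0"
proof -
  obtain g where g: "g \<in> borel_measurable lborel" "AE x in lborel. h x = g x"
    using completion_ex_borel_measurable_real[of h lborel] h by auto
  then have ae: "AE x in lebesgue. h x = g x" by (auto intro: AE_completion)
  have "integrable lebesgue g"
    using h ae g(1) by (subst integrable_cong_AE[where g=h]) (auto simp: measurable_completion)
  then have "integrable lborel g" using g(1) by (simp add: integrable_completion)
  moreover have "(LINT x|lborel. indicator (box a b) x * g x) = 0" for a b
  proof -
    have "(LINT x|lborel. indicator (box a b) x * g x) = (LINT x|lebesgue. indicator (box a b) x * g x)"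
      using g(1) by (intro integral_completion[symmetric]) simp
    also have "\<dots> = (LINT x|lebesgue. indicator (box a b) x * h x)"
      using ae g(1) h
      by (intro integral_cong_AE borel_measurable_times borel_measurable_indicator) (auto simp: measurable_completion)
    finally show ?thesis using z by simp
  qed
  ultimately have "AE x in lborel. g x = 0" by (rule AE_zero_of_box_integrals_borel)
  then have "AE x in lebesgue. g x = 0" by (rule AE_completion)
  then show ?thesis using ae by eventually_elim simp
qed


text \<open>Bumps are test functions, and dominated convergence passes from them to indicators of
  boxes. This works in every box whose closure lies in \<open>U\<close>, and countably many closed
  boxes make up \<open>U\<close>.\<close>

lemma weak_zero_AE_zero:
  fixes g :: "real^'N::finite \<Rightarrow> real^'m::finite"
  assumes "open U" and g: "loc_integrable U g"
    and z: "\<And>\<phi>. \<phi> \<in> test_fun U \<Longrightarrow> (LINT x|lebesgue_on U. \<phi> x *\<^sub>R g x) = 0"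
  shows "AE x in lebesgue_on U. g x = 0"
proof -
  have Us: "U \<in> sets lebesgue" using \<open>open U\<close> by simp
  have box0: "AE x in lebesgue. x \<in> box a b \<longrightarrow> g x = 0" if ab: "cbox a b \<subseteq> U" for a b
  proof (cases "box a b = {}")
    case False
    have sub: "box a b \<subseteq> U" using ab box_subset_cbox by blast
    \<comment> \<open>Cut off to a box with closure in \<open>U\<close>, \<open>g\<close> is
      integrable on the whole space. Its norm is the dominating function below, and only boxes
      inside this one have to be tested.\<close>
    let ?g = "\<lambda>x. indicator (box a b) x *\<^sub>R g x"
    have "compactly_inside (box a b) U"
      unfolding compactly_inside_def closure_box[OF False] using ab by auto
    then have gi: "integrable lebesgue ?g"
      using g unfolding loc_integrable_def
      by (subst integrable_restrict_space[symmetric]) auto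
    have zero: "(LINT x|lebesgue. indicator (box c d) x *\<^sub>R g x) = 0" if cd: "box c d \<subseteq> box a b" for c d
    proof (cases "box c d = {}")
      case False
      have cd': "cbox c d \<subseteq> U" using closure_mono[OF cd] False \<open>box a b \<noteq> {}\<close> ab by (auto simp: closure_box)
      have "(\<lambda>n. LINT x|lebesgue. bump n c d x *\<^sub>R g x) \<longlonglongrightarrow> (LINT x|lebesgue. indicator (box c d) x *\<^sub>R g x)"
      proof (rule integral_dominated_convergence)
        have meas: "?g \<in> borel_measurable lebesgue"
          using gi by (rule borel_measurable_integrable)
        have "(\<lambda>x. indicator (box c d) x *\<^sub>R ?g x) \<in> borel_measurable lebesgue"
          by (intro borel_measurable_scaleR[OF _ meas] borel_measurable_indicator) simp
        also have "(\<lambda>x. indicator (box c d) x *\<^sub>R ?g x) = (\<lambda>x. indicator (box c d) x *\<^sub>R g x)"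
          using cd by (auto simp: indicator_def fun_eq_iff)
        finally show "(\<lambda>x. indicator (box c d) x *\<^sub>R g x) \<in> borel_measurable lebesgue" .
        show "(\<lambda>x. bump n c d x *\<^sub>R g x) \<in> borel_measurable lebesgue" for n
        proof -
          have "continuous_on UNIV (bump n c d)"
            using bump_test_fun[OF cd', of n]
            by (auto simp: test_fun_def smooth_def partials_def intro!: differentiable_imp_continuous_on differentiable_at_imp_differentiable_on dest: spec[of _ "[]"])
          then have "bump n c d \<in> borel_measurable lebesgue"
            by (simp add: borel_measurable_continuous_onI measurable_completion)
          then have "(\<lambda>x. bump n c d x *\<^sub>R ?g x) \<in> borel_measurable lebesgue"
            by (intro borel_measurable_scaleR[OF _ meas])
          also have "(\<lambda>x. bump n c d x *\<^sub>R ?g x) = (\<lambda>x. bump n c d x *\<^sub>R g x)"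
            using cd bump_outside[of _ c d n] by (auto simp: indicator_def fun_eq_iff)
          finally show ?thesis .
        qed
        show "integrable lebesgue (\<lambda>x. norm (?g x))" by (rule integrable_norm[OF gi])
        show "AE x in lebesgue. (\<lambda>n. bump n c d x *\<^sub>R g x) \<longlonglongrightarrow> indicator (box c d) x *\<^sub>R g x"
          by (intro always_eventually allI tendsto_scaleR bump_tendsto tendsto_const)
        show "AE x in lebesgue. norm (bump n c d x *\<^sub>R g x) \<le> norm (?g x)" for n
        proof (intro always_eventually allI)
          fix x
          show "norm (bump n c d x *\<^sub>R g x) \<le> norm (?g x)"
            using cd bump_outside[of x c d n] bump_bounds[of n c d x]
            by (cases "x \<in> box c d") (auto simp: mult_left_le_one_le)
        qed
      qed
      moreover have "(LINT x|lebesgue. bump n c d x *\<^sub>R g x) = 0" for n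
      proof -
        have "(LINT x|lebesgue. bump n c d x *\<^sub>R g x) = (LINT x|lebesgue_on U. bump n c d x *\<^sub>R g x)"
        proof (subst integral_restrict_space)
          have "bump n c d x = 0" if "x \<notin> U" for x
            using bump_outside[of x c d n] cd sub that by auto
          then show "(LINT x|lebesgue. bump n c d x *\<^sub>R g x) = (LINT x|lebesgue. indicator U x *\<^sub>R bump n c d x *\<^sub>R g x)"
            by (intro Bochner_Integration.integral_cong) (auto simp: indicator_def)
        qed (use Us in auto)
        then show ?thesis using z bump_test_fun[OF cd'] by simp
      qed
      ultimately show ?thesis by (simp add: LIMSEQ_const_iff)
    qed simp
    have "AE x in lebesgue. indicator (box a b) x * g x $ j = 0" for j
    proof (rule AE_zero_of_box_integrals)
      show "integrable lebesgue (\<lambda>x. indicator (box a b) x * g x $ j)"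
        using integrable_bounded_linear[OF bounded_linear_vec_nth gi, of j] by simp
      fix c d
      obtain c' d' where cd': "box a b \<inter> box c d = box c' d'" using box_Int_box by blast
      have "integrable lebesgue (\<lambda>x. indicator (box c d) x *\<^sub>R ?g x)"
        by (rule integrable_mult_indicator[OF _ gi]) simp
      moreover have "(\<lambda>x. indicator (box c d) x *\<^sub>R ?g x) = (\<lambda>x. indicator (box c' d') x *\<^sub>R g x)"
        using cd' by (auto simp: fun_eq_iff indicator_def)
      ultimately have "(LINT x|lebesgue. (indicator (box c' d') x *\<^sub>R g x) $ j) = (LINT x|lebesgue. (indicator (box c' d') x *\<^sub>R g x)) $ j"
        by (intro integral_bounded_linear bounded_linear_vec_nth) simp
      moreover have "box c' d' \<subseteq> box a b" using cd' by blast
      ultimately have "(LINT x|lebesgue. (indicator (box c' d') x *\<^sub>R g x) $ j) = 0" using zero by simp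
      moreover have "(\<lambda>x. (indicator (box c' d') x *\<^sub>R g x) $ j) = (\<lambda>x. indicator (box c d) x * (indicator (box a b) x * g x $ j))"
        using cd' by (auto simp: indicator_def fun_eq_iff)
      ultimately show "(LINT x|lebesgue. indicator (box c d) x * (indicator (box a b) x * g x $ j)) = 0"
        by (simp only:)
    qed
    then have "AE x in lebesgue. \<forall>j. indicator (box a b) x * g x $ j = 0"
      unfolding AE_all_countable by blast
    then show ?thesis by eventually_elim (auto simp: vec_eq_iff)
  qed simp
  obtain \<D> where \<D>: "countable \<D>" "\<D> \<subseteq> Pow U" "\<And>X. X \<in> \<D> \<Longrightarrow> \<exists>a b. X = cbox a b" "\<Union>\<D> = U"
    using open_countable_Union_open_cbox[OF \<open>open U\<close>] by metis
  have "AE x in lebesgue. x \<in> X \<longrightarrow> g x = 0" if XD: "X \<in> \<D>" for X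
  proof -
    obtain a b where X: "X = cbox a b" "cbox a b \<subseteq> U" using \<D>(2) \<D>(3)[OF XD] XD by auto
    \<comment> \<open>The cover consists of closed boxes while the result concerns open ones; the
      frontiers are null.\<close>
    have "AE x in lebesgue. x \<notin> frontier (cbox a b)"
      using negligible_convex_frontier[OF convex_box(1), of a b]
      by (auto simp: negligible_iff_null_sets intro: AE_not_in)
    with box0[OF X(2)] show ?thesis unfolding X(1)
      by eventually_elim (auto simp: frontier_cbox)
  qed
  then have "AE x in lebesgue. \<forall>X\<in>\<D>. x \<in> X \<longrightarrow> g x = 0"
    unfolding AE_ball_countable[OF \<D>(1)] by blast
  then have "AE x in lebesgue. x \<in> U \<longrightarrow> g x = 0"
    by eventually_elim (use \<D>(4) in blast)
  then show ?thesis using Us by (simp add: AE_restrict_space_iff)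
qed

abbreviation zoom :: "'a::real_vector \<Rightarrow> real \<Rightarrow> 'a \<Rightarrow> 'a" where
  "zoom x0 s \<equiv> \<lambda>y. x0 + s *\<^sub>R y"

text \<open>The inverse of \<open>zoom x0 s\<close> for s \<noteq> 0, written again as a
  \<open>zoom\<close> so that the lemmas on affine maps apply in both directions.\<close>

abbreviation unzoom :: "'a::real_vector \<Rightarrow> real \<Rightarrow> 'a \<Rightarrow> 'a" where
  "unzoom x0 s \<equiv> zoom (- ((1/s) *\<^sub>R x0)) (1/s)"

section \<open>Affine changes of variables\<close>

lemma smooth_partials_differentiable: "smooth f \<Longrightarrow> partials \<alpha> f differentiable (at x)"
  by (simp add: smooth_def)

text \<open>The factor \<open>c\<close> and the differentiability are carried along so that the
  formula iterates along a word of derivatives.\<close>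

lemma partial_affine:
  fixes f :: "real^'N::finite \<Rightarrow> real"
  assumes "f differentiable (at (zoom x0 s y))"
  shows "((\<lambda>y. c * f (zoom x0 s y)) differentiable (at y)) \<and>
    partial j (\<lambda>y. c * f (zoom x0 s y)) y = c * s * partial j f (zoom x0 s y)"
proof -
  obtain D where D: "(f has_derivative D) (at (zoom x0 s y))" using assms by (auto simp: differentiable_def)
  then interpret D: bounded_linear D by (rule has_derivative_bounded_linear)
  have "((zoom x0 s) has_derivative (\<lambda>h. s *\<^sub>R h)) (at y)"
    by (auto intro!: derivative_eq_intros)
  from has_derivative_compose[OF this D]
  have "((\<lambda>y. c * f (zoom x0 s y)) has_derivative (\<lambda>h. c * D (s *\<^sub>R h))) (at y)"
    by (intro has_derivative_mult_right)
  then show ?thesis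
    using partial_eq[of _ "\<lambda>h. c * D (s *\<^sub>R h)"] partial_eq[OF D, of j] by (auto simp: D.scaleR differentiable_def)
qed

lemma partials_affine:
  fixes f :: "real^'N::finite \<Rightarrow> real"
  assumes "smooth f"
  shows "partials \<alpha> (\<lambda>y. f (zoom x0 s y)) = (\<lambda>y. s ^ length \<alpha> * partials \<alpha> f (zoom x0 s y))"
proof (induction \<alpha>)
  case (Cons j \<alpha>)
  have "partials (j # \<alpha>) (\<lambda>y. f (zoom x0 s y)) = partial j (\<lambda>y. s ^ length \<alpha> * partials \<alpha> f (zoom x0 s y))"
    using Cons by (simp add: partials_def)
  also have "\<dots> = (\<lambda>y. s ^ length (j # \<alpha>) * partials (j # \<alpha>) f (zoom x0 s y))"
    using partial_affine[OF smooth_partials_differentiable[OF assms, of \<alpha>]] by (auto simp: fun_eq_iff partials_def)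
  finally show ?case .
qed (simp add: partials_def)

lemma smooth_affine: "smooth f \<Longrightarrow> smooth (\<lambda>y. f (zoom x0 s y))"
  unfolding smooth_def[of "\<lambda>y. f (zoom x0 s y)"] partials_affine
  using partial_affine[OF smooth_partials_differentiable] by blast

lemma supp_affine_subset: "supp (\<lambda>x. \<phi> (zoom x0 s x)) \<subseteq> zoom x0 s -` supp \<phi>"
  unfolding supp_def
proof (rule closure_minimal)
  show "{x. \<phi> (zoom x0 s x) \<noteq> 0} \<subseteq> zoom x0 s -` closure {x. \<phi> x \<noteq> 0}"
    using closure_subset by fastforce
  show "closed (zoom x0 s -` closure {x. \<phi> x \<noteq> 0})"
    by (intro continuous_closed_vimage closed_closure continuous_intros)
qed

lemma affine_inverse: "s \<noteq> 0 \<Longrightarrow> (zoom x0 s y = x) \<longleftrightarrow> (y = unzoom x0 s x)"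
  for x y :: "'a::real_vector"
  by (auto simp: scaleR_right_distrib scaleR_diff_right)

lemma affine_vimage: "s \<noteq> 0 \<Longrightarrow> zoom x0 s -` K = unzoom x0 s ` K"
  for K :: "'a::real_vector set"
  using affine_inverse[of s x0] by (auto simp: image_iff)

lemma test_fun_affine:
  assumes "\<phi> \<in> test_fun V" "s \<noteq> 0" "\<And>x. zoom x0 s x \<in> V \<Longrightarrow> x \<in> U"
  shows "(\<lambda>x. \<phi> (zoom x0 s x)) \<in> test_fun U"
proof -
  have K: "compact (zoom x0 s -` supp \<phi>)"
    unfolding affine_vimage[OF assms(2)] using assms(1)
    by (intro compact_continuous_image continuous_intros) (auto simp: test_fun_def)
  have "compact (supp (\<lambda>x. \<phi> (zoom x0 s x)))"
    using K supp_affine_subset[of \<phi> x0 s] unfolding supp_def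
    by (metis closed_closure compact_eq_bounded_closed bounded_subset)
  then show ?thesis
    using assms supp_affine_subset[of \<phi> x0 s] by (auto simp: test_fun_def smooth_affine)
qed

text \<open>The complement of the support is open, so vanishing there passes from a function to its
  derivatives.\<close>

lemma partials_zero_outside_supp:
  assumes "x \<notin> supp \<phi>"
  shows "partials \<alpha> \<phi> x = 0"
proof -
  have op: "open (- supp \<phi>)" unfolding supp_def by (intro open_Compl closed_closure)
  have "\<forall>x. x \<notin> supp \<phi> \<longrightarrow> partials \<alpha> \<phi> x = 0"
  proof (induction \<alpha>)
    case Nil
    then show ?case using closure_subset[of "{x. \<phi> x \<noteq> 0}"] by (auto simp: partials_def supp_def)
  next
    case (Cons j \<alpha>)
    have "(partials \<alpha> \<phi> has_derivative (\<lambda>h. 0)) (at x)" if "x \<notin> supp \<phi>" for x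
      by (rule has_derivative_transform_within_open[OF has_derivative_const op]) (use that Cons in auto)
    then show ?case using partial_eq[of "partials \<alpha> \<phi>" "\<lambda>h. 0"] by (auto simp: partials_def)
  qed
  then show ?thesis using assms by blast
qed

lemma partial_test_fun:
  assumes "\<phi> \<in> test_fun U"
  shows "partial j \<phi> \<in> test_fun U"
proof -
  have "partials \<alpha> (partial j \<phi>) = partials (\<alpha> @ [j]) \<phi>" for \<alpha> by (simp add: partials_def)
  then have "smooth (partial j \<phi>)" using assms by (auto simp: smooth_def test_fun_def)
  moreover have "supp (partial j \<phi>) \<subseteq> supp \<phi>"
    unfolding supp_def[of "partial j \<phi>"]
    using partials_zero_outside_supp[of _ \<phi> "[j]"] by (intro closure_minimal) (auto simp: partials_def supp_def)
  moreover have "compact (supp (partial j \<phi>))"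
    using calculation(2) assms unfolding supp_def[of "partial j \<phi>"] test_fun_def
    by (metis (no_types, lifting) closed_closure compact_eq_bounded_closed bounded_subset mem_Collect_eq)
  ultimately show ?thesis using assms by (auto simp: test_fun_def)
qed

lemma test_fun_continuous: "\<phi> \<in> test_fun U \<Longrightarrow> continuous_on S (partials \<alpha> \<phi>)"
  by (auto simp: test_fun_def intro!: differentiable_imp_continuous_on differentiable_at_imp_differentiable_on smooth_partials_differentiable)

lemma test_fun_outside: "\<phi> \<in> test_fun U \<Longrightarrow> x \<notin> U \<Longrightarrow> partials \<alpha> \<phi> x = 0"
  using partials_zero_outside_supp by (auto simp: test_fun_def)

lemma test_fun_bounded:
  assumes "\<phi> \<in> test_fun U"
  obtains b where "\<And>x. \<bar>partials \<alpha> \<phi> x\<bar> \<le> b"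
proof -
  have "bounded (partials \<alpha> \<phi> ` supp \<phi>)"
    using assms test_fun_continuous[OF assms] by (intro compact_imp_bounded compact_continuous_image) (auto simp: test_fun_def)
  then obtain b where b: "\<And>x. x \<in> supp \<phi> \<Longrightarrow> \<bar>partials \<alpha> \<phi> x\<bar> \<le> b" by (auto simp: bounded_iff)
  have "\<bar>partials \<alpha> \<phi> x\<bar> \<le> max b 0" for x
    using b[of x] partials_zero_outside_supp[of x \<phi> \<alpha>] by (cases "x \<in> supp \<phi>") auto
  then show ?thesis by (rule that)
qed

text \<open>The continuity estimate of \<open>v\<close> on the image of \<open>K\<close> is pulled
  back: each derivative gains a factor 1/s, and words of length at most k gain at most (max 1
  (1/s))^k. The free constant \<open>c\<close> is fixed later, when the gradient is
  computed.\<close>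

lemma distribution_affine:
  fixes v :: "(real^'N::finite \<Rightarrow> real) \<Rightarrow> real^'d::finite"
  assumes v: "distribution U v" and s: "0 < s" and sub: "\<And>y. y \<in> I \<Longrightarrow> zoom x0 s y \<in> U"
  shows "distribution I (\<lambda>\<phi>. c *\<^sub>R v (\<lambda>x. \<phi> (unzoom x0 s x)))"
proof -
  define S where "S x = unzoom x0 s x" for x :: "real^'N"
  let ?c = "\<lambda>\<phi> x. \<phi> (S x)" and ?s = "\<lambda>k \<phi>. \<Sum>\<alpha> | length \<alpha> \<le> k. SUP x. \<bar>partials \<alpha> \<phi> x\<bar>"
  have zoom_unzoom: "x0 + s *\<^sub>R S x = x" for x using affine_inverse[of s x0 "S x" x] s by (auto simp: S_def)
  have tf: "(?c \<phi>) \<in> test_fun U" if "\<phi> \<in> test_fun I" for \<phi>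
    unfolding S_def
  proof (rule test_fun_affine[OF that])
    show "x \<in> U" if "unzoom x0 s x \<in> I" for x
      using sub[OF that] zoom_unzoom[of x] by (simp add: S_def)
  qed (use s in auto)
  have "\<exists>C k. \<forall>\<phi>\<in>test_fun I. supp \<phi> \<subseteq> K \<longrightarrow>
      norm (c *\<^sub>R v (?c \<phi>)) \<le> C * ?s k \<phi>"
    if K: "compact K" "K \<subseteq> I" for K
  proof -
    have "compact (zoom x0 s ` K)" using K by (intro compact_continuous_image continuous_intros)
    moreover have "zoom x0 s ` K \<subseteq> U" using K sub by auto
    ultimately obtain C k where C: "\<And>\<psi>. \<psi> \<in> test_fun U \<Longrightarrow> supp \<psi> \<subseteq> zoom x0 s ` K \<Longrightarrow>
        norm (v \<psi>) \<le> C * (\<Sum>\<alpha> | length \<alpha> \<le> k. SUP x. \<bar>partials \<alpha> \<psi> x\<bar>)"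
      using v unfolding distribution_def by meson
    have fin: "finite {\<alpha> :: 'N list. length \<alpha> \<le> k}"
      using finite_lists_length_le[of "UNIV :: 'N set" k] by simp
    define R where "R = max 1 (1/s) ^ k"
    have "norm (c *\<^sub>R v (?c \<phi>)) \<le> (\<bar>c\<bar> * \<bar>C\<bar> * R) * ?s k \<phi>"
      if \<phi>: "\<phi> \<in> test_fun I" "supp \<phi> \<subseteq> K" for \<phi>
    proof -
      let ?p = "\<lambda>\<alpha>. SUP x. \<bar>partials \<alpha> (?c \<phi>) x\<bar>" and ?q = "\<lambda>\<alpha>. SUP x. \<bar>partials \<alpha> \<phi> x\<bar>"
      have sm: "smooth \<phi>" using \<phi> by (simp add: test_fun_def)
      have "supp (?c \<phi>) \<subseteq> zoom x0 s ` K"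
      proof
        fix x assume "x \<in> supp (?c \<phi>)"
        then have "S x \<in> K" using supp_affine_subset[of \<phi> "- ((1/s) *\<^sub>R x0)" "1/s"] \<phi>(2) by (auto simp: S_def)
        then show "x \<in> zoom x0 s ` K" using zoom_unzoom[of x] by (metis imageI)
      qed
      then have 1: "norm (v (?c \<phi>)) \<le> C * (\<Sum>\<alpha> | length \<alpha> \<le> k. ?p \<alpha>)"
        by (intro C tf \<phi>)
      \<comment> \<open>A real \<open>SUP\<close> is meaningful only for bounded families. Compact
        support provides the bound, and the nonnegativity below depends on it as well.\<close>
      have bd: "bdd_above (range (\<lambda>x. \<bar>partials \<alpha> \<phi> x\<bar>))" for \<alpha>
      proof -
        obtain b where "\<And>x. \<bar>partials \<alpha> \<phi> x\<bar> \<le> b" by (rule test_fun_bounded[OF \<phi>(1), of \<alpha>]) blast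
        then show ?thesis by (intro bdd_aboveI2)
      qed
      have nn: "0 \<le> ?q \<alpha>" for \<alpha>
        by (rule order_trans[OF abs_ge_zero cSUP_upper[OF UNIV_I bd]])
      have R: "\<bar>(1/s) ^ length \<alpha>\<bar> \<le> R" if "length \<alpha> \<le> k" for \<alpha> :: "'N list"
      proof -
        have "(1/s) ^ length \<alpha> \<le> max 1 (1/s) ^ length \<alpha>" using s by (intro power_mono) auto
        also have "\<dots> \<le> R" unfolding R_def using that by (intro power_increasing) auto
        finally show ?thesis using s by simp
      qed
      have 2: "?p \<alpha> \<le> R * ?q \<alpha>"
        and 3: "0 \<le> ?p \<alpha>" if "length \<alpha> \<le> k" for \<alpha>
      proof -
        have le: "\<bar>partials \<alpha> (?c \<phi>) x\<bar> \<le> R * ?q \<alpha>" for x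
        proof -
          have "\<bar>partials \<alpha> (?c \<phi>) x\<bar> = \<bar>(1/s) ^ length \<alpha>\<bar> * \<bar>partials \<alpha> \<phi> (S x)\<bar>"
            unfolding S_def partials_affine[OF sm] by (simp add: abs_mult)
          also have "\<dots> \<le> R * ?q \<alpha>"
            by (intro mult_mono R that cSUP_upper bd) (auto simp: R_def)
          finally show ?thesis .
        qed
        then show "?p \<alpha> \<le> R * ?q \<alpha>"
          by (intro cSUP_least) auto
        have bd': "bdd_above (range (\<lambda>x. \<bar>partials \<alpha> (?c \<phi>) x\<bar>))" using le by (intro bdd_aboveI2)
        have "0 \<le> \<bar>partials \<alpha> (?c \<phi>) 0\<bar>" by simp
        also have "\<dots> \<le> ?p \<alpha>" by (rule cSUP_upper[OF UNIV_I bd'])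
        finally show "0 \<le> ?p \<alpha>" .
      qed
      \<comment> \<open>The constant in the estimate may be negative, hence the passage to its
        absolute value.\<close>
      have "C * (\<Sum>\<alpha> | length \<alpha> \<le> k. ?p \<alpha>)
          \<le> \<bar>C\<bar> * (\<Sum>\<alpha> | length \<alpha> \<le> k. ?p \<alpha>)"
        by (intro mult_right_mono sum_nonneg) (use 3 in auto)
      also have "\<dots> \<le> \<bar>C\<bar> * (\<Sum>\<alpha> | length \<alpha> \<le> k. R * ?q \<alpha>)"
        by (intro mult_left_mono sum_mono) (use 2 in auto)
      finally have "norm (v (?c \<phi>)) \<le> \<bar>C\<bar> * (R * ?s k \<phi>)"
        using 1 by (simp add: sum_distrib_left)
      from mult_left_mono[OF this, of "\<bar>c\<bar>"] show ?thesis by (simp add: mult.assoc)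
    qed
    then show ?thesis by blast
  qed
  moreover have "c *\<^sub>R v (\<lambda>x. \<phi> (S x) + \<psi> (S x)) = c *\<^sub>R v (?c \<phi>) + c *\<^sub>R v (\<lambda>x. \<psi> (S x))"
    if "\<phi> \<in> test_fun I" "\<psi> \<in> test_fun I" for \<phi> \<psi>
    using v tf[OF that(1)] tf[OF that(2)] by (simp add: distribution_def scaleR_add_right)
  moreover have "c *\<^sub>R v (\<lambda>x. b * \<phi> (S x)) = b *\<^sub>R (c *\<^sub>R v (?c \<phi>))" if "\<phi> \<in> test_fun I" for \<phi> b
    using v tf[OF that] by (simp add: distribution_def mult.commute)
  ultimately show ?thesis unfolding distribution_def S_def[symmetric] by blast
qed

section \<open>Lebesgue measure and integrals under affine maps\<close>

lemma affine_lebesgue: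
  fixes x0 :: "real^'N::finite"
  assumes "s \<noteq> 0"
  shows "(lebesgue :: (real^'N) measure) = density (distr lebesgue lebesgue (zoom x0 s)) (\<lambda>_. ennreal (\<bar>s\<bar> ^ CARD('N)))"
    and affine_measurable_lebesgue: "(zoom x0 s) \<in> lebesgue \<rightarrow>\<^sub>M lebesgue"
proof -
  have T: "x0 + (\<Sum>j\<in>Basis. (s * (x \<bullet> j)) *\<^sub>R j) = zoom x0 s x" for x :: "real^'N"
    by (simp only: scaleR_scaleR[symmetric] scaleR_sum_right[symmetric] euclidean_representation)
  show "(lebesgue :: (real^'N) measure) = density (distr lebesgue lebesgue (zoom x0 s)) (\<lambda>_. ennreal (\<bar>s\<bar> ^ CARD('N)))"
    using lebesgue_affine_euclidean[where c="\<lambda>_::real^'N. s" and t=x0] assms by (simp add: T del: scaleR_scaleR)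
  show "(zoom x0 s) \<in> lebesgue \<rightarrow>\<^sub>M lebesgue"
    using lebesgue_affine_measurable[where c="\<lambda>_::real^'N. s" and t=x0] assms by (simp add: T del: scaleR_scaleR)
qed

lemma measurable_affine_iff:
  fixes f :: "real^'N::finite \<Rightarrow> 'b::topological_space"
  assumes "s \<noteq> 0"
  shows "(\<lambda>y. f (zoom x0 s y)) \<in> borel_measurable lebesgue \<longleftrightarrow> f \<in> borel_measurable lebesgue"
proof
  assume "(\<lambda>y. f (zoom x0 s y)) \<in> borel_measurable lebesgue"
  from measurable_compose[OF affine_measurable_lebesgue[of "1/s" "- ((1/s) *\<^sub>R x0)"] this] assms
  show "f \<in> borel_measurable lebesgue" by (simp add: scaleR_right_distrib scaleR_diff_right)
qed (use measurable_compose[OF affine_measurable_lebesgue[OF assms]] in blast)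

lemma nn_integral_affine:
  fixes f :: "real^'N::finite \<Rightarrow> ennreal"
  assumes "s \<noteq> 0" "f \<in> borel_measurable lebesgue"
  shows "(\<integral>\<^sup>+x. f x \<partial>lebesgue) = ennreal (\<bar>s\<bar> ^ CARD('N)) * (\<integral>\<^sup>+y. f (zoom x0 s y) \<partial>lebesgue)"
proof -
  note T = affine_measurable_lebesgue[OF assms(1), of x0]
  have "(\<integral>\<^sup>+x. f x \<partial>lebesgue) = (\<integral>\<^sup>+x. f x \<partial>density (distr lebesgue lebesgue (zoom x0 s)) (\<lambda>_. ennreal (\<bar>s\<bar> ^ CARD('N))))"
    using affine_lebesgue[OF assms(1)] by metis
  also have "\<dots> = (\<integral>\<^sup>+y. ennreal (\<bar>s\<bar> ^ CARD('N)) * f (zoom x0 s y) \<partial>lebesgue)"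
    using T assms(2) by (subst nn_integral_density) (auto simp: nn_integral_distr)
  also have "\<dots> = ennreal (\<bar>s\<bar> ^ CARD('N)) * (\<integral>\<^sup>+y. f (zoom x0 s y) \<partial>lebesgue)"
    using measurable_compose[OF T assms(2)] by (rule nn_integral_cmult)
  finally show ?thesis .
qed

lemma integrable_affine_iff:
  fixes f :: "real^'N::finite \<Rightarrow> 'b::{banach, second_countable_topology}"
  assumes "s \<noteq> 0"
  shows "integrable lebesgue (\<lambda>y. f (zoom x0 s y)) \<longleftrightarrow> integrable lebesgue f"
proof (cases "f \<in> borel_measurable lebesgue")
  case True
  have "(\<integral>\<^sup>+x. ennreal (norm (f x)) \<partial>lebesgue) = ennreal (\<bar>s\<bar> ^ CARD('N)) * (\<integral>\<^sup>+y. ennreal (norm (f (zoom x0 s y))) \<partial>lebesgue)"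
    using True by (intro nn_integral_affine assms) auto
  then show ?thesis
    using True assms measurable_affine_iff[OF assms, of f x0]
    by (auto simp: integrable_iff_bounded ennreal_mult_less_top ennreal_mult_eq_top_iff less_top)
next
  case False
  then show ?thesis using measurable_affine_iff[OF assms, of f x0] borel_measurable_integrable by blast
qed

lemma integral_affine:
  fixes f :: "real^'N::finite \<Rightarrow> 'b::{banach, second_countable_topology}"
  assumes "s \<noteq> 0"
  shows "(LINT x|lebesgue. f x) = \<bar>s\<bar> ^ CARD('N) *\<^sub>R (LINT y|lebesgue. f (zoom x0 s y))"
proof (cases "f \<in> borel_measurable lebesgue")
  case True
  note T = affine_measurable_lebesgue[OF assms(1), of x0]
  have "(LINT x|lebesgue. f x) = (LINT x|density (distr lebesgue lebesgue (zoom x0 s)) (\<lambda>_. ennreal (\<bar>s\<bar> ^ CARD('N))). f x)"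
    using affine_lebesgue[OF assms(1)] by metis
  also have "\<dots> = (LINT y|lebesgue. \<bar>s\<bar> ^ CARD('N) *\<^sub>R f (zoom x0 s y))"
    using T True by (subst integral_density) (auto simp: integral_distr)
  finally show ?thesis by simp
next
  case False
  \<comment> \<open>Without measurability neither function is integrable, and both integrals take
    the default value 0.\<close>
  then have "\<not> integrable lebesgue f" "\<not> integrable lebesgue (\<lambda>y. f (zoom x0 s y))"
    using measurable_affine_iff[OF assms, of f x0] borel_measurable_integrable by blast+
  then show ?thesis by (simp add: not_integrable_integral_eq)
qed

lemma AE_affine:
  fixes x0 :: "real^'N::finite"
  assumes "s \<noteq> 0" "AE x in lebesgue. P x"
  shows "AE y in lebesgue. P (zoom x0 s y)"
proof -
  have "AE x in density (distr lebesgue lebesgue (zoom x0 s)) (\<lambda>_. ennreal (\<bar>s\<bar> ^ CARD('N))). P x"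
    using assms affine_lebesgue[OF assms(1)] by metis
  then have "AE x in distr lebesgue lebesgue (zoom x0 s). P x"
    using assms(1) by (subst (asm) AE_density) (auto simp: ennreal_zero_less_mult_iff)
  then show ?thesis by (rule AE_distrD[OF affine_measurable_lebesgue[OF assms(1)]])
qed

lemma affine_image_sets:
  fixes V :: "(real^'N::finite) set"
  assumes "s \<noteq> 0" "V \<in> sets lebesgue"
  shows "zoom x0 s ` V \<in> sets lebesgue"
proof -
  have "indicator (zoom x0 s ` V) (zoom x0 s y) = (indicator V y :: real)" for y
    using assms(1) by (auto simp: indicator_def)
  then have "(\<lambda>y. indicator (zoom x0 s ` V) (zoom x0 s y) :: real) \<in> borel_measurable lebesgue"
    using assms(2) by simp
  then have "(indicator (zoom x0 s ` V) :: _ \<Rightarrow> real) \<in> borel_measurable lebesgue"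
    using measurable_affine_iff[OF assms(1)] by blast
  then show ?thesis by (simp add: borel_measurable_indicator_iff)
qed

lemma indicator_affine: "s \<noteq> 0 \<Longrightarrow> indicator (zoom x0 s ` V) (zoom x0 s y) = indicator V y"
  for y :: "'a::real_vector"
  by (auto simp: indicator_def)

context
  fixes V :: "(real^'N::finite) set" and s :: real and x0 :: "real^'N"
  assumes s: "s \<noteq> 0" and V: "V \<in> sets lebesgue"
begin

lemmas zoom_image_sets = affine_image_sets[OF s V, of x0]

lemma measurable_on_affine_iff:
  fixes f :: "real^'N::finite \<Rightarrow> 'b::real_normed_vector"
  shows "(\<lambda>y. f (zoom x0 s y)) \<in> borel_measurable (lebesgue_on V) \<longleftrightarrow>
    f \<in> borel_measurable (lebesgue_on (zoom x0 s ` V))"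
  using V zoom_image_sets measurable_affine_iff[OF s, of "\<lambda>x. indicator (zoom x0 s ` V) x *\<^sub>R f x" x0]
  by (simp add: borel_measurable_restrict_space_iff indicator_affine[OF s])

lemma integrable_on_affine_iff:
  fixes f :: "real^'N::finite \<Rightarrow> 'b::{banach, second_countable_topology}"
  shows "integrable (lebesgue_on V) (\<lambda>y. f (zoom x0 s y)) \<longleftrightarrow>
    integrable (lebesgue_on (zoom x0 s ` V)) f"
  using V zoom_image_sets integrable_affine_iff[OF s, of "\<lambda>x. indicator (zoom x0 s ` V) x *\<^sub>R f x" x0]
  by (simp add: integrable_restrict_space indicator_affine[OF s])

lemma nn_integral_on_affine:
  assumes "f \<in> borel_measurable (lebesgue_on (zoom x0 s ` V))"
  shows "(\<integral>\<^sup>+x. ennreal (f x) \<partial>lebesgue_on (zoom x0 s ` V)) =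
    ennreal (\<bar>s\<bar> ^ CARD('N)) * (\<integral>\<^sup>+y. ennreal (f (zoom x0 s y)) \<partial>lebesgue_on V)"
proof -
  let ?T = "zoom x0 s"
  have "(\<lambda>x. indicator (?T ` V) x *\<^sub>R f x) \<in> borel_measurable lebesgue"
    using assms zoom_image_sets by (simp add: borel_measurable_restrict_space_iff)
  then have "(\<lambda>x. ennreal (indicator (?T ` V) x *\<^sub>R f x)) \<in> borel_measurable lebesgue" by measurable
  also have "(\<lambda>x. ennreal (indicator (?T ` V) x *\<^sub>R f x)) = (\<lambda>x. ennreal (f x) * indicator (?T ` V) x)"
    by (auto simp: indicator_def fun_eq_iff)
  finally have "(\<integral>\<^sup>+x. ennreal (f x) * indicator (?T ` V) x \<partial>lebesgue) =
      ennreal (\<bar>s\<bar> ^ CARD('N)) * (\<integral>\<^sup>+y. ennreal (f (?T y)) * indicator V y \<partial>lebesgue)"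
    by (subst nn_integral_affine[OF s, of _ x0]) (auto simp: indicator_affine[OF s])
  then show ?thesis using V zoom_image_sets by (simp add: nn_integral_restrict_space)
qed

lemma AE_on_affine:
  assumes "AE x in lebesgue_on (zoom x0 s ` V). P x"
  shows "AE y in lebesgue_on V. P (zoom x0 s y)"
proof -
  have "AE x in lebesgue. x \<in> zoom x0 s ` V \<longrightarrow> P x"
    using assms zoom_image_sets by (simp add: AE_restrict_space_iff)
  from AE_affine[OF s this, of x0] have "AE y in lebesgue. y \<in> V \<longrightarrow> P (zoom x0 s y)"
    using s by auto
  then show ?thesis using V by (simp add: AE_restrict_space_iff)
qed

end

section \<open>Test functions against locally integrable functions\<close>

lemma compactly_inside_nbhd:
  fixes K U :: "(real^'N::finite) set"
  assumes "compact K" "open U" "K \<subseteq> U"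
  obtains V where "compactly_inside V U" "K \<subseteq> V"
proof -
  obtain e where e: "0 < e" "(\<Union>x\<in>K. ball x e) \<subseteq> U"
    using compact_subset_open_imp_ball_epsilon_subset[OF assms] by blast
  \<comment> \<open>Half of the available distance is used: the closure of \<open>V\<close> stays in
    the compact sum \<open>C\<close> of \<open>K\<close> and a closed ball, which still lies in
    \<open>U\<close>.\<close>
  define V where "V = (\<Union>x\<in>K. ball x (e/2))"
  define C where "C = {x + y | x y. x \<in> K \<and> y \<in> cball 0 (e/2)}"
  have C: "compact C" unfolding C_def using assms(1) compact_cball by (rule compact_sums)
  have "V \<subseteq> C"
  proof
    fix z assume "z \<in> V"
    then obtain x where "x \<in> K" "dist x z < e/2" by (auto simp: V_def)
    then show "z \<in> C" unfolding C_def
      by (intro CollectI exI[of _ x] exI[of _ "z - x"]) (auto simp: dist_norm norm_minus_commute)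
  qed
  then have cl: "closure V \<subseteq> C" using C by (intro closure_minimal compact_imp_closed)
  have "C \<subseteq> U"
  proof
    fix z assume "z \<in> C"
    then obtain x y where "x \<in> K" "norm y \<le> e/2" "z = x + y" by (auto simp: C_def)
    then show "z \<in> U" using e by (intro subsetD[OF e(2)]) (auto simp: dist_norm intro!: bexI[of _ x])
  qed
  with cl C have "compactly_inside V U"
    unfolding compactly_inside_def V_def
    by (metis (no_types, lifting) bounded_subset closed_closure compact_eq_bounded_closed open_UN open_ball order_trans)
  moreover have "K \<subseteq> V" using e(1) by (auto simp: V_def)
  ultimately show ?thesis by (rule that)
qed

text \<open>\<open>g\<close> is integrable near the support and \<phi> is bounded. The statement
  matters because the integral of a difference splits only for integrable functions.\<close>

lemma test_fun_integrable:
  fixes g :: "real^'N::finite \<Rightarrow> real^'m::finite"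
  assumes "open U" "\<phi> \<in> test_fun U" "loc_integrable U g"
  shows "integrable (lebesgue_on U) (\<lambda>x. \<phi> x *\<^sub>R g x)"
proof -
  have pn: "partials [] \<phi> = \<phi>" by (simp add: partials_def)
  have "compact (supp \<phi>)" "supp \<phi> \<subseteq> U" using assms(2) by (auto simp: test_fun_def)
  then obtain V where V: "compactly_inside V U" "supp \<phi> \<subseteq> V"
    using compactly_inside_nbhd[OF _ assms(1)] by metis
    let ?g = "\<lambda>x. indicator V x *\<^sub>R g x"
  have Vs: "V \<in> sets lebesgue" and VU: "V \<subseteq> U"
    using V(1) closure_subset by (auto simp: compactly_inside_def)
  have gi: "integrable lebesgue ?g"
    using assms(3) V(1) Vs unfolding loc_integrable_def
    by (subst integrable_restrict_space[symmetric]) auto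
  obtain b where b: "\<And>x. \<bar>\<phi> x\<bar> \<le> b" using test_fun_bounded[OF assms(2), of "[]"] pn by metis
  have "integrable lebesgue (\<lambda>x. \<phi> x *\<^sub>R (?g x))"
  proof (rule Bochner_Integration.integrable_bound[OF integrable_scaleR_right[OF integrable_norm[OF gi], of b]])
    have "\<phi> \<in> borel_measurable lebesgue"
      using test_fun_continuous[OF assms(2), of UNIV "[]"] pn
      by (simp add: borel_measurable_continuous_onI measurable_completion)
    then show "(\<lambda>x. \<phi> x *\<^sub>R (?g x)) \<in> borel_measurable lebesgue"
      by (intro borel_measurable_scaleR borel_measurable_integrable[OF gi])
    show "AE x in lebesgue. norm (\<phi> x *\<^sub>R (?g x)) \<le> norm (b *\<^sub>R norm (?g x))"
    proof (intro always_eventually allI)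
      fix x
      have "\<bar>\<phi> x\<bar> \<le> \<bar>b\<bar>" using b[of x] by linarith
      then show "norm (\<phi> x *\<^sub>R (?g x)) \<le> norm (b *\<^sub>R norm (?g x))"
        by (auto simp: indicator_def abs_mult intro!: mult_right_mono)
    qed
  qed
  moreover have "(\<lambda>x. \<phi> x *\<^sub>R (?g x)) = (\<lambda>x. indicator U x *\<^sub>R (\<phi> x *\<^sub>R g x))"
  proof
    fix x
    show "\<phi> x *\<^sub>R (?g x) = indicator U x *\<^sub>R (\<phi> x *\<^sub>R g x)"
      using partials_zero_outside_supp[of x \<phi> "[]"] V(2) VU pn by (cases "x \<in> V") auto
  qed
  ultimately show ?thesis using \<open>open U\<close> by (subst integrable_restrict_space) auto
qed

text \<open>\<open>weak_deriv\<close> is chosen among all representatives, so identities between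
  weak derivatives hold almost everywhere and are obtained from this uniqueness.\<close>

lemma weak_deriv_unique:
  assumes "open U" "is_weak_deriv U \<alpha> w g" "is_weak_deriv U \<alpha> w g'"
  shows "AE x in lebesgue_on U. g x = g' x"
proof -
  have g: "loc_integrable U g" "loc_integrable U g'" using assms by (auto simp: is_weak_deriv_def)
  then have "loc_integrable U (\<lambda>x. g x - g' x)" by (auto simp: loc_integrable_def)
  then have "AE x in lebesgue_on U. g x - g' x = 0"
  proof (rule weak_zero_AE_zero[OF assms(1)])
    fix \<phi> assume \<phi>: "\<phi> \<in> test_fun U"
    have "(LINT x|lebesgue_on U. \<phi> x *\<^sub>R (g x - g' x)) = (LINT x|lebesgue_on U. \<phi> x *\<^sub>R g x) - (LINT x|lebesgue_on U. \<phi> x *\<^sub>R g' x)"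
      unfolding scaleR_diff_right
      by (intro Bochner_Integration.integral_diff test_fun_integrable assms(1) \<phi> g)
    then show "(LINT x|lebesgue_on U. \<phi> x *\<^sub>R (g x - g' x)) = 0"
      using assms \<phi> by (simp add: is_weak_deriv_def)
  qed
  then show ?thesis by simp
qed

lemma is_weak_deriv_weak_deriv: "is_weak_deriv U \<alpha> w g \<Longrightarrow> is_weak_deriv U \<alpha> w (weak_deriv U \<alpha> w)"
  unfolding weak_deriv_def by (rule someI[where P="is_weak_deriv U \<alpha> w"])

lemma powr_scale: "\<bar>c * x\<bar> powr r = \<bar>c\<bar> powr r * \<bar>x\<bar> powr (r::real)"
  by (simp add: abs_mult powr_mult)

section \<open>Pull-back of functions and distributions to a reference domain\<close>

context
  fixes I U :: "(real^'N::finite) set" and x0 :: "real^'N" and s :: real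
  assumes s: "0 < s" and opI: "open I" and opU: "open U" and TI: "compactly_inside (zoom x0 s ` I) U"
begin

lemma s_ne: "s \<noteq> 0" using s by simp

lemma unzoom_zoom: "unzoom x0 s (zoom x0 s y) = y"
  using affine_inverse[OF s_ne, of x0 y "zoom x0 s y"] by simp

lemma zoom_unzoom: "zoom x0 s (unzoom x0 s x) = x"
  using affine_inverse[OF s_ne, of x0 "unzoom x0 s x" x] by simp

lemma zoom_domain_sets: "I \<in> sets lebesgue" using opI by simp

lemma zoom_mem: "y \<in> I \<Longrightarrow> zoom x0 s y \<in> U"
  using TI closure_subset by (force simp: compactly_inside_def)

lemma test_fun_pull: "\<phi> \<in> test_fun I \<Longrightarrow> (\<lambda>x. \<phi> (unzoom x0 s x)) \<in> test_fun U"
  by (rule test_fun_affine) (use s zoom_mem zoom_unzoom in force)+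

text \<open>After the change of variables the indicator of \<open>U\<close> may be replaced by that
  of \<open>I\<close>, because \<phi> vanishes off \<open>I\<close> and the zoomed \<open>I\<close>
  lies in \<open>U\<close>.\<close>

lemma integral_test_pull:
  fixes w :: "real^'N \<Rightarrow> real^'m::finite"
  assumes "\<And>y. y \<notin> I \<Longrightarrow> \<phi> y = 0"
  shows "(LINT x|lebesgue_on U. \<phi> (unzoom x0 s x) *\<^sub>R w x) = s ^ CARD('N) *\<^sub>R (LINT y|lebesgue_on I. \<phi> y *\<^sub>R w (zoom x0 s y))"
proof -
  have "(LINT x|lebesgue_on U. \<phi> (unzoom x0 s x) *\<^sub>R w x) = (LINT x|lebesgue. indicator U x *\<^sub>R (\<phi> (unzoom x0 s x) *\<^sub>R w x))"
    using opU by (subst integral_restrict_space) auto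
  also have "\<dots> = s ^ CARD('N) *\<^sub>R (LINT y|lebesgue. indicator U (zoom x0 s y) *\<^sub>R (\<phi> (unzoom x0 s (zoom x0 s y)) *\<^sub>R w (zoom x0 s y)))"
    by (subst integral_affine[OF s_ne, of _ x0]) (use s in simp)
  also have "(\<lambda>y. indicator U (zoom x0 s y) *\<^sub>R (\<phi> (unzoom x0 s (zoom x0 s y)) *\<^sub>R w (zoom x0 s y))) = (\<lambda>y. indicator I y *\<^sub>R (\<phi> y *\<^sub>R w (zoom x0 s y)))"
  proof
    fix y
    show "indicator U (zoom x0 s y) *\<^sub>R (\<phi> (unzoom x0 s (zoom x0 s y)) *\<^sub>R w (zoom x0 s y)) = indicator I y *\<^sub>R (\<phi> y *\<^sub>R w (zoom x0 s y))"
      unfolding unzoom_zoom using assms[of y] zoom_mem[of y] by (cases "y \<in> I") auto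
  qed
  also have "(LINT y|lebesgue. indicator I y *\<^sub>R (\<phi> y *\<^sub>R w (zoom x0 s y))) = (LINT y|lebesgue_on I. \<phi> y *\<^sub>R w (zoom x0 s y))"
    using opI by (subst integral_restrict_space) auto
  finally show ?thesis .
qed

text \<open>The zoomed domain is itself compactly inside \<open>U\<close>, so local integrability on
  \<open>U\<close> becomes integrability on all of \<open>I\<close>, up to the boundary.\<close>

lemma loc_integrable_pull:
  fixes w :: "real^'N \<Rightarrow> real^'m::finite"
  assumes "loc_integrable U w"
  shows "loc_integrable I (\<lambda>y. c *\<^sub>R w (zoom x0 s y))"
  unfolding loc_integrable_def
proof (intro allI impI)
  fix V assume V: "compactly_inside V I"
  have "integrable (lebesgue_on (zoom x0 s ` I)) w" using assms TI by (simp add: loc_integrable_def)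
  then have "integrable (lebesgue_on I) (\<lambda>y. w (zoom x0 s y))"
    by (subst integrable_on_affine_iff[OF s_ne zoom_domain_sets])
  then have "integrable lebesgue (\<lambda>y. indicator I y *\<^sub>R w (zoom x0 s y))"
    using opI by (subst (asm) integrable_restrict_space) auto
  then have "integrable lebesgue (\<lambda>y. indicator V y *\<^sub>R (indicator I y *\<^sub>R w (zoom x0 s y)))"
    by (rule integrable_mult_indicator[rotated]) (use V in \<open>auto simp: compactly_inside_def\<close>)
  moreover have "(\<lambda>y. indicator V y *\<^sub>R (indicator I y *\<^sub>R w (zoom x0 s y))) = (\<lambda>y. indicator V y *\<^sub>R w (zoom x0 s y))"
    using V closure_subset by (fastforce simp: compactly_inside_def indicator_def fun_eq_iff)
  ultimately have "integrable (lebesgue_on V) (\<lambda>y. w (zoom x0 s y))"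
    using V by (subst integrable_restrict_space) (auto simp: compactly_inside_def)
  then show "integrable (lebesgue_on V) (\<lambda>y. c *\<^sub>R w (zoom x0 s y))" by simp
qed

text \<open>Testing with \<phi> on \<open>I\<close> amounts to testing with its rescaled copy on
  \<open>U\<close>. The derivatives of the copy carry (1/s)^k for words of length k; moved to the
  other side, this becomes the factor s^k.\<close>

lemma is_weak_deriv_pull:
  fixes w :: "real^'N \<Rightarrow> real^'m::finite"
  assumes g: "is_weak_deriv U \<alpha> w g"
  shows "is_weak_deriv I \<alpha> (\<lambda>y. w (zoom x0 s y)) (\<lambda>y. s ^ length \<alpha> *\<^sub>R g (zoom x0 s y))"
  unfolding is_weak_deriv_def
proof (intro conjI ballI)
  show "loc_integrable I (\<lambda>y. s ^ length \<alpha> *\<^sub>R g (zoom x0 s y))"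
    using g by (intro loc_integrable_pull) (simp add: is_weak_deriv_def)
  fix \<phi> assume \<phi>: "\<phi> \<in> test_fun I"
  let ?l = "length \<alpha>"
  let ?P = "LINT y|lebesgue_on I. partials \<alpha> \<phi> y *\<^sub>R w (zoom x0 s y)" and ?Q = "LINT y|lebesgue_on I. \<phi> y *\<^sub>R g (zoom x0 s y)"
  have out: "y \<notin> I \<Longrightarrow> \<phi> y = 0" "y \<notin> I \<Longrightarrow> partials \<alpha> \<phi> y = 0" for y
    using test_fun_outside[OF \<phi>, of y "[]"] test_fun_outside[OF \<phi>, of y \<alpha>] by (auto simp: partials_def)
  have sm: "smooth \<phi>" using \<phi> by (simp add: test_fun_def)
  have "s ^ CARD('N) *\<^sub>R ?Q = (LINT x|lebesgue_on U. \<phi> (unzoom x0 s x) *\<^sub>R g x)"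
    by (rule integral_test_pull[symmetric]) (rule out)
  also have "\<dots> = (- 1) ^ ?l *\<^sub>R (LINT x|lebesgue_on U. partials \<alpha> (\<lambda>x. \<phi> (unzoom x0 s x)) x *\<^sub>R w x)"
    using g test_fun_pull[OF \<phi>] by (simp add: is_weak_deriv_def)
  also have "(\<lambda>x. partials \<alpha> (\<lambda>x. \<phi> (unzoom x0 s x)) x *\<^sub>R w x) = (\<lambda>x. (1/s) ^ ?l *\<^sub>R (partials \<alpha> \<phi> (unzoom x0 s x) *\<^sub>R w x))"
    unfolding partials_affine[OF sm] by simp
  also have "(LINT x|lebesgue_on U. (1/s) ^ ?l *\<^sub>R (partials \<alpha> \<phi> (unzoom x0 s x) *\<^sub>R w x))
      = (1/s) ^ ?l *\<^sub>R (s ^ CARD('N) *\<^sub>R ?P)"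
  proof -
    have "(LINT x|lebesgue_on U. partials \<alpha> \<phi> (unzoom x0 s x) *\<^sub>R w x) = s ^ CARD('N) *\<^sub>R ?P"
      by (rule integral_test_pull) (rule out)
    then show ?thesis by (simp only: integral_scaleR_right)
  qed
  finally have "s ^ CARD('N) *\<^sub>R ?Q =
      s ^ CARD('N) *\<^sub>R ((- 1) ^ ?l *\<^sub>R ((1/s) ^ ?l *\<^sub>R ?P))"
    by (simp add: mult.commute mult.left_commute)
  then have "?Q = (- 1) ^ ?l *\<^sub>R ((1/s) ^ ?l *\<^sub>R ?P)"
    using s by (simp only: scaleR_cancel_left) simp
  then have "s ^ ?l *\<^sub>R ?Q = (- 1) ^ ?l *\<^sub>R ?P"
    using s by (simp add: power_divide)
  moreover have "(LINT y|lebesgue_on I. \<phi> y *\<^sub>R (s ^ ?l *\<^sub>R g (zoom x0 s y))) = s ^ ?l *\<^sub>R ?Q"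
    unfolding integral_scaleR_right[symmetric] by (simp add: mult.commute)
  ultimately show "(LINT y|lebesgue_on I. \<phi> y *\<^sub>R (s ^ ?l *\<^sub>R g (zoom x0 s y))) = (- 1) ^ ?l *\<^sub>R ?P"
    by simp
qed

lemma Lq_pull:
  assumes "f \<in> Lq_loc U r"
  shows "(\<lambda>y. c *\<^sub>R f (zoom x0 s y)) \<in> Lq I r"
  unfolding Lq_def
proof (intro CollectI allI conjI)
  fix j
  have f: "f \<in> Lq (zoom x0 s ` I) r" using assms TI by (simp add: Lq_loc_def)
  have "(\<lambda>y. f (zoom x0 s y) $ j) \<in> borel_measurable (lebesgue_on I)"
    using f by (subst measurable_on_affine_iff[OF s_ne zoom_domain_sets, of "\<lambda>x. f x $ j"]) (simp add: Lq_def)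
  then show "(\<lambda>y. (c *\<^sub>R f (zoom x0 s y)) $ j) \<in> borel_measurable (lebesgue_on I)" by simp
  have "integrable (lebesgue_on I) (\<lambda>y. \<bar>f (zoom x0 s y) $ j\<bar> powr r $ j)"
    using f by (subst integrable_on_affine_iff[OF s_ne zoom_domain_sets, of "\<lambda>x. \<bar>f x $ j\<bar> powr r $ j"]) (simp add: Lq_def)
  then show "integrable (lebesgue_on I) (\<lambda>y. \<bar>(c *\<^sub>R f (zoom x0 s y)) $ j\<bar> powr r $ j)"
    by (simp add: powr_scale)
qed

lemma sobolev_pull:
  assumes "w \<in> sobolev_loc U n p"
  shows "(\<lambda>y. w (zoom x0 s y)) \<in> sobolev I n p"
proof -
  have "\<exists>g. is_weak_deriv I \<alpha> (\<lambda>y. w (zoom x0 s y)) g \<and> g \<in> Lq I (vec p)" if l: "length \<alpha> \<le> n" for \<alpha>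
  proof -
    obtain g where "is_weak_deriv U \<alpha> w g" "g \<in> Lq_loc U (vec p)"
      using assms l by (auto simp: sobolev_loc_def)
    then show ?thesis using is_weak_deriv_pull Lq_pull by blast
  qed
  then show ?thesis using assms Lq_pull[of w "vec p" 1] by (simp add: sobolev_def sobolev_loc_def)
qed

text \<open>If v is a function, the new distribution is v(x0 + s y)/s, whose gradient is that of v
  at the zoomed point. Accordingly the constant consists of s^(-N) for the change of variables and
  one further 1/s for the chain rule.\<close>

lemma represented_pull:
  fixes v :: "(real^'N \<Rightarrow> real) \<Rightarrow> real^'d::finite" and A :: "real^'N^'d \<Rightarrow> real^'m::finite"
  assumes "linear A" "distribution U v" and w: "represented_by U (A_grad A v) w"
  shows "represented_by I (A_grad A (\<lambda>\<phi>. (1/s) ^ (CARD('N) + 1) *\<^sub>R v (\<lambda>x. \<phi> (unzoom x0 s x)))) (\<lambda>y. w (zoom x0 s y))"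
  unfolding represented_by_def
proof (intro conjI ballI)
  show "loc_integrable I (\<lambda>y. w (zoom x0 s y))"
    using w loc_integrable_pull[of w 1] by (simp add: represented_by_def)
  fix \<phi> assume \<phi>: "\<phi> \<in> test_fun I"
  have sm: "smooth \<phi>" using \<phi> by (simp add: test_fun_def)
  let ?L = "LINT y|lebesgue_on I. \<phi> y *\<^sub>R w (zoom x0 s y)"
  let ?\<psi> = "\<lambda>x. \<phi> (unzoom x0 s x)"
  let ?c = "(1/s) ^ (CARD('N) + 1)"
  let ?\<Phi> = "\<lambda>\<phi>. ?c *\<^sub>R v (\<lambda>x. \<phi> (unzoom x0 s x))"
  have \<psi>: "?\<psi> \<in> test_fun U" by (rule test_fun_pull[OF \<phi>])
  have "(\<lambda>x. partial j \<phi> (unzoom x0 s x)) = (\<lambda>x. s * partial j ?\<psi> x)" for j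
    using partials_affine[OF sm, of "[j]" "- ((1/s) *\<^sub>R x0)" "1/s"] s by (auto simp: partials_def)
  then have vj: "v (\<lambda>x. partial j \<phi> (unzoom x0 s x)) = s *\<^sub>R v (partial j ?\<psi>)" for j
    using assms(2) partial_test_fun[OF \<psi>, of j] by (simp add: distribution_def)
  have "dist_grad ?\<Phi> \<phi> = (?c * s) *\<^sub>R dist_grad v ?\<psi>"
    unfolding dist_grad_def vj by (simp add: vec_eq_iff)
  then have "A_grad A ?\<Phi> \<phi> = (?c * s) *\<^sub>R A_grad A v ?\<psi>"
    using assms(1) by (simp add: A_grad_def linear_cmul)
  also have "A_grad A v ?\<psi> = (LINT x|lebesgue_on U. \<phi> (unzoom x0 s x) *\<^sub>R w x)"
    using w \<psi> by (simp add: represented_by_def)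
  also have "\<dots> = s ^ CARD('N) *\<^sub>R ?L"
    using test_fun_outside[OF \<phi>, of _ "[]"] by (intro integral_test_pull) (auto simp: partials_def)
  also have "(?c * s) *\<^sub>R \<dots> = ?L"
    using s by (simp add: power_divide)
  finally show "A_grad A ?\<Phi> \<phi> = ?L" .
qed

text \<open>The chain rule turns the scale \<delta> into \<delta> * s. There are countably many
  words, so the exceptional null sets can be united.\<close>

lemma scaled_jet_pull:
  assumes "w \<in> sobolev_loc U n p"
  shows "AE y in lebesgue_on I. scaled_jet I n \<delta> (\<lambda>y. w (zoom x0 s y)) y = scaled_jet U n (\<delta> * s) w (zoom x0 s y)"
proof -
  have "AE y in lebesgue_on I. length \<alpha> \<le> n \<longrightarrow> weak_deriv I \<alpha> (\<lambda>y. w (zoom x0 s y)) y = s ^ length \<alpha> *\<^sub>R weak_deriv U \<alpha> w (zoom x0 s y)" for \<alpha>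
  proof (cases "length \<alpha> \<le> n")
    case True
    then obtain g where "is_weak_deriv U \<alpha> w g" using assms by (auto simp: sobolev_loc_def)
    then have "is_weak_deriv U \<alpha> w (weak_deriv U \<alpha> w)" by (rule is_weak_deriv_weak_deriv)
    then have g: "is_weak_deriv I \<alpha> (\<lambda>y. w (zoom x0 s y)) (\<lambda>y. s ^ length \<alpha> *\<^sub>R weak_deriv U \<alpha> w (zoom x0 s y))"
      by (rule is_weak_deriv_pull)
    from weak_deriv_unique[OF opI is_weak_deriv_weak_deriv[OF g] g] show ?thesis by eventually_elim simp
  qed simp
  then have "AE y in lebesgue_on I. \<forall>\<alpha>. length \<alpha> \<le> n \<longrightarrow> weak_deriv I \<alpha> (\<lambda>y. w (zoom x0 s y)) y = s ^ length \<alpha> *\<^sub>R weak_deriv U \<alpha> w (zoom x0 s y)"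
    unfolding AE_all_countable by blast
  then show ?thesis
    by eventually_elim (auto simp: scaled_jet_def fun_eq_iff power_mult_distrib)
qed

end

section \<open>Packing a disc with cubes\<close>

context
  fixes B :: "(real^'N::finite) set"
  assumes B: "orthonormal_basis B"
begin

lemma orthonormal_basis_inner: "u \<in> B \<Longrightarrow> u' \<in> B \<Longrightarrow> u \<bullet> u' = (if u = u' then 1 else 0)"
  using B by (auto simp: orthonormal_basis_def pairwise_def orthogonal_def dot_square_norm)

lemma orthonormal_basis_card: "finite B" "card B = CARD('N)"
proof -
  have "0 \<notin> B" using B by (auto simp: orthonormal_basis_def)
  then have ind: "independent B"
    using B by (intro pairwise_orthogonal_independent) (auto simp: orthonormal_basis_def)
  then show "finite B" by (rule independent_imp_finite)
  have "card B = dim (UNIV :: (real^'N) set)"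
    using ind B by (intro basis_card_eq_dim) (auto simp: orthonormal_basis_def)
  then show "card B = CARD('N)" by simp
qed

text \<open>The difference of the two sides is orthogonal to every basis vector, hence to the whole
  span and to itself.\<close>

lemma orthonormal_basis_sum: "(\<Sum>u\<in>B. (x \<bullet> u) *\<^sub>R u) = x"
proof -
  let ?y = "\<Sum>u\<in>B. (x \<bullet> u) *\<^sub>R u"
  have "(x - ?y) \<bullet> u = 0" if "u \<in> B" for u
  proof -
    have "?y \<bullet> u = (\<Sum>u'\<in>B. (x \<bullet> u') * (if u' = u then 1 else 0))"
      using orthonormal_basis_inner that by (auto simp: inner_sum_left intro!: sum.cong)
    also have "\<dots> = x \<bullet> u" using that orthonormal_basis_card(1) by (simp add: if_distrib[of "(*) _"] cong: if_cong)
    finally show ?thesis by (simp add: inner_diff_left)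
  qed
  moreover have "x - ?y \<in> span B" using B by (simp add: orthonormal_basis_def)
  ultimately have "orthogonal (x - ?y) (x - ?y)"
    using orthogonal_to_span[of "x - ?y" B "x - ?y"] by (simp add: orthogonal_def)
  then show ?thesis by (simp add: orthogonal_def)
qed

lemma norm_le_sum_coords: "norm x \<le> (\<Sum>u\<in>B. \<bar>x \<bullet> u\<bar>)"
proof -
  have "norm x = norm (\<Sum>u\<in>B. (x \<bullet> u) *\<^sub>R u)" by (simp add: orthonormal_basis_sum)
  also have "\<dots> \<le> (\<Sum>u\<in>B. norm ((x \<bullet> u) *\<^sub>R u))" by (rule norm_sum)
  also have "\<dots> = (\<Sum>u\<in>B. \<bar>x \<bullet> u\<bar>)" using B by (auto simp: orthonormal_basis_def)
  finally show ?thesis .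
qed

lemma norm_combination:
  assumes "A \<subseteq> B"
  shows "norm (\<Sum>u\<in>A. c u *\<^sub>R u) = sqrt (\<Sum>u\<in>A. (c u)\<^sup>2)"
proof -
  have fin: "finite A" using assms orthonormal_basis_card(1) finite_subset by blast
  have "(\<Sum>u\<in>A. c u *\<^sub>R u) \<bullet> (\<Sum>u\<in>A. c u *\<^sub>R u) = (\<Sum>u\<in>A. \<Sum>u'\<in>A. c u * (c u' * (u \<bullet> u')))"
    by (simp add: inner_sum_left inner_sum_right sum_distrib_left inner_commute mult.left_commute)
  also have "\<dots> = (\<Sum>u\<in>A. \<Sum>u'\<in>A. if u' = u then (c u)\<^sup>2 else 0)"
    using assms orthonormal_basis_inner by (intro sum.cong refl) (auto simp: subset_iff power2_eq_square)
  also have "\<dots> = (\<Sum>u\<in>A. (c u)\<^sup>2)" using fin by simp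
  finally show ?thesis by (simp add: norm_eq_sqrt_inner)
qed

lemma inner_combination:
  assumes "A \<subseteq> B" "u \<in> B"
  shows "(\<Sum>u\<in>A. c u *\<^sub>R u) \<bullet> u = (if u \<in> A then c u else 0)"
proof -
  have fin: "finite A" using assms orthonormal_basis_card(1) finite_subset by blast
  have "(\<Sum>u\<in>A. c u *\<^sub>R u) \<bullet> u = (\<Sum>u'\<in>A. if u' = u then c u else 0)"
    using assms orthonormal_basis_inner by (auto simp: inner_sum_left subset_iff intro!: sum.cong)
  also have "\<dots> = (if u \<in> A then c u else 0)" using fin by simp
  finally show ?thesis .
qed

lemma open_unit_cube: "open (unit_cube B)"
proof -
  have "unit_cube B = (\<Inter>u\<in>B. {y. \<bar>y \<bullet> u\<bar> < 1/2})" by (auto simp: unit_cube_def)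
  also have "open \<dots>" using orthonormal_basis_card(1) by (intro open_INT ballI open_Collect_less continuous_intros) auto
  finally show ?thesis .
qed

text \<open>The cubes with centres on the lattice of mesh \<open>r\<close> in the hyperplane orthogonal to \<open>\<nu>\<close> that stay in
  the unit ball cover the slightly smaller \<open>(N - 1)\<close>-dimensional disc.\<close>

lemma disc_packing:
  assumes \<nu>: "\<nu> \<in> B" and \<eta>: "0 < \<eta>" "\<eta> < 1"
  obtains r Z where "0 < r" "finite Z" "\<And>z. z \<in> Z \<Longrightarrow> z \<bullet> \<nu> = 0"
    "\<And>z. z \<in> Z \<Longrightarrow> zoom z r ` unit_cube B \<subseteq> ball 0 1"
    "pairwise (\<lambda>z z'. disjnt (zoom z r ` unit_cube B) (zoom z' r ` unit_cube B)) Z"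
    "(1 - \<eta>) * unit_ball_vol (real (CARD('N) - 1)) \<le> real (card Z) * r ^ (CARD('N) - 1)"
proof -
  define n where "n = real CARD('N)"
  have n: "n \<ge> 1" unfolding n_def by (simp add: Suc_leI)
  \<comment> \<open>Chosen so that 2 n r = \<eta>/n. By Bernoulli's inequality a disc of radius 1 -
    2 n r then loses at most the fraction \<eta> of the (N-1)-dimensional volume.\<close>
  define r where "r = \<eta> / (2 * n * n)"
  define A where "A = B - {\<nu>}"
  have A: "A \<subseteq> B" "finite A" "card A = CARD('N) - 1"
    using orthonormal_basis_card \<nu> by (auto simp: A_def)
  have r: "0 < r" using \<eta> n by (simp add: r_def)
  have nr: "2 * n * r = \<eta> / n" using n by (simp add: r_def)
  have "\<eta> / n \<le> \<eta>" using \<eta> n by (simp add: field_simps)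
  then have nr1: "2 * n * r < 1" using nr \<eta> by linarith
  define z where "z k = (\<Sum>u\<in>A. (r * real_of_int (k u)) *\<^sub>R u)" for k :: "real^'N \<Rightarrow> int"
  have zu: "z k \<bullet> u = r * real_of_int (k u)" if "u \<in> A" for k u
    using inner_combination[OF A(1), of u] that A(1) by (auto simp: z_def)
  have z\<nu>: "z k \<bullet> \<nu> = 0" for k
    using inner_combination[OF A(1) \<nu>] by (simp add: z_def A_def)
  \<comment> \<open>The margin n r serves twice: the points of a cube of edge r are within n r / 2
    of its centre, so the cube stays in the ball; and a point of norm at most 1 - 2 n r has its
    nearest lattice point within n r, so that lattice point belongs to \<open>G\<close>.\<close>
  define G where "G = {k \<in> A \<rightarrow>\<^sub>E UNIV. norm (z k) \<le> 1 - n * r}"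
  have finG: "finite G"
  proof (rule finite_subset)
    show "G \<subseteq> A \<rightarrow>\<^sub>E {- \<lceil>1/r\<rceil>..\<lceil>1/r\<rceil>}"
    proof
      fix k assume k: "k \<in> G"
      have "k u \<in> {- \<lceil>1/r\<rceil>..\<lceil>1/r\<rceil>}" if "u \<in> A" for u
      proof -
        have "\<bar>r * real_of_int (k u)\<bar> \<le> norm (z k) * norm u"
          using zu[OF that, of k] Cauchy_Schwarz_ineq2[of "z k" u] by simp
        also have "norm u = 1" using that A(1) B by (auto simp: orthonormal_basis_def)
        also have "norm (z k) * 1 \<le> 1"
        proof -
          have "0 < n * r" using n r by (intro mult_pos_pos) auto
          then show ?thesis using k by (simp add: G_def)
        qed
        finally have "\<bar>real_of_int (k u)\<bar> \<le> 1 / r" using r by (simp add: abs_mult field_simps)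
        then have "real_of_int (k u) \<le> real_of_int \<lceil>1/r\<rceil>" "real_of_int (- k u) \<le> real_of_int \<lceil>1/r\<rceil>"
          using le_of_int_ceiling[of "1/r"] by linarith+
        then show ?thesis by auto
      qed
      then show "k \<in> A \<rightarrow>\<^sub>E {- \<lceil>1/r\<rceil>..\<lceil>1/r\<rceil>}" using k by (auto simp: G_def)
    qed
    show "finite (A \<rightarrow>\<^sub>E {- \<lceil>1/r\<rceil>..\<lceil>1/r\<rceil>})" using A(2) by (intro finite_PiE) auto
  qed
  have inj: "inj_on z G"
  proof (rule inj_onI)
    fix k k' assume k: "k \<in> G" "k' \<in> G" "z k = z k'"
    have "k u = k' u" for u
    proof (cases "u \<in> A")
      case True then show ?thesis using zu[of u k] zu[of u k'] k(3) r by simp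
    next
      case False then show ?thesis using k by (auto simp: G_def PiE_def extensional_def)
    qed
    then show "k = k'" by auto
  qed
  show ?thesis
  proof (rule that[of r "z ` G"])
    show "finite (z ` G)" using finG by simp
    show "z' \<bullet> \<nu> = 0" if "z' \<in> z ` G" for z' using that z\<nu> by auto
    show "zoom z' r ` unit_cube B \<subseteq> ball 0 1" if "z' \<in> z ` G" for z'
    proof
      fix x assume "x \<in> zoom z' r ` unit_cube B"
      then obtain y where y: "y \<in> unit_cube B" "x = z' + r *\<^sub>R y" by auto
      have "norm y \<le> (\<Sum>u\<in>B. \<bar>y \<bullet> u\<bar>)" by (rule norm_le_sum_coords)
      also have "\<dots> \<le> (\<Sum>u\<in>B. 1/2)" using y(1) by (intro sum_mono) (auto simp: unit_cube_def less_imp_le)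
      also have "\<dots> = n / 2" using orthonormal_basis_card by (simp add: n_def)
      finally have "r * norm y \<le> r * (n / 2)" using r by simp
      moreover have "norm z' \<le> 1 - n * r" using that by (auto simp: G_def)
      moreover have "norm x \<le> norm z' + r * norm y" using y(2) r norm_triangle_ineq[of z' "r *\<^sub>R y"] by simp
      ultimately have "norm x \<le> 1 - n * r / 2" by (simp add: algebra_simps)
      moreover have "0 < n * r" using n r by (intro mult_pos_pos) auto
      ultimately have "norm x < 1" by linarith
      then show "x \<in> ball 0 1" by simp
    qed
    show "pairwise (\<lambda>z z'. disjnt (zoom z r ` unit_cube B) (zoom z' r ` unit_cube B)) (z ` G)"
    proof (intro pairwiseI)
      fix z1 z2 assume "z1 \<in> z ` G" "z2 \<in> z ` G" "z1 \<noteq> z2"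
      then obtain k1 k2 where k: "k1 \<in> G" "k2 \<in> G" "z1 = z k1" "z2 = z k2" "k1 \<noteq> k2" by auto
      then obtain u where u: "k1 u \<noteq> k2 u" by auto
      \<comment> \<open>Members of \<open>G\<close> are extensional, so they can differ only at an
        index in \<open>A\<close>.\<close>
      then have uA: "u \<in> A" using k(1,2) by (cases "u \<in> A") (auto simp: G_def PiE_def extensional_def)
      show "disjnt (zoom z1 r ` unit_cube B) (zoom z2 r ` unit_cube B)"
      proof (rule ccontr)
        assume "\<not> ?thesis"
        then obtain y1 y2 where y: "y1 \<in> unit_cube B" "y2 \<in> unit_cube B" "z1 + r *\<^sub>R y1 = z2 + r *\<^sub>R y2"
          by (auto simp: disjnt_def)
        from y(3) have "(z1 + r *\<^sub>R y1) \<bullet> u = (z2 + r *\<^sub>R y2) \<bullet> u" by simp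
        then have "r * (real_of_int (k1 u) + y1 \<bullet> u) = r * (real_of_int (k2 u) + y2 \<bullet> u)"
          using k(3,4) zu[OF uA] by (simp add: inner_add_left distrib_left)
        then have "real_of_int (k1 u) + y1 \<bullet> u = real_of_int (k2 u) + y2 \<bullet> u" using r by simp
        moreover have "\<bar>y1 \<bullet> u\<bar> < 1/2" "\<bar>y2 \<bullet> u\<bar> < 1/2" using y(1,2) uA A(1) by (auto simp: unit_cube_def)
        ultimately have "\<bar>real_of_int (k1 u) - real_of_int (k2 u)\<bar> < 1" by linarith
        then have "k1 u = k2 u" by linarith
        with u show False by simp
      qed
    qed
    show "(1 - \<eta>) * unit_ball_vol (real (CARD('N) - 1)) \<le> real (card (z ` G)) * r ^ (CARD('N) - 1)"
    proof -
      \<comment> \<open>The hyperplane is represented by coordinate functions on \<open>A\<close>.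
        In the product measure the volume of a ball is known for every finite index set, including
        the empty one that occurs when N = 1.\<close>
      interpret product_sigma_finite "\<lambda>_ :: real^'N. lborel :: real measure" by standard
      let ?M = "Pi\<^sub>M A (\<lambda>_. lborel :: real measure)"
      define R where "R = 1 - 2 * n * r"
      have R: "0 < R" using nr1 by (simp add: R_def)
      define Q where "Q k = (\<Pi>\<^sub>E u\<in>A. {r * real_of_int (k u) - r/2 .. r * real_of_int (k u) + r/2})" for k
      have Qm: "Q k \<in> sets ?M" for k unfolding Q_def using A(2) by (intro sets_PiM_I_finite) auto
      have eQ: "emeasure ?M (Q k) = ennreal (r ^ card A)" for k
        unfolding Q_def using A(2) r by (subst emeasure_PiM) (auto simp: ennreal_power)
      have cover: "{f. sqrt (\<Sum>u\<in>A. (f u)\<^sup>2) \<le> R} \<inter> space ?M \<subseteq> (\<Union>k\<in>G. Q k)"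
      proof
        fix f assume f: "f \<in> {f. sqrt (\<Sum>u\<in>A. (f u)\<^sup>2) \<le> R} \<inter> space ?M"
        then have fe: "f \<in> extensional A" by (auto simp: space_PiM PiE_def)
        \<comment> \<open>Adding 1/2 makes the floor a rounding to the nearest lattice
          point.\<close>
        define k where "k = (\<lambda>u\<in>A. \<lfloor>f u / r + 1/2\<rfloor>)"
        have ku: "\<bar>f u - r * real_of_int (k u)\<bar> \<le> r / 2" if "u \<in> A" for u
        proof -
          have "k u = \<lfloor>f u / r + 1/2\<rfloor>" using that by (simp add: k_def)
          then have "real_of_int (k u) \<le> f u / r + 1/2" "f u / r + 1/2 < real_of_int (k u) + 1"
            using floor_correct[of "f u / r + 1/2"] by (auto simp: floor_le_iff)
          then have "\<bar>f u / r - real_of_int (k u)\<bar> \<le> 1/2" by linarith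
          then have "r * \<bar>f u / r - real_of_int (k u)\<bar> \<le> r * (1/2)" using r by simp
          also have "r * \<bar>f u / r - real_of_int (k u)\<bar> = \<bar>f u - r * real_of_int (k u)\<bar>"
            using r abs_mult[of r "f u / r - real_of_int (k u)"] by (simp add: right_diff_distrib)
          finally show ?thesis by simp
        qed
        let ?f = "\<Sum>u\<in>A. f u *\<^sub>R u"
        have "norm (z k - ?f) = norm (\<Sum>u\<in>A. (r * real_of_int (k u) - f u) *\<^sub>R u)"
          by (simp add: z_def sum_subtractf scaleR_diff_left)
        also have "\<dots> \<le> (\<Sum>u\<in>A. norm ((r * real_of_int (k u) - f u) *\<^sub>R u))" by (rule norm_sum)
        also have "\<dots> \<le> (\<Sum>u\<in>A. r / 2)"
        proof (rule sum_mono)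
          fix u assume u: "u \<in> A"
          then have "norm u = 1" using A(1) B by (auto simp: orthonormal_basis_def)
          then show "norm ((r * real_of_int (k u) - f u) *\<^sub>R u) \<le> r / 2" using ku[OF u] by (simp add: abs_minus_commute)
        qed
        also have "\<dots> = real (card A) * (r / 2)" by simp
        also have "\<dots> \<le> n * r" 
        proof -
          have "real (card A) \<le> n" unfolding n_def A(3) by simp
          then have "real (card A) * (r/2) \<le> n * (r/2)" using r by (intro mult_right_mono) auto
          moreover have "0 < n * r" using n r by (intro mult_pos_pos) auto
          ultimately show ?thesis by simp
        qed
        finally have "norm (z k - ?f) \<le> n * r" .
        moreover have "norm ?f \<le> R" using f norm_combination[OF A(1), of f] by simp
        moreover have "norm (z k) \<le> norm (z k - ?f) + norm ?f" using norm_triangle_ineq[of "z k - ?f" ?f] by simp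
        ultimately have "norm (z k) \<le> 1 - n * r" by (simp add: R_def)
        then have "k \<in> G" by (auto simp: G_def k_def)
        moreover have "f \<in> Q k" unfolding Q_def
        proof (rule PiE_I)
          fix u assume "u \<in> A"
          from ku[OF this] show "f u \<in> {r * real_of_int (k u) - r/2 .. r * real_of_int (k u) + r/2}"
            unfolding abs_le_iff atLeastAtMost_iff by linarith
        qed (use fe in \<open>auto simp: extensional_def\<close>)
        ultimately show "f \<in> (\<Union>k\<in>G. Q k)" by blast
      qed
      have "ennreal (unit_ball_vol (real (card A)) * R ^ card A) =
          emeasure ?M ({f. sqrt (\<Sum>u\<in>A. (f u)\<^sup>2) \<le> R} \<inter> space ?M)"
        using emeasure_cball_aux[OF A(2) R] by simp
      also have "\<dots> \<le> emeasure ?M (\<Union>k\<in>G. Q k)"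
        using Qm finG by (intro emeasure_mono cover) auto
      also have "\<dots> \<le> (\<Sum>k\<in>G. emeasure ?M (Q k))"
        using Qm finG by (intro emeasure_subadditive_finite) auto
      also have "\<dots> = ennreal (real (card G) * r ^ card A)"
        using r by (simp add: eQ ennreal_mult ennreal_of_nat_eq_real_of_nat)
      finally have main: "unit_ball_vol (real (card A)) * R ^ card A \<le> real (card G) * r ^ card A"
        using r by (simp add: ennreal_le_iff)
      have "1 - \<eta> \<le> 1 + real (card A) * (- (2 * n * r))"
      proof -
        have "real (card A) * (\<eta> / n) \<le> n * (\<eta> / n)"
          using \<eta> n by (intro mult_right_mono) (auto simp: A(3) n_def)
        then show ?thesis using n by (simp add: nr)
      qed
      also have "\<dots> \<le> (1 + (- (2 * n * r))) ^ card A"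
        using nr1 by (intro Bernoulli_inequality) auto
      finally have "1 - \<eta> \<le> R ^ card A" by (simp add: R_def)
      then have "(1 - \<eta>) * unit_ball_vol (real (card A)) \<le> R ^ card A * unit_ball_vol (real (card A))"
        by (intro mult_right_mono) auto
      also have "\<dots> \<le> real (card G) * r ^ card A" using main by (simp add: mult.commute)
      finally show ?thesis using card_image[OF inj] A(3) by simp
    qed
  qed (rule r)
qed

end

section \<open>Blow-up at a jump point\<close>

lemma scaled_jet_in_jets: "scaled_jet U n \<epsilon> w x \<in> jets n"
  by (auto simp: jets_def scaled_jet_def)

text \<open>Words are countably many, so a jet is measurable once its coordinates are. Weak
  derivatives are locally integrable, which gives measurability on sets compactly inside
  \<open>U\<close>, and \<open>F\<close> is continuous on \<open>jets n\<close>; whence the set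
  \<open>V\<close> and the restricted Borel space.\<close>

lemma energy_density_measurable:
  fixes F :: "('N::finite list \<Rightarrow> real^'m::finite) \<Rightarrow> real^'N \<Rightarrow> real"
  assumes F: "continuous_on (jets n \<times> UNIV) (\<lambda>(J, x). F J x)"
    and w: "w \<in> sobolev_loc U n p" "loc_integrable U w" and V: "compactly_inside V U"
  shows "(\<lambda>x. F (scaled_jet U n \<epsilon> w x) x) \<in> borel_measurable (lebesgue_on V)"
proof -
  have wd: "weak_deriv U \<alpha> w \<in> borel_measurable (lebesgue_on V)" if l: "length \<alpha> \<le> n" for \<alpha>
  proof -
    obtain g where "is_weak_deriv U \<alpha> w g" using w(1) l by (auto simp: sobolev_loc_def)
    then have "is_weak_deriv U \<alpha> w (weak_deriv U \<alpha> w)" by (rule is_weak_deriv_weak_deriv)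
    then show ?thesis using V by (auto simp: is_weak_deriv_def loc_integrable_def)
  qed
  have wm: "w \<in> borel_measurable (lebesgue_on V)" using w(2) V by (auto simp: loc_integrable_def)
  have "(\<lambda>x. scaled_jet U n \<epsilon> w x \<alpha>) \<in> borel_measurable (lebesgue_on V)" for \<alpha>
    using wm wd[of \<alpha>] by (cases "\<alpha> = []"; cases "length \<alpha> \<le> n") (auto simp: scaled_jet_def)
  then have J: "(\<lambda>x. scaled_jet U n \<epsilon> w x) \<in> borel_measurable (lebesgue_on V)"
    by (rule measurable_coordinatewise_then_product)
  have id: "(\<lambda>x. x) \<in> borel_measurable (lebesgue_on V)"
    by (intro measurable_restrict_space1 measurable_completion) simp
  have "(\<lambda>x. (scaled_jet U n \<epsilon> w x, x)) \<in> lebesgue_on V \<rightarrow>\<^sub>M restrict_space borel (jets n \<times> UNIV)"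
    by (intro measurable_restrict_space2 borel_measurable_Pair J id) (auto simp: scaled_jet_in_jets)
  moreover have "(\<lambda>(J, x). F J x) \<in> borel_measurable (restrict_space borel (jets n \<times> UNIV))"
    by (rule borel_measurable_continuous_on_restrict[OF F])
  ultimately show ?thesis by (auto dest: measurable_compose)
qed

text \<open>A sequence of competitors suffices: between consecutive scales the family is kept constant.\<close>

lemma E0_le:
  fixes F :: "('N::finite list \<Rightarrow> real^'m::finite) \<Rightarrow> real^'N \<Rightarrow> real"
    and A :: "real^'N^'d::finite \<Rightarrow> real^'m"
    and B :: "real^'N \<Rightarrow> (real^'N) set" and \<nu> :: "real^'N"
  defines "I \<equiv> unit_cube (B \<nu>)"
  assumes *: "\<And>\<kappa>. 0 < \<kappa> \<Longrightarrow> \<exists>\<delta> (\<Phi> :: (real^'N \<Rightarrow> real) \<Rightarrow> real^'d) W. 0 < \<delta> \<and> \<delta> < \<kappa> \<and>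
      distribution I \<Phi> \<and> represented_by I (A_grad A \<Phi>) W \<and> W \<in> Lq I q \<inter> sobolev I n p \<and>
      (AE y in lebesgue_on I. W y \<in> M) \<and> Lq_norm I q (\<lambda>y. W y - \<xi> y a b \<nu>) < \<kappa> \<and>
      ennreal (1 / \<delta>) * (\<integral>\<^sup>+y. ennreal (F (scaled_jet I n \<delta> W y) x) \<partial>lebesgue_on I) \<le> c"
  shows "E0 n p q A M F B a b \<nu> x \<le> c"
proof -
  define en where "en \<delta> W = ennreal (1 / \<delta>) * (\<integral>\<^sup>+y. ennreal (F (scaled_jet I n \<delta> W y) x) \<partial>lebesgue_on I)" for \<delta> W
  define P where "P \<kappa> s \<longleftrightarrow> (case s of (\<delta>, \<Phi> :: (real^'N \<Rightarrow> real) \<Rightarrow> real^'d, W) \<Rightarrow> 0 < \<delta> \<and> \<delta> < \<kappa> \<and>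
      (distribution I \<Phi> \<and> represented_by I (A_grad A \<Phi>) W \<and> W \<in> Lq I q \<inter> sobolev I n p \<and>
      (AE y in lebesgue_on I. W y \<in> M)) \<and> Lq_norm I q (\<lambda>y. W y - \<xi> y a b \<nu>) < \<kappa> \<and> en \<delta> W \<le> c)" for \<kappa> s
  have ex: "\<exists>s. P \<kappa> s" if "0 < \<kappa>" for \<kappa>
    using *[OF that] unfolding P_def en_def by (auto split: prod.split)
  have mono: "P \<kappa> s \<Longrightarrow> \<kappa> \<le> \<kappa>' \<Longrightarrow> P \<kappa>' s" for \<kappa> \<kappa>' s
    unfolding P_def by (auto split: prod.splits)
  have Pd: "P \<kappa> s \<Longrightarrow> 0 < fst s \<and> fst s < \<kappa>" for \<kappa> s by (auto simp: P_def split: prod.splits)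
  \<comment> \<open>Dependent choice keeps the scales strictly decreasing, so that the index of a
    scale can be recovered from it.\<close>
  have "\<exists>f. \<forall>j. P (1 / real (Suc j)) (f j) \<and> fst (f (Suc j)) < fst (f j)"
  proof (rule dependent_nat_choice)
    show "\<exists>s. P (1 / real (Suc 0)) s" by (rule ex) simp
    fix s j assume "P (1 / real (Suc j)) s"
    then have "0 < min (fst s) (1 / real (Suc (Suc j)))" using Pd by auto
    then obtain s' where s': "P (min (fst s) (1 / real (Suc (Suc j)))) s'" using ex by blast
    then show "\<exists>s'. P (1 / real (Suc (Suc j))) s' \<and> fst s' < fst s"
      using mono[OF s', of "1 / real (Suc (Suc j))"] Pd[OF s'] by (intro exI[of _ s']) simp
  qed
  then obtain f where f: "\<And>j. P (1 / real (Suc j)) (f j)" "\<And>j. fst (f (Suc j)) < fst (f j)" by blast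
  define \<delta> where "\<delta> j = fst (f j)" for j
  define \<Phi> where "\<Phi> j = fst (snd (f j))" for j
  define W where "W j = snd (snd (f j))" for j
  have fj: "f j = (\<delta> j, \<Phi> j, W j)" for j by (simp add: \<delta>_def \<Phi>_def W_def)
  have pos: "0 < \<delta> j" "\<delta> j < 1 / real (Suc j)" for j using f(1)[of j] by (auto simp: P_def fj)
  have good: "distribution I (\<Phi> j)" "represented_by I (A_grad A (\<Phi> j)) (W j)" "W j \<in> Lq I q \<inter> sobolev I n p"
      "AE y in lebesgue_on I. W j y \<in> M" "Lq_norm I q (\<lambda>y. W j y - \<xi> y a b \<nu>) < 1 / real (Suc j)"
      "en (\<delta> j) (W j) \<le> c" for j
    using f(1)[of j] by (auto simp: P_def fj)
  have dec: "\<delta> j < \<delta> i" if "i < j" for i j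
    using that f(2) by (induction rule: less_Suc_induct) (auto simp: \<delta>_def)
  have small: "\<exists>j. \<delta> j < \<epsilon>" if \<epsilon>: "0 < \<epsilon>" for \<epsilon>
  proof -
    obtain j where "1 / real (Suc j) < \<epsilon>" using nat_approx_posE[OF \<epsilon>] by blast
    with pos(2)[of j] show ?thesis by (intro exI[of _ j]) simp
  qed
  \<comment> \<open>The index of the first scale not exceeding \<epsilon>. The energy is controlled
    only when \<epsilon> is itself one of the scales, which is enough for a lower limit.\<close>
  define N where "N \<epsilon> = (LEAST j. \<delta> j \<le> \<epsilon>)" for \<epsilon>
  have N: "\<delta> (N \<epsilon>) \<le> \<epsilon>" if "0 < \<epsilon>" for \<epsilon>
  proof -
    have "\<exists>j. \<delta> j \<le> \<epsilon>" using small[OF that] less_imp_le by blast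
    then show ?thesis unfolding N_def by (rule LeastI_ex[where P="\<lambda>j. \<delta> j \<le> \<epsilon>"])
  qed
  have N\<delta>: "N (\<delta> j) = j" for j
    unfolding N_def 
  proof (rule Least_equality)
    show "j \<le> i" if "\<delta> i \<le> \<delta> j" for i using dec[of i j] that by (cases "i < j") auto
  qed simp
  have Nlarge: "i < N \<epsilon>" if "0 < \<epsilon>" "\<epsilon> < \<delta> i" for i \<epsilon>
  proof (rule ccontr)
    assume "\<not> i < N \<epsilon>"
    then have "\<delta> i \<le> \<delta> (N \<epsilon>)" using dec[of "N \<epsilon>" i] by (cases "N \<epsilon> = i") auto
    with N[OF that(1)] that(2) show False by linarith
  qed
  have "admissible n p q A M B a b \<nu> (\<lambda>\<epsilon>. \<Phi> (N \<epsilon>)) (\<lambda>\<epsilon>. W (N \<epsilon>))"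
    unfolding admissible_def Let_def I_def[symmetric] tendsto_Lq_def
  proof (intro conjI allI impI good)
    show "((\<lambda>\<epsilon>. Lq_norm I q (\<lambda>y. W (N \<epsilon>) y - \<xi> y a b \<nu>)) \<longlongrightarrow> 0) (at_right 0)"
    proof (rule tendstoI)
      fix e :: real assume "0 < e"
      then obtain i where i: "1 / real (Suc i) < e" using nat_approx_posE by blast
      have "eventually (\<lambda>\<epsilon>. 0 < \<epsilon> \<and> \<epsilon> < \<delta> i) (at_right 0)"
        using pos(1)[of i] by (auto simp: eventually_at_right intro!: exI[of _ "\<delta> i"])
      then show "eventually (\<lambda>\<epsilon>. dist (Lq_norm I q (\<lambda>y. W (N \<epsilon>) y - \<xi> y a b \<nu>)) 0 < e) (at_right 0)"
      proof eventually_elim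
        case (elim \<epsilon>)
        then have "i < N \<epsilon>" using Nlarge by simp
        then have "1 / real (Suc (N \<epsilon>)) \<le> 1 / real (Suc i)" by (simp add: frac_le)
        moreover have "0 \<le> Lq_norm I q (\<lambda>y. W (N \<epsilon>) y - \<xi> y a b \<nu>)"
          by (auto simp: Lq_norm_def intro!: sum_nonneg)
        ultimately show ?case using good(5)[of "N \<epsilon>"] i by simp
      qed
    qed
  qed
  then have "E0 n p q A M F B a b \<nu> x \<le> Liminf (at_right 0) (\<lambda>\<epsilon>. en \<epsilon> (W (N \<epsilon>)))"
    unfolding E0_def I_def[symmetric] en_def
    by (intro Inf_lower CollectI exI[of _ "\<lambda>\<epsilon>. \<Phi> (N \<epsilon>)"] exI[of _ "\<lambda>\<epsilon>. W (N \<epsilon>)"] conjI refl)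
  also have "\<dots> \<le> c"
  proof (rule ccontr)
    assume "\<not> ?thesis"
    then have "eventually (\<lambda>\<epsilon>. c < en \<epsilon> (W (N \<epsilon>))) (at_right 0)" by (intro less_LiminfD) auto
    then obtain b where b: "0 < b" "\<And>\<epsilon>. 0 < \<epsilon> \<Longrightarrow> \<epsilon> < b \<Longrightarrow> c < en \<epsilon> (W (N \<epsilon>))"
      unfolding eventually_at_right_field by blast
    obtain j where "\<delta> j < b" using small[OF b(1)] by blast
    then show False using b(2)[of "\<delta> j"] pos(1)[of j] good(6)[of j] N\<delta> by auto
  qed
  finally show ?thesis .
qed

section \<open>Estimates with a vector exponent\<close>

lemma powr_add_le:
  fixes u v r :: real
  assumes "1 \<le> r"
  shows "\<bar>u + v\<bar> powr r \<le> 2 powr r * (\<bar>u\<bar> powr r + \<bar>v\<bar> powr r)"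
proof -
  have "\<bar>u + v\<bar> powr r \<le> (2 * max \<bar>u\<bar> \<bar>v\<bar>) powr r" using assms by (intro powr_mono2) auto
  also have "\<dots> = 2 powr r * (max \<bar>u\<bar> \<bar>v\<bar>) powr r" by (simp add: powr_mult)
  also have "\<dots> \<le> 2 powr r * (\<bar>u\<bar> powr r + \<bar>v\<bar> powr r)" by (intro mult_left_mono) (auto simp: max_def)
  finally show ?thesis .
qed

lemma Lq_diff:
  assumes "f \<in> Lq U q" "g \<in> Lq U q" "\<And>j. 1 \<le> q $ j"
  shows "(\<lambda>x. f x - g x) \<in> Lq U q"
  unfolding Lq_def
proof (intro CollectI allI conjI)
  fix j
  have m: "(\<lambda>x. f x $ j) \<in> borel_measurable (lebesgue_on U)" "(\<lambda>x. g x $ j) \<in> borel_measurable (lebesgue_on U)"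
    and i: "integrable (lebesgue_on U) (\<lambda>x. \<bar>f x $ j\<bar> powr q $ j)" "integrable (lebesgue_on U) (\<lambda>x. \<bar>g x $ j\<bar> powr q $ j)"
    using assms by (auto simp: Lq_def)
  show m': "(\<lambda>x. (f x - g x) $ j) \<in> borel_measurable (lebesgue_on U)" using m by simp
  show "integrable (lebesgue_on U) (\<lambda>x. \<bar>(f x - g x) $ j\<bar> powr q $ j)"
  proof (rule Bochner_Integration.integrable_bound)
    show "integrable (lebesgue_on U) (\<lambda>x. 2 powr q $ j * (\<bar>f x $ j\<bar> powr q $ j + \<bar>g x $ j\<bar> powr q $ j))"
      by (intro integrable_mult_right Bochner_Integration.integrable_add i)
    show "(\<lambda>x. \<bar>(f x - g x) $ j\<bar> powr q $ j) \<in> borel_measurable (lebesgue_on U)" using m' by measurable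
    show "AE x in lebesgue_on U. norm (\<bar>(f x - g x) $ j\<bar> powr q $ j) \<le> norm (2 powr q $ j * (\<bar>f x $ j\<bar> powr q $ j + \<bar>g x $ j\<bar> powr q $ j))"
      using powr_add_le[OF assms(3), of "f _ $ j" "- g _ $ j" j] by (intro always_eventually allI) simp
  qed
qed

lemma Lq_const:
  assumes "compactly_inside V U"
  shows "(\<lambda>x. c) \<in> Lq V q"
proof -
  have "bounded V"
    using assms compact_imp_bounded[of "closure V"] bounded_subset[OF _ closure_subset[of V]]
    by (simp add: compactly_inside_def)
  moreover have "V \<in> sets lebesgue" using assms by (simp add: compactly_inside_def)
  ultimately have "V \<in> lmeasurable" by (rule bounded_set_imp_lmeasurable)
  then have "integrable (lebesgue_on V) (\<lambda>x. k)" for k :: real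
    by (intro finite_measure.integrable_const finite_measure_lebesgue_on)
  then show ?thesis by (simp add: Lq_def)
qed

text \<open>\<open>V\<close> and \<open>S\<close> are kept apart because measurability of the energy
  density is available on sets compactly inside the domain, whereas the comparison set may be the
  whole domain.\<close>

lemma sum_nn_integral_disjoint_le:
  fixes f :: "real^'N::finite \<Rightarrow> ennreal"
  assumes "finite Z" "\<And>z. z \<in> Z \<Longrightarrow> C z \<in> sets lebesgue \<and> C z \<subseteq> V"
    and V: "V \<in> sets lebesgue" "f \<in> borel_measurable (lebesgue_on V)"
    and disj: "pairwise (\<lambda>z z'. disjnt (C z) (C z')) Z"
    and S: "S \<in> sets lebesgue" "\<And>z. z \<in> Z \<Longrightarrow> C z \<subseteq> S"
  shows "(\<Sum>z\<in>Z. \<integral>\<^sup>+x. f x \<partial>lebesgue_on (C z)) \<le> (\<integral>\<^sup>+x. f x \<partial>lebesgue_on S)"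
proof -
  let ?s = "\<lambda>x. \<Sum>z\<in>Z. f x * indicator (C z) x"
  have fV: "(\<lambda>x. f x * indicator V x) \<in> borel_measurable lebesgue"
    using V by (simp add: borel_measurable_restrict_space_iff_ennreal)
  have m: "(\<lambda>x. f x * indicator (C z) x) \<in> borel_measurable lebesgue" if "z \<in> Z" for z
  proof -
    have "(\<lambda>x. (f x * indicator V x) * indicator (C z) x) \<in> borel_measurable lebesgue"
      using assms(2)[OF that] by (intro borel_measurable_times_ennreal fV borel_measurable_indicator) auto
    also have "(\<lambda>x. (f x * indicator V x) * indicator (C z) x) = (\<lambda>x. f x * indicator (C z) x)"
      using assms(2)[OF that] by (auto simp: indicator_def fun_eq_iff)
    finally show ?thesis .
  qed
  have "(\<Sum>z\<in>Z. \<integral>\<^sup>+x. f x \<partial>lebesgue_on (C z)) = (\<Sum>z\<in>Z. \<integral>\<^sup>+x. f x * indicator (C z) x \<partial>lebesgue)"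
    using assms(2) by (intro sum.cong refl) (simp add: nn_integral_restrict_space)
  also have "\<dots> = (\<integral>\<^sup>+x. ?s x \<partial>lebesgue)"
    by (intro nn_integral_sum[symmetric] m)
  also have "\<dots> \<le> (\<integral>\<^sup>+x. f x * indicator S x \<partial>lebesgue)"
  proof (intro nn_integral_mono)
    fix x
    show "?s x \<le> f x * indicator S x"
    proof (cases "\<exists>z\<in>Z. x \<in> C z")
      case True
      then obtain z0 where z0: "z0 \<in> Z" "x \<in> C z0" by blast
      have "?s x = (\<Sum>z\<in>Z. if z = z0 then f x else 0)"
        using disj z0 by (intro sum.cong refl) (auto simp: pairwise_def disjnt_iff indicator_def)
      also have "\<dots> = f x" using assms(1) z0(1) by simp
      also have "\<dots> = f x * indicator S x" using S(2)[OF z0(1)] z0(2) by auto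
      finally show ?thesis by simp
    next
      case False
      then have "?s x = (\<Sum>z\<in>Z. 0)" by (intro sum.cong) auto
      then show ?thesis by simp
    qed
  qed
  also have "\<dots> = (\<integral>\<^sup>+x. f x \<partial>lebesgue_on S)" using S(1) by (simp add: nn_integral_restrict_space)
  finally show ?thesis .
qed

text \<open>The norm bounds a root of the integral. Since \<sigma> \<le> 1 and the exponent is at
  least 1, raising \<sigma> to that exponent does not increase it, so one linear bound serves every
  component.\<close>

lemma nn_integral_le_of_Lq_norm:
  assumes f: "f \<in> Lq V q" and q: "1 \<le> q $ j" and lt: "Lq_norm V q f < \<sigma>" and "\<sigma> \<le> 1"
  shows "(\<integral>\<^sup>+x. ennreal (\<bar>f x $ j\<bar> powr q $ j) \<partial>lebesgue_on V) \<le> ennreal \<sigma>"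
proof -
  define a where "a = (LINT x|lebesgue_on V. \<bar>f x $ j\<bar> powr q $ j)"
  have i: "integrable (lebesgue_on V) (\<lambda>x. \<bar>f x $ j\<bar> powr q $ j)" using f by (simp add: Lq_def)
  have a0: "0 \<le> a" unfolding a_def by (rule integral_nonneg_AE) simp
  have "a powr (1 / q $ j) \<le> Lq_norm V q f"
    unfolding Lq_norm_def a_def by (rule member_le_sum) auto
  then have le: "a powr (1 / q $ j) \<le> \<sigma>" using lt by simp
  have s_ne: "0 \<le> \<sigma>" using le powr_ge_zero[of a "1 / q $ j"] by linarith
  have "a = (a powr (1 / q $ j)) powr (q $ j)" using a0 q by (simp add: powr_powr)
  also have "\<dots> \<le> \<sigma> powr (q $ j)" using le q by (intro powr_mono2) auto
  also have "\<dots> \<le> \<sigma> powr 1" using s_ne \<open>\<sigma> \<le> 1\<close> q by (intro powr_mono') auto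
  also have "\<dots> = \<sigma>" using s_ne by simp
  finally have "a \<le> \<sigma>" .
  moreover have "(\<integral>\<^sup>+x. ennreal (\<bar>f x $ j\<bar> powr q $ j) \<partial>lebesgue_on V) = ennreal a"
    unfolding a_def using i by (intro nn_integral_eq_integral) auto
  ultimately show ?thesis by (simp add: ennreal_leI)
qed

lemma Lq_norm_le:
  assumes "\<And>j. (\<integral>\<^sup>+x. ennreal (\<bar>f x $ j\<bar> powr q $ j) \<partial>lebesgue_on V) \<le> ennreal (m j)" "\<And>j. 0 \<le> m j" "\<And>j. 1 \<le> q $ j"
  shows "Lq_norm V q f \<le> (\<Sum>j\<in>UNIV. m j powr (1 / q $ j))"
  unfolding Lq_norm_def
proof (intro sum_mono powr_mono2)
  fix j
  show "(LINT x|lebesgue_on V. \<bar>f x $ j\<bar> powr q $ j) \<le> m j"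
  proof (cases "integrable (lebesgue_on V) (\<lambda>x. \<bar>f x $ j\<bar> powr q $ j)")
    case True
    then have "(\<integral>\<^sup>+x. ennreal (\<bar>f x $ j\<bar> powr q $ j) \<partial>lebesgue_on V) = ennreal (LINT x|lebesgue_on V. \<bar>f x $ j\<bar> powr q $ j)"
      by (intro nn_integral_eq_integral) auto
    then show ?thesis using assms(1)[of j] assms(2)[of j] by simp
  qed (simp add: not_integrable_integral_eq assms(2))
  show "0 \<le> 1 / q $ j" using assms(3)[of j] by simp
qed (auto intro!: integral_nonneg_AE)

lemma half_ball_compactly_inside:
  assumes "cball x \<rho> \<subseteq> U" "0 < \<rho>"
  shows "compactly_inside (half_ball \<rho> x \<nu>) U" "compactly_inside (ball x \<rho>) U"
proof -
  have "half_ball \<rho> x \<nu> = ball x \<rho> \<inter> {y. 0 < (y - x) \<bullet> \<nu>}" by (auto simp: half_ball_def)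
  then have "open (half_ball \<rho> x \<nu>)" by (auto intro!: open_Int open_Collect_less continuous_intros)
  moreover have "closure (half_ball \<rho> x \<nu>) \<subseteq> cball x \<rho>" by (intro closure_minimal) (auto simp: half_ball_def)
  moreover have "compact (closure (half_ball \<rho> x \<nu>))"
    unfolding compact_closure
    by (rule bounded_subset[OF bounded_ball[of x \<rho>]]) (auto simp: half_ball_def)
  ultimately show "compactly_inside (half_ball \<rho> x \<nu>) U" using assms by (auto simp: compactly_inside_def)
  show "compactly_inside (ball x \<rho>) U" using assms by (auto simp: compactly_inside_def)
qed

lemma half_ball_powq_bound:
  assumes w: "w \<in> Lq_loc U q" and q: "\<And>j. 1 \<le> q $ j" and b: "cball x \<rho> \<subseteq> U" "0 < \<rho>"
    and le: "(LINT y|lebesgue_on (half_ball \<rho> x \<nu>). powq (w y - a) q) \<le> e"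
  shows "(\<integral>\<^sup>+y. ennreal (\<bar>(w y - a) $ j\<bar> powr q $ j) \<partial>lebesgue_on (half_ball \<rho> x \<nu>)) \<le> ennreal e"
proof -
  let ?H = "half_ball \<rho> x \<nu>"
  have c: "compactly_inside ?H U" using b by (rule half_ball_compactly_inside)
  then have "(\<lambda>y. w y - a) \<in> Lq ?H q"
    using w by (intro Lq_diff Lq_const q) (auto simp: Lq_loc_def)
  then have i: "integrable (lebesgue_on ?H) (\<lambda>y. \<bar>(w y - a) $ j\<bar> powr q $ j)" for j by (simp add: Lq_def)
  have "(\<integral>\<^sup>+y. ennreal (\<bar>(w y - a) $ j\<bar> powr q $ j) \<partial>lebesgue_on ?H) = ennreal (LINT y|lebesgue_on ?H. \<bar>(w y - a) $ j\<bar> powr q $ j)"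
    using i by (intro nn_integral_eq_integral) auto
  also have "\<dots> \<le> ennreal (LINT y|lebesgue_on ?H. powq (w y - a) q)"
  proof (intro ennreal_leI integral_mono i)
    show "integrable (lebesgue_on ?H) (\<lambda>y. powq (w y - a) q)" unfolding powq_def using i by simp
    show "\<bar>(w y - a) $ j\<bar> powr q $ j \<le> powq (w y - a) q" for y
      unfolding powq_def by (rule member_le_sum) auto
  qed
  also have "\<dots> \<le> ennreal e" using le by (rule ennreal_leI)
  finally show ?thesis .
qed

text \<open>On each half ball, u minus the jump function is the sum of u - w and of the deviation of
  w from its one-sided limit. The three resulting integrals are at most e each,
  \<open>2 powr q $ j\<close> is the price of splitting a power of a sum, and the separating
  hyperplane is null.\<close>

lemma jump_distance_le:
  fixes w u :: "real^'N::finite \<Rightarrow> real^'m::finite"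
  assumes w: "w \<in> Lq_loc U q" and u: "u \<in> Lq_loc U q" and q: "\<And>j. 1 \<le> q $ j"
    and b: "cball x \<rho> \<subseteq> U" "0 < \<rho>" and \<nu>: "norm \<nu> = 1" and e: "0 \<le> e"
    and p: "(LINT y|lebesgue_on (half_ball \<rho> x \<nu>). powq (w y - a) q) \<le> e"
    and m: "(LINT y|lebesgue_on (half_ball \<rho> x (- \<nu>)). powq (w y - b) q) \<le> e"
    and d: "(\<integral>\<^sup>+y. ennreal (\<bar>(u y - w y) $ j\<bar> powr q $ j) \<partial>lebesgue_on (ball x \<rho>)) \<le> ennreal e"
  shows "(\<integral>\<^sup>+y. ennreal (\<bar>(u y - \<xi> (y - x) a b \<nu>) $ j\<bar> powr q $ j) \<partial>lebesgue_on (ball x \<rho>)) \<le> ennreal (2 powr q $ j * (3 * e))"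
proof -
  let ?e = "\<lambda>y. \<bar>(u y - \<xi> (y - x) a b \<nu>) $ j\<bar> powr q $ j"
  let ?V = "ball x \<rho>" and ?P = "half_ball \<rho> x \<nu>" and ?M = "half_ball \<rho> x (- \<nu>)"
  let ?d = "\<lambda>y. \<bar>(u y - w y) $ j\<bar> powr q $ j" and ?p = "\<lambda>y. \<bar>(w y - a) $ j\<bar> powr q $ j" and ?m = "\<lambda>y. \<bar>(w y - b) $ j\<bar> powr q $ j"
  have V: "compactly_inside ?V U" and PM: "compactly_inside ?P U" "compactly_inside ?M U"
    using half_ball_compactly_inside[OF b] by auto
  have VS: "?V \<in> sets lebesgue" "?P \<in> sets lebesgue" "?M \<in> sets lebesgue"
    using V PM by (auto simp: compactly_inside_def)
  note R = borel_measurable_restrict_space_iff_ennreal[symmetric]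
  have dm: "(\<lambda>y. ennreal (?d y) * indicator ?V y) \<in> borel_measurable lebesgue"
    using Lq_diff[of u ?V q w] u w q V VS
    by (subst R) (auto simp: Lq_def Lq_loc_def)
  have pm: "(\<lambda>y. ennreal (?p y) * indicator ?P y) \<in> borel_measurable lebesgue"
    using Lq_diff[of w ?P q "\<lambda>_. a"] Lq_const[OF PM(1)] w q PM VS
    by (subst R) (auto simp: Lq_def Lq_loc_def)
  have mm: "(\<lambda>y. ennreal (?m y) * indicator ?M y) \<in> borel_measurable lebesgue"
    using Lq_diff[of w ?M q "\<lambda>_. b"] Lq_const[OF PM(2)] w q PM VS
    by (subst R) (auto simp: Lq_def Lq_loc_def)
  have "negligible {y. \<nu> \<bullet> y = \<nu> \<bullet> x}" using \<nu> by (intro negligible_hyperplane) auto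
  then have off: "AE y in lebesgue. y \<notin> {y. \<nu> \<bullet> y = \<nu> \<bullet> x}"
    by (intro AE_not_in) (simp add: negligible_iff_null_sets)
  have "(\<integral>\<^sup>+y. ennreal (?e y) \<partial>lebesgue_on ?V)
      = (\<integral>\<^sup>+y. ennreal (?e y) * indicator ?V y \<partial>lebesgue)"
    using VS by (simp add: nn_integral_restrict_space)
  also have "\<dots> \<le> (\<integral>\<^sup>+y. ennreal (2 powr q $ j) * ((ennreal (?d y) * indicator ?V y) + (ennreal (?p y) * indicator ?P y + ennreal (?m y) * indicator ?M y)) \<partial>lebesgue)"
  proof (rule nn_integral_mono_AE, use off in eventually_elim)
    case (elim y)
    show ?case
    proof (cases "y \<in> ?V")
      case y: True
      have ne: "(y - x) \<bullet> \<nu> \<noteq> 0" using elim by (simp add: inner_commute[of _ \<nu>] inner_diff_right)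
      show ?thesis
      proof (cases "0 < (y - x) \<bullet> \<nu>")
        case True
        then have i: "y \<in> ?P" "y \<notin> ?M" using y by (auto simp: half_ball_def)
        have "?e y \<le> 2 powr q $ j * (?d y + ?p y)"
          using powr_add_le[OF q[of j], of "(u y - w y) $ j" "(w y - a) $ j"] True by (simp add: \<xi>_def)
        then show ?thesis using i y by (simp add: ennreal_plus[symmetric] ennreal_mult[symmetric] ennreal_leI del: ennreal_plus)
      next
        case False
        then have i: "y \<notin> ?P" "y \<in> ?M" using y ne by (auto simp: half_ball_def)
        have "?e y \<le> 2 powr q $ j * (?d y + ?m y)"
          using powr_add_le[OF q[of j], of "(u y - w y) $ j" "(w y - b) $ j"] False by (simp add: \<xi>_def)
        then show ?thesis using i y by (simp add: ennreal_plus[symmetric] ennreal_mult[symmetric] ennreal_leI del: ennreal_plus)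
      qed
    qed simp
  qed
  also have "\<dots> = ennreal (2 powr q $ j) * ((\<integral>\<^sup>+y. ennreal (?d y) * indicator ?V y \<partial>lebesgue) +
      ((\<integral>\<^sup>+y. ennreal (?p y) * indicator ?P y \<partial>lebesgue) + (\<integral>\<^sup>+y. ennreal (?m y) * indicator ?M y \<partial>lebesgue)))"
    using dm pm mm by (subst nn_integral_cmult nn_integral_add, auto)+
  also have "\<dots> \<le> ennreal (2 powr q $ j) * (ennreal e + (ennreal e + ennreal e))"
    using d half_ball_powq_bound[OF w q b p, of j] half_ball_powq_bound[OF w q b m, of j] VS
    by (intro mult_left_mono add_mono) (auto simp: nn_integral_restrict_space)
  also have "\<dots> = ennreal (2 powr q $ j * (3 * e))"
    using e by (simp add: ennreal_plus[symmetric] ennreal_mult[symmetric] del: ennreal_plus)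
  finally show ?thesis .
qed

text \<open>The factor collects three effects: s/\<epsilon> is the prefactor at the new scale
  \<epsilon>/s, s^(-N) comes from the change of variables, and 1/(1 - \<tau>) pays for freezing the
  last argument of \<open>F\<close> at x.\<close>

lemma rescaled_energy_le:
  fixes F :: "('N::finite list \<Rightarrow> real^'m::finite) \<Rightarrow> real^'N \<Rightarrow> real"
  assumes s: "0 < s" and I: "open I" and U: "open U" and TI: "compactly_inside (zoom x0 s ` I) U"
    and F: "continuous_on (jets n \<times> UNIV) (\<lambda>(J, x). F J x)" "\<And>J x. J \<in> jets n \<Longrightarrow> 0 \<le> F J x"
    and w: "w \<in> sobolev_loc U n p" "loc_integrable U w"
    and \<tau>: "\<tau> < 1" "\<And>J y. J \<in> jets n \<Longrightarrow> y \<in> zoom x0 s ` I \<Longrightarrow> (1 - \<tau>) * F J x \<le> F J y"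
    and \<epsilon>: "0 < \<epsilon>"
  shows "ennreal (1 / (\<epsilon> / s)) * (\<integral>\<^sup>+y. ennreal (F (scaled_jet I n (\<epsilon> / s) (\<lambda>y. w (zoom x0 s y)) y) x) \<partial>lebesgue_on I)
    \<le> ennreal (s / \<epsilon> / ((1 - \<tau>) * s ^ CARD('N))) *
       (\<integral>\<^sup>+y. ennreal (F (scaled_jet U n \<epsilon> w y) y) \<partial>lebesgue_on (zoom x0 s ` I))"
proof -
  let ?L = "\<integral>\<^sup>+y. ennreal (F (scaled_jet I n (\<epsilon> / s) (\<lambda>y. w (zoom x0 s y)) y) x) \<partial>lebesgue_on I"
  let ?R = "\<integral>\<^sup>+y. ennreal (F (scaled_jet U n \<epsilon> w y) y) \<partial>lebesgue_on (zoom x0 s ` I)"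
  let ?K = "\<integral>\<^sup>+y. ennreal (F (scaled_jet U n \<epsilon> w (zoom x0 s y)) (zoom x0 s y)) \<partial>lebesgue_on I"
  let ?T = "zoom x0 s"
  let ?G = "\<lambda>y. F (scaled_jet U n \<epsilon> w y) y"
  have s_ne: "s \<noteq> 0" and Is: "I \<in> sets lebesgue" using s I by auto
  have Gm: "?G \<in> borel_measurable (lebesgue_on (?T ` I))"
    by (rule energy_density_measurable[OF F(1) w TI])
  then have GTm: "(\<lambda>y. ?G (?T y)) \<in> borel_measurable (lebesgue_on I)"
    by (subst measurable_on_affine_iff[OF s_ne Is, of ?G x0])
  have "AE y in lebesgue_on I. scaled_jet I n (\<epsilon> / s) (\<lambda>y. w (?T y)) y = scaled_jet U n (\<epsilon> / s * s) w (?T y)"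
    by (rule scaled_jet_pull[OF s I U TI w(1)])
  then have ae: "AE y in lebesgue_on I. scaled_jet I n (\<epsilon> / s) (\<lambda>y. w (?T y)) y = scaled_jet U n \<epsilon> w (?T y)"
    using s by simp
  have "?L
      \<le> (\<integral>\<^sup>+y. ennreal (1 / (1 - \<tau>)) * ennreal (?G (?T y)) \<partial>lebesgue_on I)"
  proof (rule nn_integral_mono_AE)
    have "AE y in lebesgue_on I. y \<in> space (lebesgue_on I)" by (rule AE_space)
    with ae show "AE y in lebesgue_on I. ennreal (F (scaled_jet I n (\<epsilon> / s) (\<lambda>y. w (?T y)) y) x) \<le> ennreal (1 / (1 - \<tau>)) * ennreal (?G (?T y))"
    proof eventually_elim
      case (elim y)
      then have "?T y \<in> ?T ` I" by (intro imageI) (simp add: space_restrict_space)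
      then have "(1 - \<tau>) * F (scaled_jet U n \<epsilon> w (?T y)) x \<le> ?G (?T y)"
        by (intro \<tau>(2) scaled_jet_in_jets)
      then have "F (scaled_jet U n \<epsilon> w (?T y)) x \<le> 1 / (1 - \<tau>) * ?G (?T y)"
        using \<tau>(1) by (simp add: field_simps)
      then show ?case unfolding elim(1)
        using \<tau>(1) F(2)[OF scaled_jet_in_jets] by (subst ennreal_mult[symmetric]) (auto intro: ennreal_leI)
    qed
  qed
  also have "\<dots> = ennreal (1 / (1 - \<tau>)) * ?K"
    using GTm by (intro nn_integral_cmult) measurable
  finally have 1: "?L
      \<le> ennreal (1 / (1 - \<tau>)) * ?K" .
  have "?R = ennreal (\<bar>s\<bar> ^ CARD('N)) * ?K"
    by (rule nn_integral_on_affine[OF s_ne Is Gm])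
  then have "ennreal (1 / s ^ CARD('N)) * ?R
      = (ennreal (1 / s ^ CARD('N)) * ennreal (\<bar>s\<bar> ^ CARD('N))) * ?K"
    by (simp add: mult.assoc)
  also have "ennreal (1 / s ^ CARD('N)) * ennreal (\<bar>s\<bar> ^ CARD('N)) = 1"
    using s by (subst ennreal_mult[symmetric]) auto
  finally have 2: "?K
      = ennreal (1 / s ^ CARD('N)) * ?R" by simp
  have "ennreal (1 / (\<epsilon> / s)) * ?L
      \<le> ennreal (1 / (\<epsilon> / s)) * (ennreal (1 / (1 - \<tau>)) * (ennreal (1 / s ^ CARD('N)) * ?R))"
    using 1 unfolding 2 by (intro mult_left_mono) auto
  also have "\<dots> = (ennreal (1 / (\<epsilon> / s)) * (ennreal (1 / (1 - \<tau>)) * ennreal (1 / s ^ CARD('N)))) * ?R"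
    by (simp add: mult.assoc)
  also have "ennreal (1 / (\<epsilon> / s)) * (ennreal (1 / (1 - \<tau>)) * ennreal (1 / s ^ CARD('N))) = ennreal (s / \<epsilon> / ((1 - \<tau>) * s ^ CARD('N)))"
    using s \<epsilon> \<tau>(1) by (simp add: ennreal_mult[symmetric])
  finally show ?thesis .
qed

lemma ennreal_pigeonhole:
  fixes e :: "'a \<Rightarrow> ennreal"
  assumes "finite Z" "0 < card Z" "(\<Sum>z\<in>Z. e z) \<le> ennreal K" "0 \<le> K"
  obtains z where "z \<in> Z" "e z \<le> ennreal (K / real (card Z))"
proof -
  have ne: "Z \<noteq> {}" using assms(2) by auto
  define z where "z = arg_min_on e Z"
  have z: "z \<in> Z" "\<And>z'. z' \<in> Z \<Longrightarrow> e z \<le> e z'"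
    using arg_min_if_finite[OF assms(1) ne, of e] by (auto simp: z_def not_less[symmetric])
  have "of_nat (card Z) * e z = (\<Sum>z'\<in>Z. e z)" by simp
  also have "\<dots> \<le> (\<Sum>z'\<in>Z. e z')" by (intro sum_mono z)
  also have "\<dots> \<le> ennreal K" by fact
  finally have le: "of_nat (card Z) * e z \<le> ennreal K" .
  then have "of_nat (card Z) * e z < \<infinity>" by (simp add: le_less_trans)
  then have "e z < \<infinity>" using assms(2) by (auto simp: ennreal_mult_less_top)
  then obtain r where r: "0 \<le> r" "e z = ennreal r" by (cases "e z") auto
  then have "ennreal (real (card Z) * r) \<le> ennreal K" using le by (simp add: ennreal_of_nat_eq_real_of_nat ennreal_mult)
  then have "real (card Z) * r \<le> K" using assms(4) by simp
  then have "r \<le> K / real (card Z)" using assms(2) by (simp add: field_simps)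
  then show ?thesis using z(1) r by (intro that[of z]) (auto intro: ennreal_leI)
qed

lemma eventually_at_right_0_less: "0 < d \<Longrightarrow> eventually (\<lambda>\<rho>. 0 < \<rho> \<and> \<rho> < d) (at_right (0::real))"
  unfolding eventually_at_right_field by auto

text \<open>Supplies a tolerance \<sigma> for which all components of the rescaled norm together
  stay below \<kappa>. The absolute values in the proof keep the bases nonnegative, as the limit of
  \<open>powr\<close> at base 0 requires.\<close>

lemma small_powr_sum:
  fixes C r :: "'m::finite \<Rightarrow> real"
  assumes "0 < \<kappa>" "\<And>j. 0 < r j" "\<And>j. 0 \<le> C j"
  obtains \<sigma> where "0 < \<sigma>" "(\<Sum>j\<in>UNIV. (C j * \<sigma>) powr r j) < \<kappa>"
proof -
  let ?s = "\<lambda>\<sigma>. \<Sum>j\<in>UNIV. \<bar>C j * \<sigma>\<bar> powr r j"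
  have "(?s \<longlongrightarrow> (\<Sum>j\<in>(UNIV::'m set). 0)) (at_right 0)"
  proof (rule tendsto_sum)
    fix j
    have "((\<lambda>\<sigma>. \<bar>C j * \<sigma>\<bar>) \<longlongrightarrow> \<bar>C j * 0\<bar>) (at_right 0)" by (intro tendsto_intros)
    then have "((\<lambda>\<sigma>. \<bar>C j * \<sigma>\<bar>) \<longlongrightarrow> 0) (at_right 0)" by simp
    then show "((\<lambda>\<sigma>. \<bar>C j * \<sigma>\<bar> powr r j) \<longlongrightarrow> 0) (at_right 0)"
      using tendsto_powr2[OF _ tendsto_const[of "r j"], of "\<lambda>\<sigma>. \<bar>C j * \<sigma>\<bar>" 0] assms(2)[of j] by auto
  qed
  then have "eventually (\<lambda>\<sigma>. ?s \<sigma> < \<kappa>) (at_right 0)"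
    using assms(1) by (intro order_tendstoD(2)[where a=\<kappa>]) auto
  then have "eventually (\<lambda>\<sigma>. ?s \<sigma> < \<kappa> \<and> 0 < \<sigma>) (at_right 0)"
    using eventually_at_right_0_less[of 1] by (auto elim: eventually_elim2)
  then obtain \<sigma> where \<sigma>: "?s \<sigma> < \<kappa>" "0 < \<sigma>"
    using eventually_happens'[OF trivial_limit_at_right_real] by blast
  then have "\<bar>C j * \<sigma>\<bar> = C j * \<sigma>" for j using assms(3)[of j] by simp
  with \<sigma> that show ?thesis by simp
qed

text \<open>The point x0 lies on the jump hyperplane through x, so zooming maps the two-valued jump
  function to itself and only the Jacobian s^N remains.\<close>

lemma rescaled_Lq_norm_le:
  fixes w u :: "real^'N::finite \<Rightarrow> real^'m::finite"
  assumes s: "0 < s" and I: "open I" and TI: "compactly_inside (zoom x0 s ` I) U"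
    and sub: "zoom x0 s ` I \<subseteq> ball x \<rho>" and x0: "(x0 - x) \<bullet> \<nu> = 0"
    and u: "u \<in> Lq_loc U q"
    and le: "(\<integral>\<^sup>+y. ennreal (\<bar>(u y - \<xi> (y - x) a b \<nu>) $ j\<bar> powr q $ j) \<partial>lebesgue_on (ball x \<rho>)) \<le> ennreal e" and e: "0 \<le> e"
  shows "(\<integral>\<^sup>+y. ennreal (\<bar>(u (zoom x0 s y) - \<xi> y a b \<nu>) $ j\<bar> powr q $ j) \<partial>lebesgue_on I) \<le> ennreal (e / s ^ CARD('N))"
proof -
  let ?K = "\<integral>\<^sup>+y. ennreal (\<bar>(u (zoom x0 s y) - \<xi> (zoom x0 s y - x) a b \<nu>) $ j\<bar> powr q $ j) \<partial>lebesgue_on I"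
  let ?T = "zoom x0 s"
  let ?f = "\<lambda>y. \<bar>(u y - \<xi> (y - x) a b \<nu>) $ j\<bar> powr q $ j"
  have s_ne: "s \<noteq> 0" and Is: "I \<in> sets lebesgue" using s I by auto
  have Ts: "?T ` I \<in> sets lebesgue" by (rule affine_image_sets[OF s_ne Is])
  have \<xi>: "\<xi> (?T y - x) a b \<nu> = \<xi> y a b \<nu>" for y
  proof -
    have "(?T y - x) \<bullet> \<nu> = (x0 - x) \<bullet> \<nu> + s * (y \<bullet> \<nu>)" by (simp add: inner_diff_left inner_add_left)
    then show ?thesis using s x0 by (simp add: \<xi>_def zero_less_mult_iff)
  qed
  have "open {y. 0 < (y - x) \<bullet> \<nu>}" by (intro open_Collect_less continuous_intros)
  then have "{y. 0 < (y - x) \<bullet> \<nu>} \<in> sets lebesgue" by simp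
  then have "(\<lambda>y. if y \<in> {y. 0 < (y - x) \<bullet> \<nu>} then a $ j else b $ j) \<in> borel_measurable lebesgue"
    by (intro measurable_If_set) auto
  moreover have "(\<lambda>y. if y \<in> {y. 0 < (y - x) \<bullet> \<nu>} then a $ j else b $ j) = (\<lambda>y. \<xi> (y - x) a b \<nu> $ j)"
    by (auto simp: \<xi>_def)
  ultimately have \<xi>m: "(\<lambda>y. \<xi> (y - x) a b \<nu> $ j) \<in> borel_measurable (lebesgue_on (?T ` I))"
    by (simp add: measurable_restrict_space1)
  have um: "(\<lambda>y. u y $ j) \<in> borel_measurable (lebesgue_on (?T ` I))" using u TI by (auto simp: Lq_loc_def Lq_def)
  have "(\<lambda>y. u y $ j - \<xi> (y - x) a b \<nu> $ j) \<in> borel_measurable (lebesgue_on (?T ` I))"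
    using um \<xi>m by (rule borel_measurable_diff)
  then have fm: "?f \<in> borel_measurable (lebesgue_on (?T ` I))"
    unfolding vector_minus_component by measurable
  have "ennreal (s ^ CARD('N)) * ?K = (\<integral>\<^sup>+y. ennreal (?f y) \<partial>lebesgue_on (?T ` I))"
    using nn_integral_on_affine[OF s_ne Is fm] s by simp
  also have "\<dots> \<le> (\<integral>\<^sup>+y. ennreal (?f y) \<partial>lebesgue_on (ball x \<rho>))"
  proof -
    have "(\<integral>\<^sup>+y. ennreal (?f y) * indicator (?T ` I) y \<partial>lebesgue) \<le> (\<integral>\<^sup>+y. ennreal (?f y) * indicator (ball x \<rho>) y \<partial>lebesgue)"
      by (intro nn_integral_mono mult_left_mono) (use sub in \<open>auto simp: indicator_def simp del: image_subset_iff\<close>)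
    then show ?thesis using Ts by (simp add: nn_integral_restrict_space)
  qed
  also have "\<dots> \<le> ennreal e" by (rule le)
  finally have "ennreal (1 / s ^ CARD('N)) * (ennreal (s ^ CARD('N)) * ?K) \<le> ennreal (1 / s ^ CARD('N)) * ennreal e"
    by (rule mult_left_mono) auto
  also have "ennreal (1 / s ^ CARD('N)) * ennreal e = ennreal (e / s ^ CARD('N))"
    using s e by (subst ennreal_mult[symmetric]) auto
  also have "ennreal (1 / s ^ CARD('N)) * (ennreal (s ^ CARD('N)) * ?K)
      = ?K"
    using s by (simp add: mult.assoc[symmetric] ennreal_mult[symmetric])
  finally show ?thesis unfolding \<xi> .
qed

text \<open>Any competitor on a small ball restricts to the packed cubes, and at least one cube carries at
  most the average share of the energy; rescaling that cube gives a competitor for \<^const>\<open>E0\<close>.\<close>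

lemma energy_density_ge:
  fixes F :: "('N::finite list \<Rightarrow> real^'m::finite) \<Rightarrow> real^'N \<Rightarrow> real"
    and A :: "real^'N^'d::finite \<Rightarrow> real^'m"
    and B :: "real^'N \<Rightarrow> (real^'N) set"
  assumes \<Omega>: "open \<Omega>" "x \<in> \<Omega>"
    and F: "continuous_on (jets n \<times> UNIV) (\<lambda>(J, x). F J x)" "\<And>J x. J \<in> jets n \<Longrightarrow> 0 \<le> F J x"
    and Fx: "\<And>\<tau>. \<tau> > 0 \<Longrightarrow> \<exists>\<alpha>>0. \<forall>J\<in>jets n. \<forall>y. norm (y - x) < \<alpha> \<longrightarrow> F J y - F J x \<ge> - \<tau> * F J x"
    and A: "linear A" and q: "\<And>j. 1 \<le> q $ j"
    and B: "orthonormal_basis (B \<nu>)" "\<nu> \<in> B \<nu>" "norm \<nu> = 1"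
    and w: "w \<in> Lq_loc \<Omega> q"
    and lim_p: "((\<lambda>\<rho>. (LINT y|lebesgue_on (half_ball \<rho> x \<nu>). powq (w y - a) q) / measure lebesgue (ball x \<rho>)) \<longlongrightarrow> 0) (at_right 0)"
    and lim_m: "((\<lambda>\<rho>. (LINT y|lebesgue_on (half_ball \<rho> x (- \<nu>)). powq (w y - b) q) / measure lebesgue (ball x \<rho>)) \<longlongrightarrow> 0) (at_right 0)"
    and u: "\<And>\<epsilon>. \<epsilon> > 0 \<Longrightarrow> distribution \<Omega> (v \<epsilon>)"
      "\<And>\<epsilon>. \<epsilon> > 0 \<Longrightarrow> represented_by \<Omega> (A_grad A (v \<epsilon>)) (u \<epsilon>)"
      "\<And>\<epsilon>. \<epsilon> > 0 \<Longrightarrow> u \<epsilon> \<in> Lq_loc \<Omega> q \<inter> sobolev_loc \<Omega> n p"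
      "\<And>\<epsilon>. \<epsilon> > 0 \<Longrightarrow> AE y in lebesgue_on \<Omega>. u \<epsilon> y \<in> M"
      "tendsto_Lq_loc \<Omega> q u w"
    and t: "0 < t" "ennreal t < E0 n p q A M F B a b \<nu> x" and \<delta>0: "0 < \<delta>0"
  shows "\<exists>\<rho>. 0 < \<rho> \<and> \<rho> < \<delta>0 \<and> ennreal (t * (unit_ball_vol (real (CARD('N) - 1)) * \<rho> ^ (CARD('N) - 1)))
     \<le> Liminf (at_right 0) (\<lambda>\<epsilon>. ennreal (1 / \<epsilon>) * (\<integral>\<^sup>+y. ennreal (F (scaled_jet \<Omega> n \<epsilon> (u \<epsilon>) y) y) \<partial>lebesgue_on (cball x \<rho>)))"
proof (rule ccontr)
  let ?E = "E0 n p q A M F B a b \<nu> x"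
  let ?N = "CARD('N) - 1"
  define \<omega> where "\<omega> = unit_ball_vol (real ?N)"
  let ?t = "\<lambda>\<rho>. t * (\<omega> * \<rho> ^ ?N)"
  let ?P = "\<lambda>\<rho>. LINT y|lebesgue_on (half_ball \<rho> x \<nu>). powq (w y - a) q" and ?Q = "\<lambda>\<rho>. LINT y|lebesgue_on (half_ball \<rho> x (- \<nu>)). powq (w y - b) q"
  define I where "I = unit_cube (B \<nu>)"
  let ?G = "\<lambda>\<epsilon> y. F (scaled_jet \<Omega> n \<epsilon> (u \<epsilon>) y) y"
  let ?en = "\<lambda>\<epsilon> \<rho>. ennreal (1 / \<epsilon>) * (\<integral>\<^sup>+y. ennreal (?G \<epsilon> y) \<partial>lebesgue_on (cball x \<rho>))"
  assume "\<not> ?thesis"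
  then have contra: "Liminf (at_right 0) (\<lambda>\<epsilon>. ?en \<epsilon> \<rho>) < ennreal (?t \<rho>)" if "0 < \<rho>" "\<rho> < \<delta>0" for \<rho>
    using that unfolding \<omega>_def by (meson not_le)
  have \<omega>: "0 < \<omega>" unfolding \<omega>_def by simp
  have I: "open I" unfolding I_def by (rule open_unit_cube[OF B(1)])
  have Is: "I \<in> sets lebesgue" using I by simp
  have \<Omega>s: "\<Omega> \<in> sets lebesgue" using \<Omega>(1) by simp
  have card_N: "Suc ?N = CARD('N)" by simp
  \<comment> \<open>The gap between t and t' absorbs the losses of the construction; t' tends to t
    at the end.\<close>
  have "?E \<le> ennreal t'" if t': "t < t'" for t'
  proof (rule E0_le, fold I_def)
    fix \<kappa> :: real assume \<kappa>: "0 < \<kappa>"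
    define \<theta> where "\<theta> = t / t'"
    have \<theta>: "0 < \<theta>" "\<theta> < 1" using t(1) t' by (auto simp: \<theta>_def)
    \<comment> \<open>Freezing \<open>F\<close> and packing the disc each cost a factor 1 - \<tau>,
      and (1 - \<tau>)^2 \<ge> 1 - 2 \<tau> = t/t'.\<close>
    define \<tau> where "\<tau> = (1 - \<theta>) / 2"
    have \<tau>: "0 < \<tau>" "\<tau> < 1" using \<theta> by (auto simp: \<tau>_def)
    have "t / t' = 1 - 2 * \<tau>" unfolding \<theta>_def[symmetric] \<tau>_def by (simp add: field_simps)
    also have "\<dots> \<le> (1 - \<tau>)\<^sup>2" by (simp add: power2_eq_square algebra_simps)
    finally have "t \<le> t' * ((1 - \<tau>) * (1 - \<tau>))"
      using t(1) t' by (simp add: pos_divide_le_eq power2_eq_square mult.commute)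
    moreover have "0 < (1 - \<tau>) * (1 - \<tau>)" using \<tau> by simp
    ultimately have \<tau>t: "t / ((1 - \<tau>) * (1 - \<tau>)) \<le> t'" by (simp only: pos_divide_le_eq)
    obtain r Z where Z: "0 < r" "finite Z" "\<And>z. z \<in> Z \<Longrightarrow> z \<bullet> \<nu> = 0"
      "\<And>z. z \<in> Z \<Longrightarrow> zoom z r ` I \<subseteq> ball 0 1"
      "pairwise (\<lambda>z z'. disjnt (zoom z r ` I) (zoom z' r ` I)) Z"
      "(1 - \<tau>) * \<omega> \<le> real (card Z) * r ^ ?N"
      unfolding \<omega>_def I_def by (rule disc_packing[OF B(1,2) \<tau>]) blast
    have "0 < (1 - \<tau>) * \<omega>" using \<tau> \<omega> by simp
    then have cardZ: "0 < card Z" using Z(6) by (cases "card Z = 0") auto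
    obtain \<alpha> where \<alpha>: "0 < \<alpha>" "\<And>J y. J \<in> jets n \<Longrightarrow> norm (y - x) < \<alpha> \<Longrightarrow> F J y - F J x \<ge> - \<tau> * F J x"
      using Fx[OF \<tau>(1)] by blast
    obtain d where d: "0 < d" "cball x d \<subseteq> \<Omega>" using \<Omega> open_contains_cball by blast
    \<comment> \<open>The jump estimate is proportional to the volume of the ball of radius \<rho>,
      and rescaling divides it by (\<rho> r)^N. The radius cancels, so \<sigma> can be fixed before
      \<rho>.\<close>
    define C where "C j = 2 powr q $ j * 3 * unit_ball_vol (real CARD('N)) / r ^ CARD('N)" for j
    have C0: "0 \<le> C j" for j unfolding C_def using Z(1) by simp
    obtain \<sigma> where \<sigma>: "0 < \<sigma>" "(\<Sum>j\<in>UNIV. (C j * \<sigma>) powr (1 / q $ j)) < \<kappa>"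
      using small_powr_sum[OF \<kappa>, of "\<lambda>j. 1 / q $ j" C] C0 q by (metis less_le_trans zero_less_divide_1_iff zero_less_one)
    have "eventually (\<lambda>\<rho>. (0 < \<rho> \<and> \<rho> < min (min \<delta>0 \<alpha>) d) \<and>
        ?P \<rho> / measure lebesgue (ball x \<rho>) < \<sigma> \<and>
        ?Q \<rho> / measure lebesgue (ball x \<rho>) < \<sigma>) (at_right 0)"
      using \<delta>0 \<alpha>(1) d(1) \<sigma>(1)
      by (intro eventually_conj eventually_at_right_0_less order_tendstoD(2)[OF lim_p] order_tendstoD(2)[OF lim_m]) auto
    then obtain \<rho> where \<rho>: "0 < \<rho>" "\<rho> < \<delta>0" "\<rho> < \<alpha>" "\<rho> < d"
        "?P \<rho> / measure lebesgue (ball x \<rho>) < \<sigma>"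
        "?Q \<rho> / measure lebesgue (ball x \<rho>) < \<sigma>"
      using eventually_happens'[OF trivial_limit_at_right_real] by force
    let ?V = "ball x \<rho>"
    define e where "e = \<sigma> * measure lebesgue ?V"
    have vol: "measure lebesgue ?V = unit_ball_vol (real CARD('N)) * \<rho> ^ CARD('N)"
      using content_ball[of \<rho> x] \<rho>(1) by simp
    have vol0: "0 < measure lebesgue ?V" unfolding vol using \<rho>(1) by simp
    have e: "0 < e" using \<sigma> vol0 by (simp add: e_def)
    have p: "?P \<rho> \<le> e"
      and m: "?Q \<rho> \<le> e"
      using \<rho>(5,6) vol0 by (auto simp: e_def pos_divide_less_eq)
    have cb: "cball x \<rho> \<subseteq> \<Omega>" using d(2) \<rho>(4) subset_cball[of \<rho> d x] by auto
    have V: "compactly_inside ?V \<Omega>" using half_ball_compactly_inside(2)[OF cb \<rho>(1)] .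
    define s where "s = \<rho> * r"
    have s: "0 < s" using \<rho>(1) Z(1) by (simp add: s_def)
    \<comment> \<open>The contradiction hypothesis concerns a lower limit and gives small energy
      only for arbitrarily small \<epsilon>, not for all of them. One such \<epsilon> is enough,
      picked together with the conditions that hold eventually.\<close>
    have freq: "frequently (\<lambda>\<epsilon>. ?en \<epsilon> \<rho> < ennreal (?t \<rho>)) (at_right 0)"
    proof (rule ccontr)
      assume "\<not> ?thesis"
      then have "eventually (\<lambda>\<epsilon>. ennreal (?t \<rho>) \<le> ?en \<epsilon> \<rho>) (at_right 0)"
        by (simp add: not_frequently not_less)
      then have "ennreal (?t \<rho>) \<le> Liminf (at_right 0) (\<lambda>\<epsilon>. ?en \<epsilon> \<rho>)" by (rule Liminf_bounded)
      with contra[OF \<rho>(1,2)] show False by simp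
    qed
    have "eventually (\<lambda>\<epsilon>. (0 < \<epsilon> \<and> \<epsilon> < \<kappa> * s) \<and> Lq_norm ?V q (\<lambda>y. u \<epsilon> y - w y) < min e 1) (at_right 0)"
      using u(5) V \<kappa> s e
      by (intro eventually_conj eventually_at_right_0_less order_tendstoD(2)[where y=0]) (auto simp: tendsto_Lq_loc_def tendsto_Lq_def)
    from frequently_ex[OF frequently_eventually_conj[OF freq this]] obtain \<epsilon> where \<epsilon>: "0 < \<epsilon>" "\<epsilon> < \<kappa> * s" "Lq_norm ?V q (\<lambda>y. u \<epsilon> y - w y) < min e 1"
        "?en \<epsilon> \<rho> < ennreal (?t \<rho>)"
      by blast
    have u\<epsilon>: "u \<epsilon> \<in> Lq_loc \<Omega> q" "u \<epsilon> \<in> sobolev_loc \<Omega> n p" "loc_integrable \<Omega> (u \<epsilon>)"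
      using u(2,3)[OF \<epsilon>(1)] by (auto simp: represented_by_def)
    let ?J = "\<lambda>S. \<integral>\<^sup>+y. ennreal (?G \<epsilon> y) \<partial>lebesgue_on S"
    define K where "K = \<epsilon> * (?t \<rho>)"
    have K: "0 \<le> K" using \<epsilon> t \<omega> \<rho> by (simp add: K_def)
    have EV: "?J (cball x \<rho>) \<le> ennreal K"
    proof -
      have "?J (cball x \<rho>) = (ennreal \<epsilon> * ennreal (1 / \<epsilon>)) * ?J (cball x \<rho>)"
        using \<epsilon>(1) by (simp add: ennreal_mult[symmetric])
      also have "\<dots> = ennreal \<epsilon> * ?en \<epsilon> \<rho>" by (simp add: mult.assoc)
      also have "\<dots> \<le> ennreal \<epsilon> * ennreal (?t \<rho>)" by (intro mult_left_mono less_imp_le[OF \<epsilon>(4)]) simp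
      also have "\<dots> = ennreal K" using \<epsilon> t \<omega> \<rho> by (simp add: K_def ennreal_mult)
      finally show ?thesis .
    qed
    \<comment> \<open>The packing of the unit disc is scaled by \<rho> and moved to x: the cubes
      have edge s = \<rho> r and centres on the jump hyperplane.\<close>
    let ?T = "\<lambda>z y. (x + \<rho> *\<^sub>R z) + s *\<^sub>R y"
    have T: "?T z y = x + \<rho> *\<^sub>R (z + r *\<^sub>R y)" for z y by (simp add: s_def scaleR_add_right)
    have sub: "?T z ` I \<subseteq> ?V" if "z \<in> Z" for z
    proof
      fix y assume "y \<in> ?T z ` I"
      then obtain y' where y': "y' \<in> I" "y = x + \<rho> *\<^sub>R (z + r *\<^sub>R y')" unfolding T by blast
      then have "norm (z + r *\<^sub>R y') < 1" using Z(4)[OF that] by auto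
      then have "\<rho> * norm (z + r *\<^sub>R y') < \<rho> * 1" using \<rho>(1) by (intro mult_strict_left_mono) auto
      then show "y \<in> ?V" using y'(2) \<rho>(1) by (simp add: dist_norm del: scaleR_add_right)
    qed
    have TI: "compactly_inside (?T z ` I) \<Omega>" if "z \<in> Z" for z
    proof -
      have "closure (?T z ` I) \<subseteq> cball x \<rho>" using sub[OF that] ball_subset_cball by (intro closure_minimal) blast+
      moreover have "bounded (?T z ` I)" using sub[OF that] bounded_ball bounded_subset by blast
      moreover have "open (?T z ` I)" using open_affinity[OF I, of s "x + \<rho> *\<^sub>R z"] s by auto
      ultimately show ?thesis using cb by (auto simp: compactly_inside_def)
    qed
    have "(\<Sum>z\<in>Z. \<integral>\<^sup>+y. ennreal (?G \<epsilon> y) \<partial>lebesgue_on (?T z ` I)) \<le> ?J (cball x \<rho>)"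
    proof (rule sum_nn_integral_disjoint_le[OF Z(2), where V="?V"])
      show "?T z ` I \<in> sets lebesgue \<and> ?T z ` I \<subseteq> ?V" if "z \<in> Z" for z
        using TI[OF that] sub[OF that] by (auto simp: compactly_inside_def)
      show "(\<lambda>y. ennreal (?G \<epsilon> y)) \<in> borel_measurable (lebesgue_on ?V)"
        using energy_density_measurable[OF F(1) u\<epsilon>(2,3) V] by measurable
      show "?T z ` I \<subseteq> cball x \<rho>" if "z \<in> Z" for z using sub[OF that] ball_subset_cball by blast
      show "pairwise (\<lambda>z z'. disjnt (?T z ` I) (?T z' ` I)) Z"
      proof (rule pairwiseI)
        fix z z' assume zz: "z \<in> Z" "z' \<in> Z" "z \<noteq> z'"
        have "?T z y \<noteq> ?T z' y'" if "y \<in> I" "y' \<in> I" for y y'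
        proof -
          have "z + r *\<^sub>R y \<noteq> z' + r *\<^sub>R y'"
            using Z(5) zz that by (force simp: pairwise_def disjnt_iff)
          then show ?thesis unfolding T using \<rho>(1) by (simp del: scaleR_add_right)
        qed
        then show "disjnt (?T z ` I) (?T z' ` I)" by (auto simp: disjnt_iff)
      qed
    qed auto
    also note EV
    finally obtain z where z: "z \<in> Z" "?J (?T z ` I) \<le> ennreal (K / real (card Z))"
      by (rule ennreal_pigeonhole[OF Z(2) cardZ _ K])
    let ?x0 = "x + \<rho> *\<^sub>R z"
    let ?W = "\<lambda>y. u \<epsilon> (zoom ?x0 s y)"
    let ?\<Phi> = "\<lambda>\<phi>. (1/s) ^ (CARD('N) + 1) *\<^sub>R v \<epsilon> (\<lambda>y. \<phi> (- ((1/s) *\<^sub>R ?x0) + (1/s) *\<^sub>R y))"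
    note TIz = TI[OF z(1)]
    have T\<Omega>: "?T z ` I \<subseteq> \<Omega>" using order_trans[OF sub[OF z(1)] order_trans[OF ball_subset_cball cb]] .
    have 1: "distribution I ?\<Phi>"
      by (rule distribution_affine[OF u(1)[OF \<epsilon>(1)] s]) (use T\<Omega> in blast)
    have 2: "represented_by I (A_grad A ?\<Phi>) ?W"
      by (rule represented_pull[OF s I \<Omega>(1) TIz A u(1)[OF \<epsilon>(1)] u(2)[OF \<epsilon>(1)]])
    have 3: "?W \<in> Lq I q \<inter> sobolev I n p"
      using Lq_pull[OF s I \<Omega>(1) TIz u\<epsilon>(1), of 1] sobolev_pull[OF s I \<Omega>(1) TIz u\<epsilon>(2)] by simp
    have "AE y in lebesgue_on (?T z ` I). u \<epsilon> y \<in> M"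
    proof -
      have "AE y in lebesgue. y \<in> \<Omega> \<longrightarrow> u \<epsilon> y \<in> M" using u(4)[OF \<epsilon>(1)] \<Omega>s by (simp add: AE_restrict_space_iff)
      then have "AE y in lebesgue. y \<in> ?T z ` I \<longrightarrow> u \<epsilon> y \<in> M"
        by eventually_elim (use T\<Omega> in blast)
      then show ?thesis using TIz by (simp add: AE_restrict_space_iff compactly_inside_def)
    qed
    then have 4: "AE y in lebesgue_on I. ?W y \<in> M"
      using s by (intro AE_on_affine[OF _ Is]) auto
    have 5: "Lq_norm I q (\<lambda>y. ?W y - \<xi> y a b \<nu>) < \<kappa>"
    proof -
      have "(\<integral>\<^sup>+y. ennreal (\<bar>(?W y - \<xi> y a b \<nu>) $ j\<bar> powr q $ j) \<partial>lebesgue_on I) \<le> ennreal (C j * \<sigma>)" for j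
      proof -
        have "(\<integral>\<^sup>+y. ennreal (\<bar>(u \<epsilon> y - w y) $ j\<bar> powr q $ j) \<partial>lebesgue_on ?V) \<le> ennreal (min e 1)"
          using V u\<epsilon>(1) w q \<epsilon>(3) by (intro nn_integral_le_of_Lq_norm Lq_diff) (auto simp: Lq_loc_def)
        also have "\<dots> \<le> ennreal e" by (rule ennreal_leI) simp
        finally have "(\<integral>\<^sup>+y. ennreal (\<bar>(u \<epsilon> y - \<xi> (y - x) a b \<nu>) $ j\<bar> powr q $ j) \<partial>lebesgue_on ?V) \<le> ennreal (2 powr q $ j * (3 * e))"
          using e by (intro jump_distance_le[OF w u\<epsilon>(1) q cb \<rho>(1) B(3) _ p m]) auto
        then have "(\<integral>\<^sup>+y. ennreal (\<bar>(?W y - \<xi> y a b \<nu>) $ j\<bar> powr q $ j) \<partial>lebesgue_on I) \<le> ennreal (2 powr q $ j * (3 * e) / s ^ CARD('N))"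
          using e Z(3)[OF z(1)] sub[OF z(1)] by (intro rescaled_Lq_norm_le[OF s I TIz _ _ u\<epsilon>(1)]) auto
        also have "2 powr q $ j * (3 * e) / s ^ CARD('N) = C j * \<sigma>"
          unfolding e_def vol C_def s_def using \<rho>(1) Z(1) by (simp add: power_mult_distrib)
        finally show ?thesis .
      qed
      then have "Lq_norm I q (\<lambda>y. ?W y - \<xi> y a b \<nu>) \<le> (\<Sum>j\<in>UNIV. (C j * \<sigma>) powr (1 / q $ j))"
        using C0 \<sigma>(1) q by (intro Lq_norm_le) auto
      with \<sigma>(2) show ?thesis by simp
    qed
    have "ennreal (1 / (\<epsilon> / s)) * (\<integral>\<^sup>+y. ennreal (F (scaled_jet I n (\<epsilon> / s) ?W y) x) \<partial>lebesgue_on I)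
        \<le> ennreal (s / \<epsilon> / ((1 - \<tau>) * s ^ CARD('N))) * ?J (?T z ` I)"
    proof (rule rescaled_energy_le[OF s I \<Omega>(1) TIz F u\<epsilon>(2,3) \<tau>(2) _ \<epsilon>(1)])
      fix J :: "'N list \<Rightarrow> real^'m" and y assume J: "J \<in> jets n" and "y \<in> ?T z ` I"
      then have "norm (y - x) < \<alpha>" using sub[OF z(1)] \<rho>(3) by (auto simp: dist_norm norm_minus_commute)
      from \<alpha>(2)[OF J this] show "(1 - \<tau>) * F J x \<le> F J y" by (simp add: algebra_simps)
    qed
    also have "\<dots> \<le> ennreal (s / \<epsilon> / ((1 - \<tau>) * s ^ CARD('N))) * ennreal (K / real (card Z))"
      by (intro mult_left_mono z(2)) auto
    also have "\<dots> = ennreal (s / \<epsilon> / ((1 - \<tau>) * s ^ CARD('N)) * (K / real (card Z)))"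
      using s \<epsilon> \<tau> K by (subst ennreal_mult) auto
    also have "\<dots> \<le> ennreal t'"
    proof (rule ennreal_leI)
      have "s / \<epsilon> / ((1 - \<tau>) * s ^ CARD('N)) * (K / real (card Z)) = t * \<omega> / ((1 - \<tau>) * (real (card Z) * r ^ ?N))"
      proof -
        have "s ^ CARD('N) = s * (\<rho> ^ ?N * r ^ ?N)"
          using power_Suc[of s ?N] unfolding card_N by (simp add: s_def power_mult_distrib)
        \<comment> \<open>With c1 = s, c2 = \<epsilon>, c3 = 1 - \<tau>, c4 = \<rho>^(N-1), c5 =
          r^(N-1) and c6 = \<open>card Z\<close>: the scales cancel and apart from c3 only the
          packing density c6 * c5 remains.\<close>
        moreover have "c1 / c2 / (c3 * (c1 * (c4 * c5))) * (c2 * (t * (\<omega> * c4)) / c6) = t * \<omega> / (c3 * (c6 * c5))"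
          if "c1 \<noteq> 0" "c2 \<noteq> 0" "c3 \<noteq> 0" "c4 \<noteq> 0" "c5 \<noteq> 0" "c6 \<noteq> 0" for c1 c2 c3 c4 c5 c6
          using that by (simp add: field_simps)
        ultimately show ?thesis
          using s \<epsilon>(1) \<tau> \<rho>(1) Z(1) cardZ by (simp only: K_def) simp
      qed
      also have "\<dots> \<le> t * \<omega> / ((1 - \<tau>) * ((1 - \<tau>) * \<omega>))"
        using Z(1,6) cardZ \<tau> \<omega> t(1) by (intro divide_left_mono mult_left_mono mult_pos_pos) auto
      also have "\<dots> = t / ((1 - \<tau>) * (1 - \<tau>))" using \<omega> by simp
      also note \<tau>t
      finally show "s / \<epsilon> / ((1 - \<tau>) * s ^ CARD('N)) * (K / real (card Z)) \<le> t'" .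
    qed
    finally have 6: "ennreal (1 / (\<epsilon> / s)) * (\<integral>\<^sup>+y. ennreal (F (scaled_jet I n (\<epsilon> / s) ?W y) x) \<partial>lebesgue_on I) \<le> ennreal t'" .
    have 7: "0 < \<epsilon> / s" "\<epsilon> / s < \<kappa>" using \<epsilon>(1,2) s by (auto simp: pos_divide_less_eq)
    show "\<exists>\<delta> (\<Phi> :: (real^'N \<Rightarrow> real) \<Rightarrow> real^'d) W. 0 < \<delta> \<and> \<delta> < \<kappa> \<and>
      distribution I \<Phi> \<and> represented_by I (A_grad A \<Phi>) W \<and> W \<in> Lq I q \<inter> sobolev I n p \<and>
      (AE y in lebesgue_on I. W y \<in> M) \<and> Lq_norm I q (\<lambda>y. W y - \<xi> y a b \<nu>) < \<kappa> \<and>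
      ennreal (1 / \<delta>) * (\<integral>\<^sup>+y. ennreal (F (scaled_jet I n \<delta> W y) x) \<partial>lebesgue_on I) \<le> ennreal t'"
      by (intro exI[of _ "\<epsilon> / s"] exI[of _ ?\<Phi>] exI[of _ ?W] conjI 1 2 3 4 5 6 7)
  qed
  then have "?E \<le> ennreal (t + e)" if "0 < e" for e
    using that by simp
  then have "?E \<le> ennreal t + ennreal e" if "0 < e" for e
    using that t(1) by simp
  then have "?E \<le> ennreal t" by (rule ennreal_le_epsilon)
  with t(2) show False by simp
qed

section \<open>The lower bound\<close>

text \<open>Superadditivity of the lower limits of the energies rests on this. A lower limit is a
  supremum of infima; moving an addition inside a supremum needs a nonempty index set, which the
  constantly true predicate witnesses.\<close>

lemma Liminf_add_le_ennreal:
  fixes f g :: "'a \<Rightarrow> ennreal"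
  shows "Liminf F f + Liminf F g \<le> Liminf F (\<lambda>x. f x + g x)"
proof -
  have "(INF x\<in>Collect P. f x) + (INF x\<in>Collect Q. g x) \<le> Liminf F (\<lambda>x. f x + g x)"
    if "eventually P F" "eventually Q F" for P Q
  proof (rule Liminf_bounded, use that in eventually_elim)
    case (elim x)
    then show ?case by (intro add_mono INF_lower) auto
  qed
  then have "(INF x\<in>Collect P. f x) + Liminf F g \<le> Liminf F (\<lambda>x. f x + g x)" if "eventually P F" for P
    unfolding Liminf_def[of F g] using that
    by (subst ennreal_SUP_add_right) (auto intro!: SUP_least exI[of _ "\<lambda>_. True"])
  then show ?thesis
    unfolding Liminf_def[of F f]
    by (subst ennreal_SUP_add_left[symmetric]) (auto intro!: SUP_least exI[of _ "\<lambda>_. True"])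
qed

lemma sum_Liminf_le_ennreal:
  fixes f :: "'i \<Rightarrow> 'a \<Rightarrow> ennreal"
  assumes "finite I"
  shows "(\<Sum>i\<in>I. Liminf F (f i)) \<le> Liminf F (\<lambda>x. \<Sum>i\<in>I. f i x)"
  using assms
proof (induction I rule: finite_induct)
  case (insert i I)
  have "Liminf F (f i) + (\<Sum>i\<in>I. Liminf F (f i)) \<le> Liminf F (f i) + Liminf F (\<lambda>x. \<Sum>i\<in>I. f i x)"
    by (intro add_left_mono insert)
  also have "\<dots> \<le> Liminf F (\<lambda>x. f i x + (\<Sum>i\<in>I. f i x))" by (rule Liminf_add_le_ennreal)
  finally show ?case using insert by simp
qed simp

text \<open>Finitely many disjoint compact sets have positive mutual distances, and neighbourhoods
  of half the smallest one remain disjoint. The 1 in the minimum covers an empty index set.\<close>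

lemma separated_open_nbhds:
  fixes K :: "'i \<Rightarrow> 'a::euclidean_space set"
  assumes "finite Y" "\<And>y. y \<in> Y \<Longrightarrow> compact (K y)" "pairwise (\<lambda>y y'. disjnt (K y) (K y')) Y"
  obtains U where "\<And>y. y \<in> Y \<Longrightarrow> open (U y) \<and> K y \<subseteq> U y" "pairwise (\<lambda>y y'. disjnt (U y) (U y')) Y"
proof -
  have "\<exists>d>0. y \<in> Y \<longrightarrow> y' \<in> Y \<longrightarrow> y \<noteq> y' \<longrightarrow> (\<forall>a\<in>K y. \<forall>b\<in>K y'. d \<le> dist a b)" for y y'
  proof (cases "y \<in> Y \<and> y' \<in> Y \<and> y \<noteq> y'")
    case True
    then have "K y \<inter> K y' = {}" using assms(3) by (auto simp: pairwise_def disjnt_def)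
    then show ?thesis
      using separate_compact_closed[of "K y" "K y'"] assms(2) True compact_imp_closed by metis
  qed (auto intro: exI[of _ 1])
  then obtain d where d: "\<And>y y'. 0 < d y y'"
      "\<And>y y' a b. y \<in> Y \<Longrightarrow> y' \<in> Y \<Longrightarrow> y \<noteq> y' \<Longrightarrow> a \<in> K y \<Longrightarrow> b \<in> K y' \<Longrightarrow> d y y' \<le> dist a b"
    by metis
  have fin: "finite (insert 1 ((\<lambda>(y, y'). d y y') ` (Y \<times> Y)))" using assms(1) by simp
  define m where "m = Min (insert 1 ((\<lambda>(y, y'). d y y') ` (Y \<times> Y)))"
  have m0: "0 < m" unfolding m_def using d(1) by (subst Min_gr_iff[OF fin]) auto
  have m: "m \<le> d y y'" if "y \<in> Y" "y' \<in> Y" for y y'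
    unfolding m_def using that by (intro Min_le[OF fin]) auto
  define U where "U y = (\<Union>a\<in>K y. ball a (m/2))" for y
  show ?thesis
  proof (rule that[of U])
    show "open (U y) \<and> K y \<subseteq> U y" for y using m0 by (auto simp: U_def)
    show "pairwise (\<lambda>y y'. disjnt (U y) (U y')) Y"
    proof (rule pairwiseI, rule ccontr)
      fix y y' assume y: "y \<in> Y" "y' \<in> Y" "y \<noteq> y'" and "\<not> disjnt (U y) (U y')"
      then obtain a b x where "a \<in> K y" "b \<in> K y'" "dist a x < m/2" "dist b x < m/2"
        by (auto simp: U_def disjnt_iff)
      then show False using d(2)[OF y, of a b] m[OF y(1,2)] dist_triangle2[of a b x] by linarith
    qed
  qed
qed

theorem theorem2p2:
  fixes n :: nat and M :: "(real^'m::finite) set"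
    and \<Omega> D :: "(real^'N::finite) set"
    and F :: "('N list \<Rightarrow> real^'m) \<Rightarrow> real^'N \<Rightarrow> real"
    and A :: "real^'N^'d::finite \<Rightarrow> real^'m"
    and q :: "real^'m" and p :: real
    and B :: "real^'N \<Rightarrow> (real^'N) set"
    and v :: "(real^'N \<Rightarrow> real) \<Rightarrow> real^'d"
    and w :: "real^'N \<Rightarrow> real^'m"
    and w_plus w_minus :: "real^'N \<Rightarrow> real^'m"
    and nrm :: "real^'N \<Rightarrow> real^'N"
    and v\<epsilon> :: "real \<Rightarrow> (real^'N \<Rightarrow> real) \<Rightarrow> real^'d"
    and w\<epsilon> :: "real \<Rightarrow> real^'N \<Rightarrow> real^'m"
  assumes "n \<ge> 1"
    and "open \<Omega>"
    and "D \<subseteq> \<Omega>" and "D \<in> sets borel"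
    and "sigma_finite_measure (restrict_space (hausdorff_measure (CARD('N) - 1)) D)"
    and "continuous_on (jets n \<times> UNIV) (\<lambda>(J, x). F J x)"
    and "\<And>J x. J \<in> jets n \<Longrightarrow> F J x \<ge> 0"
    and "\<And>x0 \<tau>. x0 \<in> \<Omega> \<Longrightarrow> \<tau> > 0 \<Longrightarrow>
           \<exists>\<alpha>>0. \<forall>J\<in>jets n. \<forall>x. norm (x - x0) < \<alpha> \<longrightarrow> F J x - F J x0 \<ge> - \<tau> * F J x0"
    and "linear A"
    and "\<And>j. q $ j \<ge> 1" and "p \<ge> 1"
    and "\<And>\<nu>. norm \<nu> = 1 \<Longrightarrow> orthonormal_basis (B \<nu>) \<and> \<nu> \<in> B \<nu>"
    and "distribution \<Omega> v"
    and "represented_by \<Omega> (A_grad A v) w" and "w \<in> Lq_loc \<Omega> q"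
    and "AE x in lebesgue_on \<Omega>. F (\<lambda>\<alpha>. if \<alpha> = [] then w x else 0) x = 0"
    and "w_plus \<in> borel_measurable (restrict_space borel D)"
    and "w_minus \<in> borel_measurable (restrict_space borel D)"
    and "nrm \<in> borel_measurable (restrict_space borel D)"
    and "\<And>x. x \<in> D \<Longrightarrow> norm (nrm x) = 1"
    and "\<And>x. x \<in> D \<Longrightarrow>
           ((\<lambda>\<rho>. (LINT y|lebesgue_on (half_ball \<rho> x (nrm x)). powq (w y - w_plus x) q)
                  / measure lebesgue (ball x \<rho>)) \<longlongrightarrow> 0) (at_right 0)"
    and "\<And>x. x \<in> D \<Longrightarrow>
           ((\<lambda>\<rho>. (LINT y|lebesgue_on (half_ball \<rho> x (- nrm x)). powq (w y - w_minus x) q)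
                  / measure lebesgue (ball x \<rho>)) \<longlongrightarrow> 0) (at_right 0)"
    and "\<And>\<epsilon>. \<epsilon> > 0 \<Longrightarrow> distribution \<Omega> (v\<epsilon> \<epsilon>)"
    and "\<And>\<epsilon>. \<epsilon> > 0 \<Longrightarrow> represented_by \<Omega> (A_grad A (v\<epsilon> \<epsilon>)) (w\<epsilon> \<epsilon>)"
    and "\<And>\<epsilon>. \<epsilon> > 0 \<Longrightarrow> w\<epsilon> \<epsilon> \<in> Lq_loc \<Omega> q \<inter> sobolev_loc \<Omega> n p"
    and "\<And>\<epsilon>. \<epsilon> > 0 \<Longrightarrow> AE x in lebesgue_on \<Omega>. w\<epsilon> \<epsilon> x \<in> M"
    and "tendsto_Lq_loc \<Omega> q w\<epsilon> w"
  shows "Liminf (at_right 0) (\<lambda>\<epsilon>. ennreal (1 / \<epsilon>) *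
           (\<integral>\<^sup>+x. ennreal (F (scaled_jet \<Omega> n \<epsilon> (w\<epsilon> \<epsilon>) x) x) \<partial>lebesgue_on \<Omega>))
         \<ge> (\<integral>\<^sup>+x\<in>D. E0 n p q A M F B (w_plus x) (w_minus x) (nrm x) x
               \<partial>hausdorff_measure (CARD('N) - 1))"
proof -
  let ?k = "CARD('N) - 1"
  let ?H = "hausdorff_measure ?k :: (real^'N) measure"
  let ?h = "hausdorff_outer ?k :: (real^'N) set \<Rightarrow> ennreal"
  let ?E0 = "\<lambda>x. E0 n p q A M F B (w_plus x) (w_minus x) (nrm x) x"
  define en where "en \<epsilon> S = ennreal (1 / \<epsilon>) * (\<integral>\<^sup>+x. ennreal (F (scaled_jet \<Omega> n \<epsilon> (w\<epsilon> \<epsilon>) x) x) \<partial>lebesgue_on S)" for \<epsilon> S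
  define m where "m S = Liminf (at_right 0) (\<lambda>\<epsilon>. en \<epsilon> S)" for S
  have \<Omega>: "open \<Omega>" by fact
  \<comment> \<open>\<open>V\<close> provides measurability of the energy density, the
    \<open>C i\<close> are disjoint pieces inside it, and \<open>S\<close> is the set that contains
    them, possibly all of \<Omega>.\<close>
  have super: "(\<Sum>i\<in>I. m (C i)) \<le> m S"
    if "finite I" and V: "compactly_inside V \<Omega>" "\<And>i. i \<in> I \<Longrightarrow> C i \<in> sets lebesgue \<and> C i \<subseteq> V"
      and disj: "pairwise (\<lambda>i i'. disjnt (C i) (C i')) I"
      and S: "S \<in> sets lebesgue" "\<And>i. i \<in> I \<Longrightarrow> C i \<subseteq> S" for I :: "'i set" and C V S
  proof -
    have "(\<Sum>i\<in>I. m (C i)) \<le> Liminf (at_right 0) (\<lambda>\<epsilon>. \<Sum>i\<in>I. en \<epsilon> (C i))"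
      unfolding m_def by (rule sum_Liminf_le_ennreal) fact
    also have "\<dots> \<le> m S"
      unfolding m_def
    proof (rule Liminf_mono)
      have "eventually (\<lambda>\<epsilon>. 0 < \<epsilon> \<and> \<epsilon> < 1) (at_right (0::real))" by (rule eventually_at_right_0_less) simp
      then show "eventually (\<lambda>\<epsilon>. (\<Sum>i\<in>I. en \<epsilon> (C i)) \<le> en \<epsilon> S) (at_right 0)"
      proof eventually_elim
        case (elim \<epsilon>)
        have "(\<lambda>x. F (scaled_jet \<Omega> n \<epsilon> (w\<epsilon> \<epsilon>) x) x) \<in> borel_measurable (lebesgue_on V)"
          using assms(24,25)[of \<epsilon>] elim V(1)
          by (intro energy_density_measurable[OF assms(6)]) (auto simp: represented_by_def)
        then have "(\<lambda>x. ennreal (F (scaled_jet \<Omega> n \<epsilon> (w\<epsilon> \<epsilon>) x) x)) \<in> borel_measurable (lebesgue_on V)"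
          by measurable
        then show ?case
          unfolding en_def sum_distrib_left[symmetric]
          using that(1) V disj S
          by (intro mult_left_mono sum_nn_integral_disjoint_le[where V=V]) (auto simp: compactly_inside_def)
      qed
    qed
    finally show ?thesis .
  qed
  \<comment> \<open>A finite \<open>m U\<close> is the real bound that the covering lemma requires.
    Finitely many closed balls in \<open>U\<close> form a compact set with a neighbourhood compactly
    inside \<Omega>, so superadditivity applies to them.\<close>
  have dens: "ennreal t * ?h E \<le> m U"
    if t: "0 < t" and E: "E \<subseteq> D" "\<And>x. x \<in> E \<Longrightarrow> ennreal t < ?E0 x"
      and U: "open U" "E \<subseteq> U" "U \<subseteq> \<Omega>" for t E U
  proof (cases "m U")
    case (real l)
    have "ennreal t * ?h E \<le> ennreal l"
    proof (rule hausdorff_le_of_density[OF t U(1,2) real(1), where m=m])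
      fix x and \<delta> :: real assume "0 < \<delta>" and x: "x \<in> E"
      then have xD: "x \<in> D" "x \<in> \<Omega>" using E(1) assms(3) by auto
      have \<nu>: "orthonormal_basis (B (nrm x))" "nrm x \<in> B (nrm x)" "norm (nrm x) = 1"
        using assms(12)[OF assms(20)[OF xD(1)]] assms(20)[OF xD(1)] by auto
      show "\<exists>\<rho>. 0 < \<rho> \<and> \<rho> < \<delta> \<and> ennreal (t * (unit_ball_vol (real ?k) * \<rho> ^ ?k)) \<le> m (cball x \<rho>)"
        unfolding m_def en_def
        by (rule energy_density_ge[OF \<Omega> xD(2) assms(6,7) assms(8)[OF xD(2)] assms(9,10) \<nu> assms(15)
              assms(21)[OF xD(1)] assms(22)[OF xD(1)] assms(23-27) t E(2)[OF x] \<open>0 < \<delta>\<close>])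
    next
      fix P :: "((real^'N) \<times> real) set"
      assume P: "finite P" "\<And>p. p \<in> P \<Longrightarrow> 0 < snd p \<and> cball (fst p) (snd p) \<subseteq> U"
        "pairwise (\<lambda>p p'. disjnt (cball (fst p) (snd p)) (cball (fst p') (snd p'))) P"
      have "compact (\<Union>p\<in>P. cball (fst p) (snd p))" using P(1) by (intro compact_UN) auto
      moreover have "(\<Union>p\<in>P. cball (fst p) (snd p)) \<subseteq> \<Omega>" using P(2) U(3) by blast
      ultimately obtain V where V: "compactly_inside V \<Omega>" "(\<Union>p\<in>P. cball (fst p) (snd p)) \<subseteq> V"
        using compactly_inside_nbhd[OF _ \<Omega>] by metis
      have "(\<Sum>p\<in>P. m (cball (fst p) (snd p))) \<le> m U"
        using V(2) P(2) U(1) by (intro super[OF P(1) V(1) _ P(3)]) auto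
      then show "(\<Sum>p\<in>P. m (cball (fst p) (snd p))) \<le> ennreal l" using real by simp
    qed
    then show ?thesis using real by simp
  qed simp
  have "(\<integral>\<^sup>+x. ?E0 x * indicator D x \<partial>?H) \<le> m \<Omega>"
  proof (cases "m \<Omega>")
    case (real l)
    show ?thesis
      \<comment> \<open>The supremum runs over simple functions with finite values, so only finitely
        many level sets, with positive real values, have to be treated.\<close>
      unfolding nn_integral_def_finite
    proof (rule SUP_least)
      fix g assume "g \<in> {g. simple_function ?H g \<and> g \<le> (\<lambda>x. ?E0 x * indicator D x) \<and> (\<forall>x. g x < top)}"
      then have g: "simple_function ?H g" "\<And>x. g x \<le> ?E0 x * indicator D x" "\<And>x. g x < top"
        by (auto simp: le_fun_def)
      define Y where "Y = range g - {0}"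
      define E where "E y = g -` {y}" for y
      have finY: "finite Y" using simple_functionD(1)[OF g(1)] by (simp add: Y_def)
      have Es: "E y \<in> sets ?H" for y using simple_functionD(2)[OF g(1), of "{y}"] by (simp add: E_def)
      have ED: "E y \<subseteq> D" if "y \<in> Y" for y
      proof
        fix x assume "x \<in> E y"
        then show "x \<in> D" using g(2)[of x] that by (cases "x \<in> D") (auto simp: E_def Y_def)
      qed
      have Y: "0 < enn2real y" "ennreal (enn2real y) = y" if "y \<in> Y" for y
        using that g(3) by (auto simp: Y_def enn2real_positive_iff zero_less_iff_neq_zero less_top)
      have EE0: "y \<le> ?E0 x" if "y \<in> Y" "x \<in> E y" for x y
        using g(2)[of x] ED[OF that(1)] that(2) by (auto simp: E_def)
      have lt: "ennreal (\<theta> * enn2real y) < ?E0 x" if "y \<in> Y" "x \<in> E y" "0 < \<theta>" "\<theta> < 1" for \<theta> x y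
      proof -
        have "ennreal (\<theta> * enn2real y) < ennreal (enn2real y)"
          using Y(1)[OF that(1)] that(3,4) by (intro ennreal_lessI) auto
        then show ?thesis using Y(2)[OF that(1)] EE0[OF that(1,2)] by simp
      qed
      \<comment> \<open>The density bound at half the level, applied in all of \<Omega>, forces the
        level sets to have finite Hausdorff measure, as inner regularity requires.\<close>
      have finE: "?h (E y) < top" if "y \<in> Y" for y
      proof -
        have "ennreal (1/2 * enn2real y) * ?h (E y) \<le> m \<Omega>"
          using Y(1)[OF that] ED[OF that] assms(3) \<Omega> by (intro dens lt that) auto
        also have "\<dots> < top" using real by simp
        finally show ?thesis using Y(1)[OF that] by (auto simp: ennreal_mult_less_top)
      qed
      define S where "S = (\<Sum>y\<in>Y. enn2real y * enn2real (?h (E y)))"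
      have "simple_integral ?H g = (\<Sum>y\<in>range g. y * emeasure ?H (E y))"
        by (simp add: simple_integral_def E_def)
      also have "\<dots> = (\<Sum>y\<in>Y. y * emeasure ?H (E y))"
        using simple_functionD(1)[OF g(1)] by (intro sum.mono_neutral_right) (auto simp: Y_def)
      also have "\<dots> = (\<Sum>y\<in>Y. ennreal (enn2real y * enn2real (?h (E y))))"
        using Y finE Es by (intro sum.cong refl) (simp add: ennreal_mult emeasure_hausdorff)
      also have "\<dots> = ennreal S" unfolding S_def by (rule sum_ennreal) simp
      finally have gS: "simple_integral ?H g = ennreal S" .
      have "S \<le> l"
      proof (rule field_le_mult_one_interval)
        fix \<theta>2 :: real assume "0 < \<theta>2" "\<theta>2 < 1"
        \<comment> \<open>Two losses are allowed: one factor lowers the level strictly below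
          \<open>E0\<close>, the other passes to a compact subset. Each is the square root of the
          given factor.\<close>
        define \<theta> where "\<theta> = sqrt \<theta>2"
        have \<theta>: "0 < \<theta>" "\<theta> < 1" "\<theta> * \<theta> = \<theta>2" using \<open>0 < \<theta>2\<close> \<open>\<theta>2 < 1\<close> by (auto simp: \<theta>_def)
        have "\<exists>K. compact K \<and> K \<subseteq> E y \<and> ennreal \<theta> * ?h (E y) \<le> ?h K" if y: "y \<in> Y" for y
        \<comment> \<open>Inner regularity yields a compact set whose measure beats a strictly
          smaller value, so level sets of measure 0 are given the empty set instead.\<close>
        proof (cases "?h (E y) = 0")
          case True
          then show ?thesis by (intro exI[of _ "{}"]) simp
        next
          case False
          have "ennreal \<theta> * ?h (E y) < 1 * ?h (E y)"
            using False \<theta> finE[OF y] by (intro ennreal_mult_strict_right_mono) (auto simp: zero_less_iff_neq_zero)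
          then obtain K where "compact K" "K \<subseteq> E y" "ennreal \<theta> * ?h (E y) < ?h K"
            using hausdorff_inner_regular[OF Es, of y "ennreal \<theta> * ?h (E y)"] finE[OF y] by auto
          then show ?thesis using less_imp_le by blast
        qed
        then obtain K where K: "\<And>y. y \<in> Y \<Longrightarrow> compact (K y)" "\<And>y. y \<in> Y \<Longrightarrow> K y \<subseteq> E y"
            "\<And>y. y \<in> Y \<Longrightarrow> ennreal \<theta> * ?h (E y) \<le> ?h (K y)"
          by metis
        have disjK: "pairwise (\<lambda>y y'. disjnt (K y) (K y')) Y"
        proof (rule pairwiseI)
          fix y y' assume y: "y \<in> Y" "y' \<in> Y" "y \<noteq> y'"
          then have "E y \<inter> E y' = {}" by (auto simp: E_def)
          then show "disjnt (K y) (K y')" using K(2)[OF y(1)] K(2)[OF y(2)] by (auto simp: disjnt_def)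
        qed
        obtain U where U: "\<And>y. y \<in> Y \<Longrightarrow> open (U y) \<and> K y \<subseteq> U y" "pairwise (\<lambda>y y'. disjnt (U y) (U y')) Y"
          by (rule separated_open_nbhds[OF finY K(1) disjK]) blast+
        \<comment> \<open>The disjoint neighbourhoods are cut down to one set \<open>V\<close>
          compactly inside \<Omega>, as superadditivity requires.\<close>
        have "compact (\<Union>y\<in>Y. K y)" using finY K(1) by (intro compact_UN) auto
        moreover have "(\<Union>y\<in>Y. K y) \<subseteq> \<Omega>" using K(2) ED assms(3) by blast
        ultimately obtain V where V: "compactly_inside V \<Omega>" "(\<Union>y\<in>Y. K y) \<subseteq> V"
          using compactly_inside_nbhd[OF _ \<Omega>] by metis
        have Vo: "open V" "V \<subseteq> \<Omega>" using V(1) closure_subset by (auto simp: compactly_inside_def)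
        have "ennreal (\<theta>2 * S) = (\<Sum>y\<in>Y. ennreal (\<theta> * enn2real y) * (ennreal \<theta> * ?h (E y)))"
        proof -
          have "ennreal (\<theta>2 * S) = (\<Sum>y\<in>Y. ennreal ((\<theta> * enn2real y) * (\<theta> * enn2real (?h (E y)))))"
            using \<theta> by (subst sum_ennreal) (auto simp: S_def sum_distrib_left \<theta>(3)[symmetric] algebra_simps)
          also have "\<dots> = (\<Sum>y\<in>Y. ennreal (\<theta> * enn2real y) * (ennreal \<theta> * ?h (E y)))"
            using \<theta> finE by (intro sum.cong refl) (simp add: ennreal_mult)
          finally show ?thesis .
        qed
        also have "\<dots> \<le> (\<Sum>y\<in>Y. ennreal (\<theta> * enn2real y) * ?h (K y))"
          by (intro sum_mono mult_left_mono K) auto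
        also have "\<dots> \<le> (\<Sum>y\<in>Y. m (V \<inter> U y))"
        proof (rule sum_mono)
          fix y assume y: "y \<in> Y"
          show "ennreal (\<theta> * enn2real y) * ?h (K y) \<le> m (V \<inter> U y)"
          proof (rule dens)
            show "ennreal (\<theta> * enn2real y) < ?E0 x" if "x \<in> K y" for x
              using lt[OF y _ \<theta>(1,2)] K(2)[OF y] that by blast
            show "K y \<subseteq> V \<inter> U y" using V(2) U(1)[OF y] y by blast
          qed (use \<theta> Y(1)[OF y] K(2)[OF y] ED[OF y] Vo U(1)[OF y] in auto)
        qed
        also have "\<dots> \<le> m \<Omega>"
        proof (rule super[OF finY V(1)])
          show "pairwise (\<lambda>y y'. disjnt (V \<inter> U y) (V \<inter> U y')) Y"
            using U(2) by (auto simp: pairwise_def disjnt_iff)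
        qed (use Vo U(1) \<Omega> in auto)
        finally show "\<theta>2 * S \<le> l" using real by simp
      qed
      then show "simple_integral ?H g \<le> m \<Omega>" unfolding gS real(2) by (rule ennreal_leI)
    qed
  qed simp
  then show ?thesis unfolding m_def en_def .
qed

end
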